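(* Let $\Phi\subseteq V^*$ be an essential root system all of whose irreducible components are of classical type ($\mathrm A$, $\mathrm B$, $\mathrm C$ or $\mathrm D$), with root lattice $\mathcal L\subseteq V^*$. For a nonempty set $B\subseteq\mathcal L$, the following are equivalent: (a) $B$ is an M-convex set of type $\Phi$. (b) $B=\mathbf B(\rho)\cap\mathcal L$ for some integral spherical submodular function $\rho$ of type $\Phi$. (c) $B$ is hole-free, and for any $p,q\in B$ and any simple system $\Delta$ of $\Phi$ there exists $r\in B$ with $p\le_\Delta r$ and $q\le_\Delta r$ (the maximality property). (d) $B$ is hole-free, and $q-p\in\operatorname{cone}\{\alpha\in\Phi:p+\alpha\in B\}$ for all $p,q\in B$; i.e., there exist $\beta_1,\dots,\beta_k\in\Phi$ with $p+\beta_\ell\in B$ $(\ell=1,\dots,k)$ and reals $\mu_1,\dots,\mu_k\ge0$ such that $p+\sum_{\ell=1}^k\mu_\ell\beta_\ell=q$.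
   Context: Root systems. $V$ is a finite-dimensional real inner product space with dual $V^*$, $\langle p,x\rangle=p(x)$ for $p\in V^*,x\in V$; $V^*$ carries the induced inner product. For $\alpha\in V^*\setminus\{0\}$, $\alpha^\vee\in V$ is $2/\|\alpha\|^2$ times the vector of $V$ representing $\alpha$, and $s_\alpha(p)=p-\langle p,\alpha^\vee\rangle\alpha$. A root system is a nonempty finite set $\Phi\subseteq V^*\setminus\{0\}$ with $s_\alpha(\beta)\in\Phi$, $\mathbb R\alpha\cap\Phi=\{\alpha,-\alpha\}$ and $\langle\alpha,\beta^\vee\rangle\in\mathbb Z$ for all $\alpha,\beta\in\Phi$. It is essential if $\operatorname{span}\Phi=V^*$; it decomposes uniquely into mutually orthogonal irreducible components. The root lattice $\mathcal L$ is the set of integer linear combinations of roots. A simple system is a subset $\Delta=\{\alpha_1,\dots,\alpha_n\}\subseteq\Phi$ that is a basis of $V^*$ and such that every root lies in $\operatorname{cone}\Delta$ or $-\operatorname{cone}\Delta$; for $p=\sum p_i\alpha_i$, $q=\sum q_i\alpha_i$, write $p\le_\Delta q$ if $p_i\le q_i$ for all $i$. M-convexity. An M-convex cone of type $\Phi$ is $\operatorname{cone}\Phi'$ with $\Phi'\subseteq\Phi$ (conical hull; $\operatorname{cone}\emptyset=\{0\}$). An M-convex polyhedron of type $\Phi$ is a nonempty closed convex set $P\subseteq V^*$ whose tangent cone $\operatorname{cl}(\operatorname{cone}(P-p))$ at every $p\in P$ is an M-convex cone (such $P$ is a polyhedron); it is integral if $P=\operatorname{conv}(P\cap\mathcal L)$.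 A nonempty $B\subseteq\mathcal L$ is an M-convex set of type $\Phi$ if $B=P\cap\mathcal L$ for some integral M-convex polyhedron $P$. A set $B\subseteq\mathcal L$ is hole-free if $B=(\operatorname{conv}B)\cap\mathcal L$. Spherical submodularity. The linear hyperplanes $\{x\in V:\langle\alpha,x\rangle=0\}$, $\alpha\in\Phi$, partition $V$ into relatively open simplicial cones, the cells of the spherical Coxeter complex of type $\Phi$; its vertices are the one-dimensional cells (open rays). A spherical expression is obtained by choosing one point on each of these rays; let $S\subseteq V\setminus\{0\}$ be the finite set of chosen points. An L-convex cone of type $\Phi$ is a set $\{x\in V:\langle\alpha,x\rangle\le0\ \forall\alpha\in\Phi'\}$, $\Phi'\subseteq\Phi$. An L-sublinear function of type $\Phi$ is a proper function $\sigma:V\to\mathbb R\cup\{+\infty\}$ whose epigraph is a polyhedral cone and such that every nonempty set $\operatorname{argmin}(\sigma-p)$, $p\in V^*$ (where $(\sigma-p)(x)=\sigma(x)-\langle p,x\rangle$), is an L-convex cone; it is integral if there is a nonempty finite $B_0\subseteq\mathcal L$ with $\sigma(x)=\max_{p\in B_0}\langle p,x\rangle$ whenever $\sigma(x)<+\infty$. An integral spherical submodular function of type $\Phi$ is the restriction $\rho:S\to\mathbb R\cup\{+\infty\}$ of an integral L-sublinear function of type $\Phi$ to the vertex set $S$ of a spherical expression; $\mathbf B(\rho)=\{p\in V^*:\langle p,x\rangle\le\rho(x)\ \forall x\in S\}$. *)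

theory Defs
  imports "HOL-Analysis.Analysis"
begin

section \<open>The dual space\<close>

text \<open>
  The dual of a Euclidean space is the space of (bounded) linear functionals.  Its operator norm
  is the norm of the inner product induced from \<open>V\<close>, because the operator norm of a functional
  equals the norm of the vector representing it.
\<close>

type_synonym 'a dual = "'a \<Rightarrow>\<^sub>L real"

definition riesz :: "'a::euclidean_space dual \<Rightarrow> 'a" where
  "riesz p = (THE v. \<forall>x. blinfun_apply p x = v \<bullet> x)"

definition dual_inner :: "'a::euclidean_space dual \<Rightarrow> 'a dual \<Rightarrow> real" where
  "dual_inner p q = riesz p \<bullet> riesz q"

section \<open>Root systems\<close>

definition coroot :: "'a::euclidean_space dual \<Rightarrow> 'a" where
  "coroot \<alpha> = (2 / (norm \<alpha>)\<^sup>2) *\<^sub>R riesz \<alpha>"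

definition reflection :: "'a::euclidean_space dual \<Rightarrow> 'a dual \<Rightarrow> 'a dual" where
  "reflection \<alpha> p = p - blinfun_apply p (coroot \<alpha>) *\<^sub>R \<alpha>"

definition root_system :: "'a::euclidean_space dual set \<Rightarrow> bool" where
  "root_system \<Phi> \<longleftrightarrow> finite \<Phi> \<and> \<Phi> \<noteq> {} \<and> 0 \<notin> \<Phi> \<and>
     (\<forall>\<alpha>\<in>\<Phi>. \<forall>\<beta>\<in>\<Phi>. reflection \<alpha> \<beta> \<in> \<Phi>) \<and>
     (\<forall>\<alpha>\<in>\<Phi>. span {\<alpha>} \<inter> \<Phi> = {\<alpha>, - \<alpha>}) \<and>
     (\<forall>\<alpha>\<in>\<Phi>. \<forall>\<beta>\<in>\<Phi>. blinfun_apply \<alpha> (coroot \<beta>) \<in> \<int>)"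

definition essential :: "'a::euclidean_space dual set \<Rightarrow> bool" where
  "essential \<Phi> \<longleftrightarrow> span \<Phi> = UNIV"

definition irreducible_root_system :: "'a::euclidean_space dual set \<Rightarrow> bool" where
  "irreducible_root_system \<Psi> \<longleftrightarrow> root_system \<Psi> \<and>
     \<not> (\<exists>\<Psi>\<^sub>1 \<Psi>\<^sub>2. \<Psi>\<^sub>1 \<noteq> {} \<and> \<Psi>\<^sub>2 \<noteq> {} \<and> \<Psi>\<^sub>1 \<inter> \<Psi>\<^sub>2 = {} \<and> \<Psi> = \<Psi>\<^sub>1 \<union> \<Psi>\<^sub>2 \<and>
          (\<forall>\<alpha>\<in>\<Psi>\<^sub>1. \<forall>\<beta>\<in>\<Psi>\<^sub>2. dual_inner \<alpha> \<beta> = 0))"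

definition irreducible_component :: "'a::euclidean_space dual set \<Rightarrow> 'a dual set \<Rightarrow> bool" where
  "irreducible_component \<Phi> \<Psi> \<longleftrightarrow> \<Psi> \<subseteq> \<Phi> \<and> irreducible_root_system \<Psi> \<and>
     (\<forall>\<alpha>\<in>\<Psi>. \<forall>\<beta>\<in>\<Phi> - \<Psi>. dual_inner \<alpha> \<beta> = 0)"

definition root_lattice :: "'a::euclidean_space dual set \<Rightarrow> 'a dual set" where
  "root_lattice \<Phi> = {(\<Sum>\<alpha>\<in>\<Phi>. of_int (c \<alpha>) *\<^sub>R \<alpha>) | c :: 'a dual \<Rightarrow> int. True}"

subsection \<open>Classical types\<close>

text \<open>
  The standard coordinate models of the classical root systems.  Vectors of \<open>\<real>\<^sup>N\<close> are
  represented by functions \<open>nat \<Rightarrow> real\<close> that vanish from index \<open>N\<close> on, since \<open>N\<close> varies.  As usual,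
  type \<open>A\<^sub>n\<close> lives in \<open>\<real>\<^bsup>n+1\<^esup>\<close>, the other types of rank \<open>n\<close> in \<open>\<real>\<^sup>n\<close>.
\<close>

definition unit_coord :: "nat \<Rightarrow> nat \<Rightarrow> real" where
  "unit_coord i = (\<lambda>k. if k = i then 1 else 0)"

definition model_A :: "nat \<Rightarrow> (nat \<Rightarrow> real) set" where
  "model_A n = {(\<lambda>k. unit_coord i k - unit_coord j k) | i j. i < n + 1 \<and> j < n + 1 \<and> i \<noteq> j}"

definition model_D :: "nat \<Rightarrow> (nat \<Rightarrow> real) set" where
  "model_D n = {(\<lambda>k. s * unit_coord i k + t * unit_coord j k) | s t i j.
     s \<in> {1, -1} \<and> t \<in> {1, -1} \<and> i < n \<and> j < n \<and> i \<noteq> j}"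

definition model_B :: "nat \<Rightarrow> (nat \<Rightarrow> real) set" where
  "model_B n = model_D n \<union> {(\<lambda>k. s * unit_coord i k) | s i. s \<in> {1, -1} \<and> i < n}"

definition model_C :: "nat \<Rightarrow> (nat \<Rightarrow> real) set" where
  "model_C n = model_D n \<union> {(\<lambda>k. 2 * s * unit_coord i k) | s i. s \<in> {1, -1} \<and> i < n}"

definition coord_inner :: "nat \<Rightarrow> (nat \<Rightarrow> real) \<Rightarrow> (nat \<Rightarrow> real) \<Rightarrow> real" where
  "coord_inner N x y = (\<Sum>k<N. x k * y k)"

text \<open>
  Isomorphism of root systems: a linear isomorphism of the spans that maps one onto the other and
  preserves the Cartan integers \<open>\<langle>\<alpha>, \<beta>\<^sup>\<or>\<rangle>\<close>.  A map into coordinate space is linear iff all its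
  coordinates are.
\<close>

definition iso_to_model :: "'a::euclidean_space dual set \<Rightarrow> nat \<Rightarrow> (nat \<Rightarrow> real) set \<Rightarrow> bool" where
  "iso_to_model \<Psi> N R \<longleftrightarrow> (\<exists>f :: 'a dual \<Rightarrow> nat \<Rightarrow> real.
     (\<forall>k. linear (\<lambda>p. f p k)) \<and> inj_on f (span \<Psi>) \<and> f ` \<Psi> = R \<and>
     (\<forall>\<alpha>\<in>\<Psi>. \<forall>\<beta>\<in>\<Psi>. blinfun_apply \<alpha> (coroot \<beta>)
        = 2 * coord_inner N (f \<alpha>) (f \<beta>) / coord_inner N (f \<beta>) (f \<beta>)))"

text \<open>
  To be applied to irreducible root systems only.  No lower bounds on the rank \<open>n\<close> are needed: the
  models excluded by the usual bounds are empty, reducible, or isomorphic to another listed model.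
\<close>

definition classical_type :: "'a::euclidean_space dual set \<Rightarrow> bool" where
  "classical_type \<Psi> \<longleftrightarrow> (\<exists>n.
     iso_to_model \<Psi> (n + 1) (model_A n) \<or> iso_to_model \<Psi> n (model_B n) \<or>
     iso_to_model \<Psi> n (model_C n) \<or> iso_to_model \<Psi> n (model_D n))"

subsection \<open>Simple systems\<close>

definition simple_system :: "'a::euclidean_space dual set \<Rightarrow> 'a dual set \<Rightarrow> bool" where
  "simple_system \<Phi> \<Delta> \<longleftrightarrow> \<Delta> \<subseteq> \<Phi> \<and> independent \<Delta> \<and> span \<Delta> = UNIV \<and>
     (\<forall>\<alpha>\<in>\<Phi>. \<alpha> \<in> convex_cone hull \<Delta> \<or> - \<alpha> \<in> convex_cone hull \<Delta>)"

definition simple_le :: "'a::euclidean_space dual set \<Rightarrow> 'a dual \<Rightarrow> 'a dual \<Rightarrow> bool" where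
  "simple_le \<Delta> p q \<longleftrightarrow> (\<forall>\<alpha>\<in>\<Delta>. representation \<Delta> p \<alpha> \<le> representation \<Delta> q \<alpha>)"

section \<open>M-convexity\<close>

text \<open>
  The conical hull is \<open>convex_cone hull\<close> (\<open>conic hull\<close> and \<open>cone hull\<close> do not convexify); the conical hull of
  the empty set is \<open>{0}\<close>.
\<close>

definition M_convex_cone :: "'a::euclidean_space dual set \<Rightarrow> 'a dual set \<Rightarrow> bool" where
  "M_convex_cone \<Phi> C \<longleftrightarrow> (\<exists>\<Phi>'. \<Phi>' \<subseteq> \<Phi> \<and> C = convex_cone hull \<Phi>')"

definition tangent_cone :: "'a::euclidean_space dual set \<Rightarrow> 'a dual \<Rightarrow> 'a dual set" where
  "tangent_cone P p = closure (convex_cone hull ((\<lambda>q. q - p) ` P))"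

definition M_convex_polyhedron :: "'a::euclidean_space dual set \<Rightarrow> 'a dual set \<Rightarrow> bool" where
  "M_convex_polyhedron \<Phi> P \<longleftrightarrow> P \<noteq> {} \<and> closed P \<and> convex P \<and>
     (\<forall>p\<in>P. M_convex_cone \<Phi> (tangent_cone P p))"

definition integral_M_convex_polyhedron ::
    "'a::euclidean_space dual set \<Rightarrow> 'a dual set \<Rightarrow> bool" where
  "integral_M_convex_polyhedron \<Phi> P \<longleftrightarrow>
     M_convex_polyhedron \<Phi> P \<and> P = convex hull (P \<inter> root_lattice \<Phi>)"

definition M_convex_set :: "'a::euclidean_space dual set \<Rightarrow> 'a dual set \<Rightarrow> bool" where
  "M_convex_set \<Phi> B \<longleftrightarrow> B \<noteq> {} \<and> B \<subseteq> root_lattice \<Phi> \<and>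
     (\<exists>P. integral_M_convex_polyhedron \<Phi> P \<and> B = P \<inter> root_lattice \<Phi>)"

definition hole_free :: "'a::euclidean_space dual set \<Rightarrow> 'a dual set \<Rightarrow> bool" where
  "hole_free \<Phi> B \<longleftrightarrow> B = convex hull B \<inter> root_lattice \<Phi>"

section \<open>Spherical submodularity\<close>

definition coxeter_cell :: "'a::euclidean_space dual set \<Rightarrow> 'a \<Rightarrow> 'a set" where
  "coxeter_cell \<Phi> x =
     {y. \<forall>\<alpha>\<in>\<Phi>. sgn (blinfun_apply \<alpha> y) = sgn (blinfun_apply \<alpha> x)}"

definition coxeter_vertices :: "'a::euclidean_space dual set \<Rightarrow> 'a set set" where
  "coxeter_vertices \<Phi> = {C \<in> range (coxeter_cell \<Phi>). aff_dim C = 1}"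

definition spherical_expression :: "'a::euclidean_space dual set \<Rightarrow> 'a set \<Rightarrow> bool" where
  "spherical_expression \<Phi> S \<longleftrightarrow>
     S \<subseteq> \<Union> (coxeter_vertices \<Phi>) \<and> (\<forall>R\<in>coxeter_vertices \<Phi>. \<exists>!x. x \<in> S \<inter> R)"

definition L_convex_cone :: "'a::euclidean_space dual set \<Rightarrow> 'a set \<Rightarrow> bool" where
  "L_convex_cone \<Phi> C \<longleftrightarrow>
     (\<exists>\<Phi>'. \<Phi>' \<subseteq> \<Phi> \<and> C = {x. \<forall>\<alpha>\<in>\<Phi>'. blinfun_apply \<alpha> x \<le> 0})"

definition proper_fun :: "('a \<Rightarrow> ereal) \<Rightarrow> bool" where
  "proper_fun \<sigma> \<longleftrightarrow> (\<forall>x. \<sigma> x \<noteq> - \<infinity>) \<and> (\<exists>x. \<sigma> x \<noteq> \<infinity>)"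

definition ereal_epigraph :: "('a \<Rightarrow> ereal) \<Rightarrow> ('a \<times> real) set" where
  "ereal_epigraph \<sigma> = {(x, t). \<sigma> x \<le> ereal t}"

definition argmin :: "('a \<Rightarrow> ereal) \<Rightarrow> 'a set" where
  "argmin f = {x. \<forall>y. f x \<le> f y}"

definition L_sublinear :: "'a::euclidean_space dual set \<Rightarrow> ('a \<Rightarrow> ereal) \<Rightarrow> bool" where
  "L_sublinear \<Phi> \<sigma> \<longleftrightarrow> proper_fun \<sigma> \<and>
     polyhedron (ereal_epigraph \<sigma>) \<and> cone (ereal_epigraph \<sigma>) \<and>
     (\<forall>p. argmin (\<lambda>x. \<sigma> x - ereal (blinfun_apply p x)) \<noteq> {} \<longrightarrow>
          L_convex_cone \<Phi> (argmin (\<lambda>x. \<sigma> x - ereal (blinfun_apply p x))))"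

definition integral_L_sublinear :: "'a::euclidean_space dual set \<Rightarrow> ('a \<Rightarrow> ereal) \<Rightarrow> bool" where
  "integral_L_sublinear \<Phi> \<sigma> \<longleftrightarrow> L_sublinear \<Phi> \<sigma> \<and>
     (\<exists>B\<^sub>0. finite B\<^sub>0 \<and> B\<^sub>0 \<noteq> {} \<and> B\<^sub>0 \<subseteq> root_lattice \<Phi> \<and>
        (\<forall>x. \<sigma> x < \<infinity> \<longrightarrow> \<sigma> x = ereal (Max ((\<lambda>p. blinfun_apply p x) ` B\<^sub>0))))"

text \<open>
  A function on \<open>S\<close> is represented by a total function of which only the values on \<open>S\<close> matter.
\<close>

definition integral_spherical_submodular ::
    "'a::euclidean_space dual set \<Rightarrow> 'a set \<Rightarrow> ('a \<Rightarrow> ereal) \<Rightarrow> bool" where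
  "integral_spherical_submodular \<Phi> S \<rho> \<longleftrightarrow> spherical_expression \<Phi> S \<and>
     (\<exists>\<sigma>. integral_L_sublinear \<Phi> \<sigma> \<and> (\<forall>x\<in>S. \<rho> x = \<sigma> x))"

definition base_polyhedron :: "'a::euclidean_space set \<Rightarrow> ('a \<Rightarrow> ereal) \<Rightarrow> 'a dual set" where
  "base_polyhedron S \<rho> = {p. \<forall>x\<in>S. ereal (blinfun_apply p x) \<le> \<rho> x}"

section \<open>Maximality and the cone condition\<close>

definition maximality_property :: "'a::euclidean_space dual set \<Rightarrow> 'a dual set \<Rightarrow> bool" where
  "maximality_property \<Phi> B \<longleftrightarrow> (\<forall>p\<in>B. \<forall>q\<in>B. \<forall>\<Delta>. simple_system \<Phi> \<Delta> \<longrightarrow>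
     (\<exists>r\<in>B. simple_le \<Delta> p r \<and> simple_le \<Delta> q r))"

definition root_cone_property :: "'a::euclidean_space dual set \<Rightarrow> 'a dual set \<Rightarrow> bool" where
  "root_cone_property \<Phi> B \<longleftrightarrow>
     (\<forall>p\<in>B. \<forall>q\<in>B. q - p \<in> convex_cone hull {\<alpha>\<in>\<Phi>. p + \<alpha> \<in> B})"

end

theory Submission
  imports Defs
begin

text \<open>
  The Riesz isomorphism identifies \<open>V\<^sup>*\<close> with \<open>V\<close>.  The key fact is that a convex cone that is a union
  of closed cells of the Coxeter complex is cut out by roots.  Therefore a closed convex set on which
  linear functions have maxima is M-convex iff all its normal cones are unions of closed cells, that
  is, iff its support function is linear on each closed cell.  As a closed cell is generated by its
  vertices, such a set is determined by the values of its support function there; this gives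
  (a) \<open>\<longleftrightarrow>\<close> (b), and the recession cones that occur are generated by roots.

  Each of (c) and (d) makes the normal cones of \<open>B\<close> unions of closed cells, and passes to exposed
  faces; by induction on the dimension the convex hull of \<open>B\<close> is closed, hence M-convex.  For
  (a) \<open>\<longrightarrow>\<close> (c), maximize over \<open>B\<close> the sum of those vectors of the basis dual to \<open>\<Delta>\<close> that are bounded on
  \<open>B\<close>, and then add recession roots to increase the remaining coordinates.

  Only (a) \<open>\<longrightarrow>\<close> (d) needs the classical types: if \<open>\<alpha>\<close> is a root in the tangent cone at \<open>p \<in> B\<close>, then \<open>\<alpha>\<close> is
  a nonnegative combination of roots \<open>\<beta>\<close> with \<open>p + \<beta> \<in> B\<close>.  It suffices to test \<open>p + \<beta>\<close> on sign
  vectors, where the slack at \<open>p\<close> is a nonnegative integer.  In type A roots are at most \<open>1\<close> there,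
  and \<open>\<beta> = \<alpha>\<close> works.  In the other types \<open>\<alpha> = s e\<^sub>i + t e\<^sub>j\<close> can only be blocked by a sign vector with slack
  \<open>1\<close> and \<open>\<alpha>\<close>-value \<open>2\<close>, and then \<open>p + s e\<^sub>i\<close> and \<open>p + t e\<^sub>j\<close> lie in the convex hull of \<open>B\<close>.  In type B these
  are lattice points.  In types C and D they have the wrong parity, which yields an index \<open>k\<close> such that
  both \<open>p + s e\<^sub>i \<plusminus> e\<^sub>k\<close> lie in \<open>B\<close>.
\<close>

section \<open>Polar cones\<close>

text \<open>Two obstacles shape the proof. First, \<open>B\<close> may be infinite, and the convex
  hull of infinitely many lattice points need not be closed, which M-convexity demands. Conditions
  (c) and (d) are therefore both funnelled through \<open>regular\<close>, which stands in for
  compactness: it yields attained maxima and is inherited by faces. Normal cones replace tangent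
  cones because "union of closed cells" can be tested by moving one maximized direction inside its
  cell, without naming generators. Second, a root step from \<open>p\<close> must not overshoot
  \<open>B\<close>. Test directions are reduced to sign vectors rather than to vertices of the
  complex: sign vectors include non-vertices, but they are stable under odd monotone maps applied
  coordinatewise, and such maps keep a direction in its closed cell for all four types at once. On
  sign vectors a root has value at most 2, while a positive slack is at least 1; the case analysis
  for types B, C and D is about this gap.\<close>

definition polar :: "'a::real_inner set \<Rightarrow> 'a set" where
  "polar A = {x. \<forall>a\<in>A. a \<bullet> x \<le> 0}"

lemma polar_antimono: "A \<subseteq> B \<Longrightarrow> polar B \<subseteq> polar A"
  by (auto simp: polar_def)

lemma convex_cone_polar: "convex_cone (polar A)"
  by (auto simp: convex_cone_iff polar_def inner_add_right mult_nonneg_nonpos intro: add_nonpos_nonpos)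

lemma convex_cone_hull_inner_le:
  assumes "q \<in> convex_cone hull A" "\<And>a. a \<in> A \<Longrightarrow> a \<bullet> x \<le> 0"
  shows "q \<bullet> x \<le> 0"
proof -
  have "convex_cone hull A \<subseteq> {q. q \<bullet> x \<le> 0}"
    by (rule hull_minimal)
      (use assms(2) in \<open>auto simp: convex_cone_iff inner_add_left mult_nonneg_nonpos add_nonpos_nonpos\<close>)
  then show ?thesis
    using assms(1) by auto
qed

lemma convex_cone_hull_sum:
  assumes "\<And>a. a \<in> A \<Longrightarrow> 0 \<le> c a" "\<And>a. a \<in> A \<Longrightarrow> f a \<in> convex_cone hull S"
  shows "(\<Sum>a\<in>A. c a *\<^sub>R f a) \<in> convex_cone hull S"
  using assms
proof (induction A rule: infinite_finite_induct)
  case (insert x F)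
  then show ?case by (simp add: convex_cone_hull_add convex_cone_hull_mul)
qed (auto simp: convex_cone_hull_contains_0)

lemma convex_cone_hull_finite:
  assumes "finite A"
  shows "convex_cone hull A = {(\<Sum>a\<in>A. c a *\<^sub>R a) | c. \<forall>a\<in>A. 0 \<le> c a}" (is "_ = ?R")
proof
  show "convex_cone hull A \<subseteq> ?R"
  proof (rule hull_minimal)
    show "A \<subseteq> ?R"
    proof
      fix a assume "a \<in> A"
      then have "a = (\<Sum>b\<in>A. (if b = a then 1 else 0) *\<^sub>R b)"
        using assms by (simp add: if_distrib[where f="\<lambda>c. c *\<^sub>R _"] cong: if_cong)
      then show "a \<in> ?R" by (auto intro!: exI[of _ "\<lambda>b. if b = a then 1 else 0"])
    qed
    have "0 \<in> ?R" by (auto intro!: exI[of _ "\<lambda>_. 0"])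
    moreover have "x + y \<in> ?R" if "x \<in> ?R" "y \<in> ?R" for x y
    proof -
      from that obtain c d where "x = (\<Sum>a\<in>A. c a *\<^sub>R a)" "y = (\<Sum>a\<in>A. d a *\<^sub>R a)"
        "\<forall>a\<in>A. 0 \<le> c a" "\<forall>a\<in>A. 0 \<le> d a" by blast
      then show ?thesis
        by (auto simp: scaleR_add_left sum.distrib intro!: exI[of _ "\<lambda>a. c a + d a"])
    qed
    moreover have "k *\<^sub>R x \<in> ?R" if "x \<in> ?R" "0 \<le> k" for x and k :: real
    proof -
      from that obtain c where "x = (\<Sum>a\<in>A. c a *\<^sub>R a)" "\<forall>a\<in>A. 0 \<le> c a" by blast
      then show ?thesis
        using that by (auto simp: scaleR_sum_right intro!: exI[of _ "\<lambda>a. k * c a"])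
    qed
    ultimately show "convex_cone ?R" unfolding convex_cone_iff by blast
  qed
  show "?R \<subseteq> convex_cone hull A"
    by (auto intro!: convex_cone_hull_sum intro: hull_inc)
qed

text \<open>The nontrivial half of the bipolar theorem. A hyperplane that separates \<open>q\<close>
  from the cone can be moved to the origin, because the cone is closed under scaling.\<close>

lemma mem_closed_convex_coneI:
  fixes C :: "'a::euclidean_space set"
  assumes "closed C" "convex_cone C" and le: "\<And>x. x \<in> polar C \<Longrightarrow> q \<bullet> x \<le> 0"
  shows "q \<in> C"
proof (rule ccontr)
  assume "q \<notin> C"
  then obtain a b where ab: "a \<bullet> q < b" "\<forall>x\<in>C. b < a \<bullet> x"
    using separating_hyperplane_closed_point[of C q] assms unfolding convex_cone_def by blast
  have "0 \<in> C" using assms(2) by (rule convex_cone_contains_0)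
  then have b0: "b < 0" using ab by force
  have "0 \<le> a \<bullet> x" if "x \<in> C" for x
  proof (rule ccontr)
    assume neg: "\<not> 0 \<le> a \<bullet> x"
    \<comment> \<open>Rescales \<open>x\<close> to the level \<open>b\<close> of the separating
      hyperplane, which \<open>C\<close> has to miss.\<close>
    then have "(b / (a \<bullet> x)) *\<^sub>R x \<in> C"
      using b0 assms(2) that by (intro convex_cone_scaleR) (auto simp: divide_nonpos_neg)
    then have "b < a \<bullet> ((b / (a \<bullet> x)) *\<^sub>R x)" using ab by blast
    then show False using neg by simp
  qed
  then have "- a \<in> polar C" by (auto simp: polar_def inner_commute)
  from le[OF this] show False using ab b0 by (simp add: inner_commute)
qed

text \<open>Farkas' lemma: the cone over a finite set is closed, so the bipolar argument applies to
  it.\<close>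

lemma mem_convex_cone_hull_finite_iff:
  fixes A :: "'a::euclidean_space set"
  assumes "finite A"
  shows "q \<in> convex_cone hull A \<longleftrightarrow> (\<forall>x\<in>polar A. q \<bullet> x \<le> 0)"
proof
  assume "q \<in> convex_cone hull A"
  then show "\<forall>x\<in>polar A. q \<bullet> x \<le> 0"
    using convex_cone_hull_inner_le[of q A] by (auto simp: polar_def)
next
  assume "\<forall>x\<in>polar A. q \<bullet> x \<le> 0"
  moreover have "polar (convex_cone hull A) \<subseteq> polar A"
    by (rule polar_antimono) (rule hull_subset)
  ultimately show "q \<in> convex_cone hull A"
    by (intro mem_closed_convex_coneI closed_convex_cone_hull assms convex_cone_convex_cone_hull) auto
qed

lemma polar_convex_cone_hull: "polar (convex_cone hull A) = polar A"
  using convex_cone_hull_inner_le[of _ A] hull_subset[of A convex_cone]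
  by (fastforce simp: polar_def)

section \<open>Normal cones and exposed faces\<close>

definition normal_cone_at :: "'a::real_inner set \<Rightarrow> 'a \<Rightarrow> 'a set" where
  "normal_cone_at P p = {x. \<forall>q\<in>P. q \<bullet> x \<le> p \<bullet> x}"

definition exposed :: "'a::real_inner set \<Rightarrow> 'a \<Rightarrow> 'a set" where
  "exposed P x = {p \<in> P. \<forall>q\<in>P. q \<bullet> x \<le> p \<bullet> x}"

text \<open>The barrier cone of \<open>P\<close>, that is, the effective domain of its support
  function.\<close>

definition bounded_dirs :: "'a::real_inner set \<Rightarrow> 'a set" where
  "bounded_dirs P = {x. bdd_above ((\<lambda>q. q \<bullet> x) ` P)}"

lemma exposed_iff: "p \<in> exposed P x \<longleftrightarrow> p \<in> P \<and> x \<in> normal_cone_at P p"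
  by (auto simp: exposed_def normal_cone_at_def)

lemma normal_cone_at_eq_polar: "normal_cone_at P p = polar ((\<lambda>q. q - p) ` P)"
  by (auto simp: normal_cone_at_def polar_def inner_diff_left)

lemma convex_cone_normal_cone_at: "convex_cone (normal_cone_at P p)"
  by (simp add: normal_cone_at_eq_polar convex_cone_polar)

lemma normal_cone_at_convex_hull: "normal_cone_at (convex hull P) p = normal_cone_at P p"
proof
  show "normal_cone_at (convex hull P) p \<subseteq> normal_cone_at P p"
    using hull_subset[of P convex] by (auto simp: normal_cone_at_def)
  have "convex hull P \<subseteq> {q. x \<bullet> q \<le> x \<bullet> p}" if "x \<in> normal_cone_at P p" for x
    by (rule hull_minimal)
      (use that in \<open>auto simp: normal_cone_at_def inner_commute[of _ x] convex_halfspace_le\<close>)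
  then show "normal_cone_at P p \<subseteq> normal_cone_at (convex hull P) p"
    by (auto simp: normal_cone_at_def inner_commute subset_iff)
qed

lemma closure_tangent_eq:
  fixes P :: "'a::euclidean_space set"
  shows "closure (convex_cone hull ((\<lambda>q. q - p) ` P)) = {d. \<forall>x\<in>normal_cone_at P p. d \<bullet> x \<le> 0}"
    (is "closure ?K = ?R")
proof
  have "closed ?R"
    by (simp add: Collect_ball_eq closed_INT closed_halfspace_le inner_commute[of _ "_::'a"])
  moreover have "?K \<subseteq> ?R"
    by (auto simp: normal_cone_at_eq_polar polar_def intro: convex_cone_hull_inner_le)
  ultimately show "closure ?K \<subseteq> ?R" by (rule closure_minimal[rotated])
next
  have "convex_cone (closure ?K)"
    unfolding convex_cone_def using convex_cone_convex_cone_hull[of "(\<lambda>q. q - p) ` P"]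
    by (auto simp: convex_cone_def convex_closure conic_closure)
  moreover have "polar (closure ?K) \<subseteq> normal_cone_at P p"
    unfolding normal_cone_at_eq_polar
    by (rule polar_antimono) (meson closure_subset hull_subset subset_trans)
  ultimately show "?R \<subseteq> closure ?K"
    by (auto intro!: mem_closed_convex_coneI)
qed

text \<open>Translates M-convexity from tangent to normal cones. The two are polar to each other,
  and a finitely generated cone is closed, hence recovered from its polar.\<close>

lemma tangent_is_finite_cone_iff:
  fixes P :: "'a::euclidean_space set"
  assumes "finite A"
  shows "closure (convex_cone hull ((\<lambda>q. q - p) ` P)) = convex_cone hull A
    \<longleftrightarrow> normal_cone_at P p = polar A"
proof
  assume eq: "closure (convex_cone hull ((\<lambda>q. q - p) ` P)) = convex_cone hull A"
  have "polar A = polar (closure (convex_cone hull ((\<lambda>q. q - p) ` P)))"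
    by (simp add: eq polar_convex_cone_hull)
  also have "\<dots> = normal_cone_at P p"
  proof
    show "polar (closure (convex_cone hull ((\<lambda>q. q - p) ` P))) \<subseteq> normal_cone_at P p"
      unfolding normal_cone_at_eq_polar
      by (rule polar_antimono) (meson closure_subset hull_subset subset_trans)
    show "normal_cone_at P p \<subseteq> polar (closure (convex_cone hull ((\<lambda>q. q - p) ` P)))"
      by (auto simp: closure_tangent_eq polar_def)
  qed
  finally show "normal_cone_at P p = polar A" ..
next
  assume "normal_cone_at P p = polar A"
  then show "closure (convex_cone hull ((\<lambda>q. q - p) ` P)) = convex_cone hull A"
    unfolding closure_tangent_eq using mem_convex_cone_hull_finite_iff[OF assms] by auto
qed

text \<open>A separating functional is bounded on \<open>C\<close>, so only directions of the
  barrier cone need testing.\<close>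

lemma mem_closed_convexI:
  fixes C :: "'a::euclidean_space set"
  assumes "closed C" "convex C" "C \<noteq> {}"
    and le: "\<And>x. x \<in> bounded_dirs C \<Longrightarrow> \<exists>p\<in>C. q \<bullet> x \<le> p \<bullet> x"
  shows "q \<in> C"
proof (rule ccontr)
  assume "q \<notin> C"
  then obtain a b where ab: "a \<bullet> q < b" "\<forall>x\<in>C. b < a \<bullet> x"
    using separating_hyperplane_closed_point[of C q] assms by blast
  then have "- a \<in> bounded_dirs C"
    by (auto simp: bounded_dirs_def bdd_above_def inner_commute intro!: exI[of _ "-b"] less_imp_le)
  from le[OF this] show False using ab assms(1) by (fastforce simp: inner_commute)
qed

section \<open>Closed cells of a root arrangement\<close>

text \<open>By continuity and finiteness. This is the source of small perturbations of directions:
  positive roots stay positive, and on negated vectors it keeps negative roots negative.\<close>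

lemma finite_positive_stable:
  fixes z w :: "'a::real_inner"
  assumes "finite G"
  shows "\<exists>\<epsilon>>0. \<forall>\<gamma>\<in>G. 0 < \<gamma> \<bullet> z \<longrightarrow> 0 < \<gamma> \<bullet> (z + \<epsilon> *\<^sub>R w)"
proof -
  have "\<forall>\<^sub>F \<epsilon> in at_right 0. \<forall>\<gamma>\<in>G. 0 < \<gamma> \<bullet> z \<longrightarrow> 0 < \<gamma> \<bullet> (z + \<epsilon> *\<^sub>R w)"
  proof (rule eventually_ball_finite[OF assms], intro ballI)
    fix \<gamma> assume "\<gamma> \<in> G"
    have "((\<lambda>\<epsilon>. \<gamma> \<bullet> (z + \<epsilon> *\<^sub>R w)) \<longlongrightarrow> \<gamma> \<bullet> (z + 0 *\<^sub>R w)) (at_right 0)"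
      by (intro tendsto_intros)
    then show "\<forall>\<^sub>F \<epsilon> in at_right 0. 0 < \<gamma> \<bullet> z \<longrightarrow> 0 < \<gamma> \<bullet> (z + \<epsilon> *\<^sub>R w)"
      by (cases "0 < \<gamma> \<bullet> z") (auto dest: order_tendstoD(1)[of _ _ _ 0])
  qed
  then obtain b where "b > 0" "\<forall>\<epsilon>>0. \<epsilon> < b \<longrightarrow> (\<forall>\<gamma>\<in>G. 0 < \<gamma> \<bullet> z \<longrightarrow> 0 < \<gamma> \<bullet> (z + \<epsilon> *\<^sub>R w))"
    unfolding eventually_at_right_field by auto
  then show ?thesis by (auto intro!: exI[of _ "b / 2"])
qed

locale root_arrangement =
  fixes \<Phi> :: "'a::euclidean_space set"
  assumes finite_roots: "finite \<Phi>"
    and uminus_roots: "\<alpha> \<in> \<Phi> \<Longrightarrow> - \<alpha> \<in> \<Phi>"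
    and span_roots: "span \<Phi> = UNIV"
begin

text \<open>
  The closed cell whose relative interior contains \<open>x\<close>: as \<open>\<Phi> = - \<Phi>\<close>, the condition also says that
  \<open>\<alpha>\<close> vanishes at \<open>y\<close> if it vanishes at \<open>x\<close>.
\<close>

definition cell :: "'a \<Rightarrow> 'a set" where
  "cell x = {y. \<forall>\<alpha>\<in>\<Phi>. \<alpha> \<bullet> x \<le> 0 \<longrightarrow> \<alpha> \<bullet> y \<le> 0}"

definition cell_closed :: "'a set \<Rightarrow> bool" where
  "cell_closed K \<longleftrightarrow> (\<forall>x\<in>K. cell x \<subseteq> K)"

lemma cell_refl: "x \<in> cell x"
  by (simp add: cell_def)

lemma cellD: "y \<in> cell x \<Longrightarrow> \<alpha> \<in> \<Phi> \<Longrightarrow> \<alpha> \<bullet> x \<le> 0 \<Longrightarrow> \<alpha> \<bullet> y \<le> 0"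
  by (simp add: cell_def)

lemma cell_nonneg: "y \<in> cell x \<Longrightarrow> \<alpha> \<in> \<Phi> \<Longrightarrow> 0 \<le> \<alpha> \<bullet> x \<Longrightarrow> 0 \<le> \<alpha> \<bullet> y"
  using cellD[of y x "- \<alpha>"] uminus_roots[of \<alpha>] by simp

lemma cell_zero: "y \<in> cell x \<Longrightarrow> \<alpha> \<in> \<Phi> \<Longrightarrow> \<alpha> \<bullet> x = 0 \<Longrightarrow> \<alpha> \<bullet> y = 0"
  using cellD[of y x \<alpha>] cell_nonneg[of y x \<alpha>] by simp

lemma cell_trans: "z \<in> cell y \<Longrightarrow> y \<in> cell x \<Longrightarrow> z \<in> cell x"
  by (simp add: cell_def)

lemma cell_eq_polar: "cell x = polar {\<alpha>\<in>\<Phi>. \<alpha> \<bullet> x \<le> 0}"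
  by (auto simp: cell_def polar_def)

lemma convex_cone_cell: "convex_cone (cell x)"
  by (simp add: cell_eq_polar convex_cone_polar)

lemma cell_closed_polar: "A \<subseteq> \<Phi> \<Longrightarrow> cell_closed (polar A)"
  by (auto simp: cell_closed_def cell_def polar_def)

lemma eq_zero_if_roots: "(\<And>\<alpha>. \<alpha> \<in> \<Phi> \<Longrightarrow> \<alpha> \<bullet> x = 0) \<Longrightarrow> x = 0"
proof -
  assume 0: "\<And>\<alpha>. \<alpha> \<in> \<Phi> \<Longrightarrow> \<alpha> \<bullet> x = 0"
  have "orthogonal x x"
    by (rule orthogonal_to_span[of _ \<Phi>]) (use 0 span_roots in \<open>auto simp: orthogonal_def inner_commute\<close>)
  then show "x = 0" by (simp add: orthogonal_self)
qed

text \<open>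
  A convex union of closed cells is cut out by roots: walking from a point of \<open>K\<close> towards a point
  \<open>x\<close>, the walk can cross every root hyperplane beyond which \<open>K\<close> still has points.
\<close>

lemma cell_closed_convex_cone_eq_polar:
  assumes K: "convex_cone K" "cell_closed K"
  shows "K = polar {\<alpha>\<in>\<Phi>. \<forall>x\<in>K. \<alpha> \<bullet> x \<le> 0}"
proof
  show "K \<subseteq> polar {\<alpha>\<in>\<Phi>. \<forall>x\<in>K. \<alpha> \<bullet> x \<le> 0}" by (auto simp: polar_def)
next
  show "polar {\<alpha>\<in>\<Phi>. \<forall>x\<in>K. \<alpha> \<bullet> x \<le> 0} \<subseteq> K"
  proof
    fix x assume x: "x \<in> polar {\<alpha>\<in>\<Phi>. \<forall>x\<in>K. \<alpha> \<bullet> x \<le> 0}"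
    \<comment> \<open>The roots whose hyperplanes the walk from \<open>k\<close> to \<open>x\<close>
      has still to cross; the point of \<open>K\<close> with fewest of them is where the walk
      ends.\<close>
    define bad where "bad k = {\<beta>\<in>\<Phi>. 0 < \<beta> \<bullet> x \<and> \<beta> \<bullet> k \<le> 0}" for k
    have fin: "finite (bad k)" for k using finite_roots by (simp add: bad_def)
    obtain k where k: "k \<in> K" "\<And>k'. k' \<in> K \<Longrightarrow> card (bad k) \<le> card (bad k')"
      using ex_has_least_nat[of "\<lambda>k. k \<in> K" _ "\<lambda>k. card (bad k)"] convex_cone_nonempty[OF K(1)]
      by blast
    have "bad k = {}"
    proof (rule ccontr)
      assume ne: "bad k \<noteq> {}"
      \<comment> \<open>\<open>\<tau> \<beta>\<close> is the time at which the segment from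
        \<open>k\<close> to \<open>x\<close> meets the hyperplane of \<beta>. With the least such
        time, \<open>z\<close> below is the first crossing point and has not left the closed cell of
        \<open>k\<close>.\<close>
      define \<tau> where "\<tau> \<beta> = - (\<beta> \<bullet> k) / (\<beta> \<bullet> x - \<beta> \<bullet> k)" for \<beta>
      obtain \<beta> where \<beta>: "\<beta> \<in> bad k" "\<And>\<gamma>. \<gamma> \<in> bad k \<Longrightarrow> \<tau> \<beta> \<le> \<tau> \<gamma>"
        using ex_min_if_finite[of "\<tau> ` bad k"] ne fin by (force simp: not_less)
      define t where "t = \<tau> \<beta>"
      have b: "\<beta> \<in> \<Phi>" "0 < \<beta> \<bullet> x" "\<beta> \<bullet> k \<le> 0" using \<beta>(1) by (auto simp: bad_def)
      have t: "0 \<le> t" "t < 1" using b by (auto simp: t_def \<tau>_def field_simps)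
      define z where "z = (1 - t) *\<^sub>R k + t *\<^sub>R x"
      have iz: "\<gamma> \<bullet> z = (1 - t) * (\<gamma> \<bullet> k) + t * (\<gamma> \<bullet> x)" for \<gamma>
        by (simp add: z_def inner_add_right)
      have bz: "\<beta> \<bullet> z = 0" using b by (simp add: iz t_def \<tau>_def field_simps)
      have "z \<in> cell k"
        unfolding cell_def
      proof (clarify)
        fix \<gamma> assume g: "\<gamma> \<in> \<Phi>" "\<gamma> \<bullet> k \<le> 0"
        show "\<gamma> \<bullet> z \<le> 0"
        proof (cases "0 < \<gamma> \<bullet> x")
          case True
          then have "t \<le> \<tau> \<gamma>" using g \<beta>(2) by (auto simp: bad_def t_def)
          then have "t * (\<gamma> \<bullet> x - \<gamma> \<bullet> k) \<le> - (\<gamma> \<bullet> k)"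
            using True g pos_le_divide_eq[of "\<gamma> \<bullet> x - \<gamma> \<bullet> k" t "- (\<gamma> \<bullet> k)"]
            by (simp add: \<tau>_def)
          then show ?thesis by (simp add: iz algebra_simps)
        next
          case False
          then show ?thesis using t g
            by (simp add: iz add_nonpos_nonpos mult_nonneg_nonpos)
        qed
      qed
      then have zK: "z \<in> K" using K(2) k(1) by (auto simp: cell_closed_def)
      \<comment> \<open>\<beta> is positive at \<open>x\<close>, so by the choice of
        \<open>x\<close> it is not nonpositive on all of \<open>K\<close>. A small step towards
        \<open>k'\<close> crosses its hyperplane and undoes no earlier crossing.\<close>
      obtain k' where k': "k' \<in> K" "0 < \<beta> \<bullet> k'"
        using x b by (force simp: polar_def not_le)
      obtain \<epsilon> where e: "\<epsilon> > 0" "\<And>\<gamma>. \<gamma> \<in> \<Phi> \<Longrightarrow> 0 < \<gamma> \<bullet> z \<Longrightarrow> 0 < \<gamma> \<bullet> (z + \<epsilon> *\<^sub>R k')"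
        using finite_positive_stable[OF finite_roots, of z k'] by blast
      have "bad (z + \<epsilon> *\<^sub>R k') \<subseteq> bad k"
      proof
        fix \<gamma> assume g: "\<gamma> \<in> bad (z + \<epsilon> *\<^sub>R k')"
        then have g': "\<gamma> \<in> \<Phi>" "0 < \<gamma> \<bullet> x" "\<not> 0 < \<gamma> \<bullet> (z + \<epsilon> *\<^sub>R k')" by (auto simp: bad_def)
        have "\<not> 0 < \<gamma> \<bullet> k"
        proof
          assume "0 < \<gamma> \<bullet> k"
          then have "0 < \<gamma> \<bullet> z" using t g' by (simp add: iz add_pos_nonneg)
          then show False using e(2) g' by blast
        qed
        then show "\<gamma> \<in> bad k" using g' by (simp add: bad_def)
      qed
      moreover have "\<beta> \<notin> bad (z + \<epsilon> *\<^sub>R k')"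
        using e k' bz by (simp add: bad_def inner_add_right not_le)
      ultimately have "bad (z + \<epsilon> *\<^sub>R k') \<subset> bad k" using \<beta>(1) by blast
      then have "card (bad (z + \<epsilon> *\<^sub>R k')) < card (bad k)" by (rule psubset_card_mono[OF fin])
      moreover have "z + \<epsilon> *\<^sub>R k' \<in> K"
        using zK k' e K(1) by (intro convex_cone_add convex_cone_scaleR) auto
      ultimately show False using k(2) by (simp add: not_le[symmetric])
    qed
    then have "x \<in> cell k" by (force simp: bad_def cell_def not_le)
    then show "x \<in> K" using K(2) k(1) by (auto simp: cell_closed_def)
  qed
qed

subsection \<open>Vertices of the Coxeter complex\<close>

text \<open>One-dimensionality of the cell of \<open>y\<close> in linear terms: the subspace cut out
  by the roots that vanish at \<open>y\<close> is the line through \<open>y\<close>.\<close>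

definition vertex :: "'a \<Rightarrow> bool" where
  "vertex y \<longleftrightarrow> y \<noteq> 0 \<and> (\<forall>w. (\<forall>\<alpha>\<in>\<Phi>. \<alpha> \<bullet> y = 0 \<longrightarrow> \<alpha> \<bullet> w = 0) \<longrightarrow> (\<exists>c. w = c *\<^sub>R y))"

text \<open>If \<open>y\<close> is not a vertex, some \<open>w\<close> off the line of
  \<open>y\<close> vanishes wherever \<open>y\<close> does. With \<open>m\<close> and
  \<open>M\<close> the extreme ratios of \<open>w\<close> to \<open>y\<close> over the roots,
  \<open>w - m *\<^sub>R y\<close> and \<open>M *\<^sub>R y - w\<close> lie in the closed cell of
  \<open>y\<close>, each on a further root hyperplane, and their sum is a positive multiple of
  \<open>y\<close>. So induct on the number of roots not vanishing at \<open>y\<close>.\<close>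

lemma mem_convex_cone_hull_vertices: "y \<in> convex_cone hull {v \<in> cell y. vertex v}"
proof (induction "card {\<alpha>\<in>\<Phi>. \<alpha> \<bullet> y \<noteq> 0}" arbitrary: y rule: less_induct)
  case less
  show ?case
  proof (cases "y = 0 \<or> vertex y")
    case True
    then show ?thesis
      by (auto simp: convex_cone_hull_contains_0 cell_refl intro: hull_inc)
  next
    case False
    then obtain w where w: "\<And>\<alpha>. \<alpha> \<in> \<Phi> \<Longrightarrow> \<alpha> \<bullet> y = 0 \<Longrightarrow> \<alpha> \<bullet> w = 0" "\<And>c. w \<noteq> c *\<^sub>R y"
      and y0: "y \<noteq> 0"
      by (auto simp: vertex_def)
    define N where "N = {\<alpha>\<in>\<Phi>. \<alpha> \<bullet> y \<noteq> 0}"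
    have finN: "finite N" using finite_roots by (simp add: N_def)
    have neN: "N \<noteq> {}" using y0 eq_zero_if_roots[of y] by (auto simp: N_def)
    define \<rho> where "\<rho> \<alpha> = (\<alpha> \<bullet> w) / (\<alpha> \<bullet> y)" for \<alpha>
    have \<rho>: "\<alpha> \<bullet> w = \<rho> \<alpha> * (\<alpha> \<bullet> y)" if "\<alpha> \<in> \<Phi>" for \<alpha>
      using w(1)[OF that] by (simp add: \<rho>_def)
    define m M where "m = Min (\<rho> ` N)" and "M = Max (\<rho> ` N)"
    obtain \<alpha>m \<alpha>M where am: "\<alpha>m \<in> N" "\<rho> \<alpha>m = m" "\<alpha>M \<in> N" "\<rho> \<alpha>M = M"
    proof -
      have "m \<in> \<rho> ` N" "M \<in> \<rho> ` N" unfolding m_def M_def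
        using finN neN by (auto intro!: Min_in Max_in simp del: Min_in Max_in)
      then show ?thesis using that by blast
    qed
    have le: "m \<le> \<rho> \<alpha>" "\<rho> \<alpha> \<le> M" if "\<alpha> \<in> N" for \<alpha>
      using that finN by (auto simp: m_def M_def)
    have "m \<noteq> M"
    proof
      assume eq: "m = M"
      have "\<alpha> \<bullet> (w - m *\<^sub>R y) = 0" if "\<alpha> \<in> \<Phi>" for \<alpha>
        using le[of \<alpha>] \<rho>[OF that] that eq by (cases "\<alpha> \<in> N") (auto simp: inner_diff_right N_def)
      then have "w - m *\<^sub>R y = 0" by (rule eq_zero_if_roots)
      then show False using w(2) by auto
    qed
    then have mM: "m < M" using le[OF am(1)] by simp
    have step: "u \<in> convex_cone hull {v \<in> cell y. vertex v}"
      if u: "\<And>\<alpha>. \<alpha> \<in> \<Phi> \<Longrightarrow> \<alpha> \<bullet> u = c \<alpha> * (\<alpha> \<bullet> y)" "\<And>\<alpha>. \<alpha> \<in> N \<Longrightarrow> 0 \<le> c \<alpha>" "\<alpha>' \<in> N" "c \<alpha>' = 0"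
      for u c \<alpha>'
    proof -
      have "{\<alpha>\<in>\<Phi>. \<alpha> \<bullet> u \<noteq> 0} \<subseteq> N" "\<alpha>' \<notin> {\<alpha>\<in>\<Phi>. \<alpha> \<bullet> u \<noteq> 0}"
        using u by (auto simp: N_def)
      then have "card {\<alpha>\<in>\<Phi>. \<alpha> \<bullet> u \<noteq> 0} < card N"
        using u(3) by (intro psubset_card_mono finN) blast
      then have "u \<in> convex_cone hull {v \<in> cell u. vertex v}"
        using less by (simp add: N_def)
      moreover have "u \<in> cell y"
        unfolding cell_def
      proof (clarify)
        fix \<alpha> assume a: "\<alpha> \<in> \<Phi>" "\<alpha> \<bullet> y \<le> 0"
        show "\<alpha> \<bullet> u \<le> 0"
          using u(1)[OF a(1)] u(2)[of \<alpha>] a by (cases "\<alpha> \<in> N") (auto simp: N_def mult_nonneg_nonpos)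
      qed
      then have "{v \<in> cell u. vertex v} \<subseteq> {v \<in> cell y. vertex v}" using cell_trans by blast
      ultimately show ?thesis using hull_mono[of "{v \<in> cell u. vertex v}" _ convex_cone] by blast
    qed
    have 1: "w - m *\<^sub>R y \<in> convex_cone hull {v \<in> cell y. vertex v}"
      by (rule step[of _ "\<lambda>\<alpha>. \<rho> \<alpha> - m" \<alpha>m])
        (use \<rho> am le in \<open>auto simp: inner_diff_right algebra_simps\<close>)
    have 2: "M *\<^sub>R y - w \<in> convex_cone hull {v \<in> cell y. vertex v}"
      by (rule step[of _ "\<lambda>\<alpha>. M - \<rho> \<alpha>" \<alpha>M])
        (use \<rho> am le in \<open>auto simp: inner_diff_right algebra_simps\<close>)
    have "y = (1 / (M - m)) *\<^sub>R ((w - m *\<^sub>R y) + (M *\<^sub>R y - w))"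
      using mM by (simp add: scaleR_diff_left[symmetric])
    then show ?thesis
      using 1 2 mM
      by (metis (no_types, lifting) convex_cone_hull_add convex_cone_hull_mul diff_gt_0_iff_gt
          divide_nonneg_nonneg less_imp_le zero_le_one)
  qed
qed

end

section \<open>Barrier cones, attained maxima and recession directions\<close>

lemma sum_mono2_nonpos:
  fixes f :: "'b \<Rightarrow> real"
  assumes "finite B" "A \<subseteq> B" "\<And>b. b \<in> B - A \<Longrightarrow> f b \<le> 0"
  shows "sum f B \<le> sum f A"
  using sum_mono2[OF assms(1,2), of "\<lambda>b. - f b"] assms(3) by (force simp: sum_negf)

lemma convex_cone_bounded_dirs: "convex_cone (bounded_dirs P)"
  unfolding convex_cone_iff
proof (intro conjI ballI allI impI)
  show "0 \<in> bounded_dirs P" by (auto simp: bounded_dirs_def bdd_above_def)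
next
  fix x y assume "x \<in> bounded_dirs P" "y \<in> bounded_dirs P"
  then obtain a b where "\<forall>q\<in>P. q \<bullet> x \<le> a" "\<forall>q\<in>P. q \<bullet> y \<le> b"
    by (auto simp: bounded_dirs_def bdd_above_def)
  then show "x + y \<in> bounded_dirs P"
    by (auto simp: bounded_dirs_def bdd_above_def inner_add_right intro!: exI[of _ "a + b"] add_mono)
next
  fix x and c :: real assume "x \<in> bounded_dirs P" "0 \<le> c"
  then obtain a where "\<forall>q\<in>P. q \<bullet> x \<le> a"
    by (auto simp: bounded_dirs_def bdd_above_def)
  then show "c *\<^sub>R x \<in> bounded_dirs P"
    using \<open>0 \<le> c\<close>
    by (auto simp: bounded_dirs_def bdd_above_def intro!: exI[of _ "c * a"] mult_left_mono)
qed

lemma normal_cone_at_subset_bounded_dirs: "normal_cone_at P p \<subseteq> bounded_dirs P"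
  by (auto simp: normal_cone_at_def bounded_dirs_def bdd_above_def)

lemma bounded_dirs_convex_hull: "bounded_dirs (convex hull P) = bounded_dirs P"
proof
  show "bounded_dirs (convex hull P) \<subseteq> bounded_dirs P"
    by (auto simp: bounded_dirs_def intro: bdd_above_mono[OF _ image_mono[OF hull_subset]])
  show "bounded_dirs P \<subseteq> bounded_dirs (convex hull P)"
  proof
    fix x assume "x \<in> bounded_dirs P"
    then obtain a where "\<forall>q\<in>P. q \<bullet> x \<le> a"
      by (auto simp: bounded_dirs_def bdd_above_def)
    then have "P \<subseteq> {q. x \<bullet> q \<le> a}" by (auto simp: inner_commute)
    then have "convex hull P \<subseteq> {q. x \<bullet> q \<le> a}"
      by (rule hull_minimal) (rule convex_halfspace_le)
    then show "x \<in> bounded_dirs (convex hull P)"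
      by (auto simp: bounded_dirs_def bdd_above_def inner_commute)
  qed
qed

text \<open>If all of \<open>B\<close> were strictly below the maximum, a convex open half-space
  would contain the hull as well.\<close>

lemma exposed_convex_hull_nonempty:
  assumes "p \<in> convex hull B" "x \<in> normal_cone_at (convex hull B) p"
  shows "\<exists>b\<in>B. b \<bullet> x = p \<bullet> x \<and> x \<in> normal_cone_at B b"
proof -
  have le: "b \<bullet> x \<le> p \<bullet> x" if "b \<in> B" for b
    using assms(2) that hull_subset[of B convex] by (auto simp: normal_cone_at_def)
  have "\<exists>b\<in>B. p \<bullet> x \<le> b \<bullet> x"
  proof (rule ccontr)
    assume "\<not> ?thesis"
    then have "B \<subseteq> {q. x \<bullet> q < x \<bullet> p}" by (auto simp: inner_commute)
    then have "convex hull B \<subseteq> {q. x \<bullet> q < x \<bullet> p}"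
      by (rule hull_minimal) (rule convex_halfspace_lt)
    then show False using assms(1) by auto
  qed
  then obtain b where b: "b \<in> B" "p \<bullet> x \<le> b \<bullet> x" by blast
  then have "b \<bullet> x = p \<bullet> x" using le[of b] by simp
  then show ?thesis using b le by (auto simp: normal_cone_at_def)
qed

text \<open>
  Farkas' lemma, applied to the system that describes the maximizers of \<open>x\<close>.
\<close>

lemma halfspaces_attained:
  fixes P :: "'a::euclidean_space set"
  assumes "finite S" and P: "P = {q. \<forall>s\<in>S. q \<bullet> s \<le> c s}" and "P \<noteq> {}" and x: "x \<in> bounded_dirs P"
  shows "\<exists>p\<in>P. x \<in> normal_cone_at P p"
proof -
  define M where "M = Sup ((\<lambda>q. q \<bullet> x) ` P)"
  \<comment> \<open>Homogenization: \<open>(s, c s)\<close> is nonpositive at \<open>(q, -1)\<close>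
    iff \<open>q\<close> satisfies the constraint of \<open>s\<close>, and \<open>(- x, - M)\<close>
    iff \<open>q\<close> reaches the value \<open>M\<close>. A polar vector with negative last
    coordinate, rescaled, is the desired maximizer.\<close>
  define G where "G = insert (0, 1) ((\<lambda>s. (s, c s)) ` S)"
  have G: "finite G" using assms(1) by (simp add: G_def)
  have upper: "q \<bullet> x \<le> M" if "q \<in> P" for q
    unfolding M_def using that x by (intro cSup_upper) (auto simp: bounded_dirs_def)
  \<comment> \<open>Otherwise, evaluating the combination at \<open>(q, -1)\<close> would keep
    \<open>q \<bullet> x\<close> at distance at least \<open>1 / \<mu>\<close> below its supremum
    \<open>M\<close> for all \<open>q\<close> in \<open>P\<close>.\<close>
  have "(0, -1) \<notin> convex_cone hull (insert (- x, - M) G)"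
  proof
    assume "(0, -1) \<in> convex_cone hull (insert (- x, - M) G)"
    then obtain d where d: "(0, -1) = (\<Sum>a\<in>insert (- x, - M) G. d a *\<^sub>R a)"
      "\<forall>a\<in>insert (- x, - M) G. 0 \<le> d a"
      using convex_cone_hull_finite[of "insert (- x, - M) G"] G by auto
    define \<mu> where "\<mu> = d (- x, - M)"
    have \<mu>: "0 \<le> \<mu>" using d(2) by (simp add: \<mu>_def)
    have "1 \<le> \<mu> * (M - q \<bullet> x)" if q: "q \<in> P" for q
    proof -
      have le: "a \<bullet> (q, -1) \<le> 0" if "a \<in> G" for a
        using that q by (auto simp: G_def P inner_commute)
      have "1 = (\<Sum>a\<in>insert (- x, - M) G. d a *\<^sub>R a) \<bullet> (q, -1)" by (simp flip: d(1))
      also have "\<dots> = (\<Sum>a\<in>insert (- x, - M) G. d a * (a \<bullet> (q, -1)))"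
        by (simp add: inner_sum_left)
      also have "\<dots> \<le> (\<Sum>a\<in>{(- x, - M)}. d a * (a \<bullet> (q, -1)))"
        by (rule sum_mono2_nonpos) (use G d(2) le in \<open>auto intro: mult_nonneg_nonpos\<close>)
      also have "\<dots> = \<mu> * (M - q \<bullet> x)" by (simp add: \<mu>_def inner_commute)
      finally show ?thesis .
    qed
    note big = this
    obtain q\<^sub>0 where q\<^sub>0: "q\<^sub>0 \<in> P" using assms(3) by blast
    have pos: "0 < \<mu>" using big[OF q\<^sub>0] \<mu> by (cases "\<mu> = 0") auto
    have "M \<le> M - 1 / \<mu>"
      unfolding M_def
      by (rule cSup_least) (use assms(3) big pos in \<open>auto simp: field_simps M_def\<close>)
    then show False using pos by simp
  qed
  then obtain y where y: "y \<in> polar (insert (- x, - M) G)" "\<not> (0, -1) \<bullet> y \<le> 0"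
    using mem_convex_cone_hull_finite_iff[of "insert (- x, - M) G" "(0, -1)"] G by auto
  obtain q \<tau> where q: "y = (q, \<tau>)" by (cases y)
  have \<tau>: "\<tau> < 0" using y(2) q by simp
  define p where "p = (1 / - \<tau>) *\<^sub>R q"
  have "p \<bullet> s \<le> c s" if "s \<in> S" for s
  proof -
    have "s \<bullet> q + c s * \<tau> \<le> 0" using y(1) that by (auto simp: polar_def G_def q)
    then show ?thesis using \<tau> by (simp add: p_def inner_commute field_simps)
  qed
  then have "p \<in> P" by (simp add: P)
  moreover have "M \<le> p \<bullet> x"
  proof -
    have "- (x \<bullet> q) - M * \<tau> \<le> 0" using y(1) by (auto simp: polar_def q)
    then show ?thesis using \<tau> by (simp add: p_def inner_commute field_simps)
  qed
  then have "x \<in> normal_cone_at P p" using upper by (force simp: normal_cone_at_def)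
  ultimately show ?thesis by blast
qed

text \<open>Natural multiples of a generator come from iterating the shift; convexity fills in the
  real multiples between them.\<close>

lemma add_convex_cone_hull_mem:
  assumes "finite A" "convex H" and shift: "\<And>q \<alpha>. q \<in> H \<Longrightarrow> \<alpha> \<in> A \<Longrightarrow> q + \<alpha> \<in> H"
    and "r \<in> convex_cone hull A" "q \<in> H"
  shows "q + r \<in> H"
proof -
  have nat: "q + real n *\<^sub>R \<alpha> \<in> H" if "q \<in> H" "\<alpha> \<in> A" for q \<alpha> n
  proof (induction n)
    case (Suc n)
    then have "(q + real n *\<^sub>R \<alpha>) + \<alpha> \<in> H" by (rule shift) fact
    then show ?case by (simp add: algebra_simps)
  qed (use that in simp)
  have real: "q + t *\<^sub>R \<alpha> \<in> H" if q: "q \<in> H" "\<alpha> \<in> A" and t: "0 \<le> t" for q \<alpha> t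
  proof -
    obtain n where n: "t \<le> real n" "0 < real n" using reals_Archimedean2[of "max t 0"] by (auto dest: less_imp_le)
    have "(1 - t / n) *\<^sub>R q + (t / n) *\<^sub>R (q + real n *\<^sub>R \<alpha>) \<in> H"
      by (rule convexD[OF assms(2)]) (use q n t nat[OF q] in \<open>auto simp: divide_simps\<close>)
    moreover have "(1 - t / n) *\<^sub>R q + (t / n) *\<^sub>R (q + real n *\<^sub>R \<alpha>) = q + t *\<^sub>R \<alpha>"
      using n by (simp add: algebra_simps)
    ultimately show ?thesis by simp
  qed
  obtain c where c: "r = (\<Sum>\<alpha>\<in>A. c \<alpha> *\<^sub>R \<alpha>)" "\<forall>\<alpha>\<in>A. 0 \<le> c \<alpha>"
    using assms(4) convex_cone_hull_finite[OF assms(1)] by auto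
  have "q + (\<Sum>\<alpha>\<in>F. c \<alpha> *\<^sub>R \<alpha>) \<in> H" if "F \<subseteq> A" for F
    using finite_subset[OF that assms(1)] that
  proof (induction F)
    case (insert \<alpha> F)
    then have "(q + (\<Sum>\<alpha>\<in>F. c \<alpha> *\<^sub>R \<alpha>)) + c \<alpha> *\<^sub>R \<alpha> \<in> H"
      using c(2) by (intro real) auto
    then show ?case using insert by (simp add: algebra_simps)
  qed (use assms in simp)
  then show ?thesis using c(1) by blast
qed

context root_arrangement
begin

subsection \<open>Spherical expressions\<close>

definition open_cell :: "'a \<Rightarrow> 'a set" where
  "open_cell x = {y. \<forall>\<alpha>\<in>\<Phi>. sgn (\<alpha> \<bullet> y) = sgn (\<alpha> \<bullet> x)}"

definition rays :: "'a set set" where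
  "rays = {C \<in> range open_cell. aff_dim C = 1}"

definition spherical :: "'a set \<Rightarrow> bool" where
  "spherical S \<longleftrightarrow> S \<subseteq> \<Union> rays \<and> (\<forall>R\<in>rays. \<exists>!x. x \<in> S \<inter> R)"

lemma open_cell_eq: "y \<in> open_cell x \<Longrightarrow> open_cell y = open_cell x"
  by (auto simp: open_cell_def)

text \<open>A sign pattern is determined by its set of positive roots, since negated roots record
  the negative signs.\<close>

lemma finite_range_open_cell: "finite (range open_cell)"
proof -
  have "open_cell x = {y. {\<alpha>\<in>\<Phi>. 0 < \<alpha> \<bullet> y} = {\<alpha>\<in>\<Phi>. 0 < \<alpha> \<bullet> x}}" for x
  proof -
    have "sgn (\<alpha> \<bullet> y) = sgn (\<alpha> \<bullet> x)" if "{\<alpha>\<in>\<Phi>. 0 < \<alpha> \<bullet> y} = {\<alpha>\<in>\<Phi>. 0 < \<alpha> \<bullet> x}" "\<alpha> \<in> \<Phi>" for y \<alpha>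
    proof -
      have "0 < \<alpha> \<bullet> y \<longleftrightarrow> 0 < \<alpha> \<bullet> x" "0 < (-\<alpha>) \<bullet> y \<longleftrightarrow> 0 < (-\<alpha>) \<bullet> x"
        using that uminus_roots by blast+
      then show ?thesis by (auto simp: sgn_if)
    qed
    moreover have "0 < \<alpha> \<bullet> y \<longleftrightarrow> 0 < \<alpha> \<bullet> x" if "sgn (\<alpha> \<bullet> y) = sgn (\<alpha> \<bullet> x)" for y \<alpha>
      using that by (metis sgn_greater)
    ultimately show ?thesis unfolding open_cell_def by blast
  qed
  then have "range open_cell \<subseteq> (\<lambda>A. {y. {\<alpha>\<in>\<Phi>. 0 < \<alpha> \<bullet> y} = A}) ` Pow \<Phi>" by auto
  then show ?thesis by (rule finite_subset) (simp add: finite_roots)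
qed

lemma finite_rays: "finite rays"
  using finite_range_open_cell by (simp add: rays_def)

lemma ex_spherical: "\<exists>S. spherical S"
proof -
  define S where "S = (\<lambda>R. SOME x. x \<in> R) ` rays"
  have in_R: "(SOME x. x \<in> R) \<in> R" if "R \<in> rays" for R
  proof -
    have "R \<noteq> {}" using that by (auto simp: rays_def open_cell_def)
    then show ?thesis by (meson ex_in_conv someI_ex)
  qed
  have uniq: "R = R'" if "R \<in> rays" "R' \<in> rays" "x \<in> R" "x \<in> R'" for R R' x
    using that open_cell_eq unfolding rays_def by blast
  have "spherical S"
    unfolding spherical_def
  proof (intro conjI ballI)
    show "S \<subseteq> \<Union> rays" using in_R by (auto simp: S_def)
    fix R assume R: "R \<in> rays"
    show "\<exists>!x. x \<in> S \<inter> R"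
    proof (rule ex1I[of _ "SOME x. x \<in> R"])
      show "(SOME x. x \<in> R) \<in> S \<inter> R" using R in_R by (auto simp: S_def)
      fix y assume "y \<in> S \<inter> R"
      then obtain R' where "R' \<in> rays" "y = (SOME x. x \<in> R')" "y \<in> R" by (auto simp: S_def)
      with in_R[of R'] uniq[of R R' y] R show "y = (SOME x. x \<in> R)" by auto
    qed
  qed
  then show ?thesis ..
qed

lemma finite_spherical:
  assumes "spherical S"
  shows "finite S"
proof -
  have "S = (\<Union>R\<in>rays. S \<inter> R)" using assms by (auto simp: spherical_def)
  moreover have "finite (S \<inter> R)" if "R \<in> rays" for R
  proof -
    have "\<exists>!x. x \<in> S \<inter> R" using assms \<open>R \<in> rays\<close> by (simp add: spherical_def)
    then obtain x where "\<forall>y. y \<in> S \<inter> R \<longrightarrow> y = x" by metis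
    then show ?thesis by (intro finite_subset[of "S \<inter> R" "{x}"]) auto
  qed
  ultimately show ?thesis using finite_rays by (metis finite_UN_I)
qed

lemma open_cell_vertex:
  assumes "vertex y"
  shows "open_cell y = {t *\<^sub>R y | t. 0 < t}"
proof
  show "open_cell y \<subseteq> {t *\<^sub>R y | t. 0 < t}"
  proof
    fix w assume w: "w \<in> open_cell y"
    have "\<forall>\<alpha>\<in>\<Phi>. \<alpha> \<bullet> y = 0 \<longrightarrow> \<alpha> \<bullet> w = 0"
      using w unfolding open_cell_def by (metis (mono_tags, lifting) mem_Collect_eq sgn_zero_iff)
    then obtain c where c: "w = c *\<^sub>R y" using assms by (auto simp: vertex_def)
    obtain \<alpha> where a: "\<alpha> \<in> \<Phi>" "\<alpha> \<bullet> y \<noteq> 0"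
      using eq_zero_if_roots[of y] assms by (auto simp: vertex_def)
    have "sgn (c * (\<alpha> \<bullet> y)) = sgn (\<alpha> \<bullet> y)" using w a c by (auto simp: open_cell_def)
    then have "0 < c" using a(2) by (auto simp: sgn_mult sgn_if zero_less_mult_iff split: if_splits)
    then show "w \<in> {t *\<^sub>R y | t. 0 < t}" using c by blast
  qed
  show "{t *\<^sub>R y | t. 0 < t} \<subseteq> open_cell y"
    by (auto simp: open_cell_def sgn_mult)
qed

lemma open_cell_vertex_in_rays:
  assumes "vertex y"
  shows "open_cell y \<in> rays"
proof -
  have y: "y \<noteq> 0" using assms by (simp add: vertex_def)
  have "aff_dim {t *\<^sub>R y | t. 0 < t} \<le> aff_dim (span {y})"
    by (intro aff_dim_subset) (auto simp: span_singleton)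
  also have "\<dots> \<le> 1" using y by (simp add: aff_dim_subspace)
  finally have "aff_dim {t *\<^sub>R y | t. 0 < t} \<le> 1" .
  moreover have "{y, 2 *\<^sub>R y} \<subseteq> {t *\<^sub>R y | t. 0 < t}"
  proof -
    have "y = 1 *\<^sub>R y" by simp
    then show ?thesis by (auto intro: exI[of _ "1::real"])
  qed
  then have "aff_dim {y, 2 *\<^sub>R y} \<le> aff_dim {t *\<^sub>R y | t. 0 < t}" by (rule aff_dim_subset)
  moreover have "aff_dim {y, 2 *\<^sub>R y} = 1" using y by (simp add: aff_dim_2 scaleR_2)
  ultimately show ?thesis using open_cell_vertex[OF assms] by (auto simp: rays_def)
qed

lemma mem_convex_cone_hull_spherical:
  assumes "spherical S"
  shows "y \<in> convex_cone hull (S \<inter> cell y)"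
proof -
  have "{v \<in> cell y. vertex v} \<subseteq> convex_cone hull (S \<inter> cell y)"
  proof clarify
    fix v assume v: "v \<in> cell y" "vertex v"
    obtain x where "x \<in> S" "x \<in> open_cell v"
      using assms open_cell_vertex_in_rays[OF v(2)] unfolding spherical_def by blast
    then obtain t where t: "0 < t" "t *\<^sub>R v \<in> S" using open_cell_vertex[OF v(2)] by auto
    then have "t *\<^sub>R v \<in> S \<inter> cell y"
      using v convex_cone_scaleR[OF convex_cone_cell] by auto
    then have "(1 / t) *\<^sub>R (t *\<^sub>R v) \<in> convex_cone hull (S \<inter> cell y)"
      using t by (intro convex_cone_hull_mul hull_inc) auto
    then show "v \<in> convex_cone hull (S \<inter> cell y)" using t by simp
  qed
  then have "convex_cone hull {v \<in> cell y. vertex v} \<subseteq> convex_cone hull (S \<inter> cell y)"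
    by (rule hull_minimal) (rule convex_cone_convex_cone_hull)
  then show ?thesis using mem_convex_cone_hull_vertices by blast
qed

text \<open>This is how values on \<open>S\<close> control a whole direction: the chosen points in
  the closed cell of \<open>x\<close> generate \<open>x\<close>.\<close>

lemma inner_le_if_spherical:
  assumes "spherical S" and "\<And>s. s \<in> S \<Longrightarrow> s \<in> cell x \<Longrightarrow> d \<bullet> s \<le> 0"
  shows "d \<bullet> x \<le> 0"
  using convex_cone_hull_inner_le[OF mem_convex_cone_hull_spherical[OF assms(1)], of x d] assms(2)
  by (simp add: inner_commute)

section \<open>M-convex polyhedra\<close>

definition M_polyhedron :: "'a set \<Rightarrow> bool" where
  "M_polyhedron P \<longleftrightarrow> P \<noteq> {} \<and> closed P \<and> convex P \<and>
     (\<forall>p\<in>P. \<exists>A\<subseteq>\<Phi>. normal_cone_at P p = polar A)"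

lemma M_polyhedron_cell_closed: "M_polyhedron P \<Longrightarrow> p \<in> P \<Longrightarrow> cell_closed (normal_cone_at P p)"
  unfolding M_polyhedron_def using cell_closed_polar by metis

text \<open>Project \<open>q\<close> to the closest point \<open>p\<close> of \<open>P\<close>. Then
  \<open>q - p\<close> is normal at \<open>p\<close>, hence so is every point of \<open>S\<close> in
  its closed cell, and the inequalities there give \<open>(q - p) \<bullet> (q - p) \<le> 0\<close>.
  Only directions with a known maximizer occur, so attainment is not presupposed.\<close>

lemma M_polyhedron_memI:
  assumes "M_polyhedron P" "spherical S"
    and le: "\<And>s p. s \<in> S \<Longrightarrow> p \<in> P \<Longrightarrow> s \<in> normal_cone_at P p \<Longrightarrow> q \<bullet> s \<le> p \<bullet> s"
  shows "q \<in> P"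
proof (rule ccontr)
  assume q: "q \<notin> P"
  have P: "P \<noteq> {}" "closed P" "convex P" using assms(1) by (auto simp: M_polyhedron_def)
  define p where "p = closest_point P q"
  have p: "p \<in> P" using closest_point_in_set[OF P(2,1)] by (simp add: p_def)
  have "(q - p) \<bullet> (r - p) \<le> 0" if "r \<in> P" for r
    using closest_point_dot[OF P(3,2) that] by (simp add: p_def)
  then have nc: "q - p \<in> normal_cone_at P p"
    by (auto simp: normal_cone_at_def inner_commute[of _ "q - p"] inner_diff_right[of "q - p"])
  have "(q - p) \<bullet> (q - p) \<le> 0"
  proof (rule inner_le_if_spherical[OF assms(2)])
    fix s assume s: "s \<in> S" "s \<in> cell (q - p)"
    then have "s \<in> normal_cone_at P p"
      using M_polyhedron_cell_closed[OF assms(1) p] nc by (auto simp: cell_closed_def)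
    then show "(q - p) \<bullet> s \<le> 0" using le[OF s(1) p] by (simp add: inner_diff_left)
  qed
  then have "q = p" using inner_ge_zero[of "q - p"] by (metis antisym eq_iff_diff_eq_0 inner_eq_zero_iff)
  then show False using p q by simp
qed

text \<open>By \<open>M_polyhedron_memI\<close>, \<open>P\<close> is cut out by finitely many
  half-spaces, one for each bounded direction of \<open>S\<close>; on such a set bounded linear
  functions attain their maxima.\<close>

lemma M_polyhedron_attained:
  assumes "M_polyhedron P" "x \<in> bounded_dirs P"
  shows "\<exists>p\<in>P. x \<in> normal_cone_at P p"
proof -
  obtain S where S: "spherical S" using ex_spherical ..
  define c where "c s = Sup ((\<lambda>q. q \<bullet> s) ` P)" for s
  have "P = {q. \<forall>s\<in>S \<inter> bounded_dirs P. q \<bullet> s \<le> c s}"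
  proof
    show "P \<subseteq> {q. \<forall>s\<in>S \<inter> bounded_dirs P. q \<bullet> s \<le> c s}"
      by (auto simp: c_def bounded_dirs_def intro!: cSup_upper)
    show "{q. \<forall>s\<in>S \<inter> bounded_dirs P. q \<bullet> s \<le> c s} \<subseteq> P"
    proof clarify
      fix q assume q: "\<forall>s\<in>S \<inter> bounded_dirs P. q \<bullet> s \<le> c s"
      show "q \<in> P"
      proof (rule M_polyhedron_memI[OF assms(1) S])
        fix s p assume sp: "s \<in> S" "p \<in> P" "s \<in> normal_cone_at P p"
        then have "c s \<le> p \<bullet> s"
          unfolding c_def by (intro cSup_least) (auto simp: normal_cone_at_def)
        moreover have "q \<bullet> s \<le> c s"
          using q sp normal_cone_at_subset_bounded_dirs[of P p] by auto
        ultimately show "q \<bullet> s \<le> p \<bullet> s" by simp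
      qed
    qed
  qed
  then show ?thesis
    using finite_spherical[OF S] assms
    by (intro halfspaces_attained[of "S \<inter> bounded_dirs P" P c]) (auto simp: M_polyhedron_def)
qed

text \<open>By attainment, the barrier cone is the union of the normal cones.\<close>

lemma M_polyhedron_bounded_dirs_cell_closed:
  assumes "M_polyhedron P"
  shows "cell_closed (bounded_dirs P)"
  unfolding cell_closed_def
proof
  fix x assume "x \<in> bounded_dirs P"
  then obtain p where "p \<in> P" "x \<in> normal_cone_at P p" using M_polyhedron_attained[OF assms] by blast
  then have "cell x \<subseteq> normal_cone_at P p"
    using M_polyhedron_cell_closed[OF assms] by (auto simp: cell_closed_def)
  then show "cell x \<subseteq> bounded_dirs P" using normal_cone_at_subset_bounded_dirs by blast
qed

text \<open>The recession cone of a closed convex set is the polar of its barrier cone, so these are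
  the roots in it. The dual form also makes sense for a lattice set and gives the same roots as for
  its hull.\<close>

definition rec_roots :: "'a set \<Rightarrow> 'a set" where
  "rec_roots P = {\<alpha>\<in>\<Phi>. \<forall>x\<in>bounded_dirs P. \<alpha> \<bullet> x \<le> 0}"

lemma M_polyhedron_bounded_dirs: "M_polyhedron P \<Longrightarrow> bounded_dirs P = polar (rec_roots P)"
  unfolding rec_roots_def
  by (rule cell_closed_convex_cone_eq_polar[OF convex_cone_bounded_dirs])
    (rule M_polyhedron_bounded_dirs_cell_closed)

lemma M_polyhedron_add_rec_root:
  assumes "M_polyhedron P" "p \<in> P" "\<alpha> \<in> rec_roots P"
  shows "p + \<alpha> \<in> P"
proof -
  obtain S where S: "spherical S" using ex_spherical ..
  show ?thesis
  proof (rule M_polyhedron_memI[OF assms(1) S])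
    fix s r assume s: "s \<in> normal_cone_at P r"
    then have "\<alpha> \<bullet> s \<le> 0"
      using assms(3) normal_cone_at_subset_bounded_dirs[of P r] by (auto simp: rec_roots_def)
    moreover have "p \<bullet> s \<le> r \<bullet> s" using s assms(2) by (auto simp: normal_cone_at_def)
    ultimately show "(p + \<alpha>) \<bullet> s \<le> r \<bullet> s" by (simp add: inner_add_left)
  qed
qed

section \<open>The root lattice and M-convex sets\<close>

definition lattice :: "'a set" where
  "lattice = {(\<Sum>\<alpha>\<in>\<Phi>. of_int (c \<alpha>) *\<^sub>R \<alpha>) | c :: 'a \<Rightarrow> int. True}"

lemma root_in_lattice: "\<alpha> \<in> \<Phi> \<Longrightarrow> \<alpha> \<in> lattice"
proof -
  assume a: "\<alpha> \<in> \<Phi>"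
  have "\<alpha> = (\<Sum>\<beta>\<in>\<Phi>. of_int (if \<beta> = \<alpha> then 1 else 0) *\<^sub>R \<beta>)"
    using a finite_roots by (simp add: if_distrib[where f="\<lambda>c. of_int c *\<^sub>R _"] cong: if_cong)
  then show ?thesis unfolding lattice_def by (intro CollectI exI conjI TrueI)
qed

lemma lattice_combination:
  assumes "p \<in> lattice" "q \<in> lattice"
  shows "p + of_int k *\<^sub>R q \<in> lattice"
proof -
  obtain c d where "p = (\<Sum>\<alpha>\<in>\<Phi>. of_int (c \<alpha>) *\<^sub>R \<alpha>)" "q = (\<Sum>\<alpha>\<in>\<Phi>. of_int (d \<alpha>) *\<^sub>R \<alpha>)"
    using assms unfolding lattice_def by blast
  then have "p + of_int k *\<^sub>R q = (\<Sum>\<alpha>\<in>\<Phi>. of_int (c \<alpha> + k * d \<alpha>) *\<^sub>R \<alpha>)"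
    by (simp add: scaleR_add_left scaleR_sum_right sum.distrib)
  then show ?thesis unfolding lattice_def by (intro CollectI exI conjI TrueI)
qed

lemma lattice_add: "p \<in> lattice \<Longrightarrow> q \<in> lattice \<Longrightarrow> p + q \<in> lattice"
  using lattice_combination[of p q 1] by simp

lemma lattice_diff: "p \<in> lattice \<Longrightarrow> q \<in> lattice \<Longrightarrow> p - q \<in> lattice"
  using lattice_combination[of p q "-1"] by simp

text \<open>Used with \<open>m = 1\<close> for integrality and with \<open>m = 2\<close> for
  parity.\<close>

lemma lattice_inner_multiple:
  assumes "p \<in> lattice" and "\<And>\<alpha>. \<alpha> \<in> \<Phi> \<Longrightarrow> \<exists>k::int. \<alpha> \<bullet> z = m * of_int k"
  shows "\<exists>k::int. p \<bullet> z = m * of_int k"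
proof -
  obtain c where c: "p = (\<Sum>\<alpha>\<in>\<Phi>. of_int (c \<alpha>) *\<^sub>R \<alpha>)" using assms(1) by (auto simp: lattice_def)
  obtain k where k: "\<And>\<alpha>. \<alpha> \<in> \<Phi> \<Longrightarrow> \<alpha> \<bullet> z = m * of_int (k \<alpha> :: int)" using assms(2) by metis
  have "p \<bullet> z = (\<Sum>\<alpha>\<in>\<Phi>. m * of_int (c \<alpha> * k \<alpha>))"
    by (simp add: c inner_sum_left k algebra_simps)
  also have "\<dots> = m * of_int (\<Sum>\<alpha>\<in>\<Phi>. c \<alpha> * k \<alpha>)" by (simp add: sum_distrib_left)
  finally show ?thesis by blast
qed

text \<open>No polyhedron is quantified: an integral \<open>P\<close> with
  \<open>B = P \<inter> lattice\<close> is the hull of \<open>P \<inter> lattice\<close>, so it can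
  only be \<open>convex hull B\<close>.\<close>

definition M_set :: "'a set \<Rightarrow> bool" where
  "M_set B \<longleftrightarrow> M_polyhedron (convex hull B) \<and> B = convex hull B \<inter> lattice"

lemma M_set_normal_cones:
  assumes "M_set B" "p \<in> B"
  shows "\<exists>A\<subseteq>\<Phi>. normal_cone_at B p = polar A"
  using assms hull_inc[of p B convex] normal_cone_at_convex_hull[of B]
  unfolding M_set_def M_polyhedron_def by metis

lemma M_set_cell_closed: "M_set B \<Longrightarrow> p \<in> B \<Longrightarrow> cell_closed (normal_cone_at B p)"
  using M_set_normal_cones cell_closed_polar by metis

lemma M_set_attained:
  assumes "M_set B" "x \<in> bounded_dirs B"
  shows "\<exists>p\<in>B. x \<in> normal_cone_at B p"
proof -
  have "x \<in> bounded_dirs (convex hull B)" using assms(2) by (simp add: bounded_dirs_convex_hull)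
  then obtain p where "p \<in> convex hull B" "x \<in> normal_cone_at (convex hull B) p"
    using M_polyhedron_attained assms(1) unfolding M_set_def by blast
  then show ?thesis using exposed_convex_hull_nonempty by blast
qed

lemma M_set_bounded_dirs: "M_set B \<Longrightarrow> bounded_dirs B = polar (rec_roots B)"
  using M_polyhedron_bounded_dirs[of "convex hull B"]
  by (simp add: M_set_def rec_roots_def bounded_dirs_convex_hull)

lemma M_set_add_rec_root:
  assumes "M_set B" "p \<in> B" "\<alpha> \<in> rec_roots B"
  shows "p + \<alpha> \<in> B"
proof -
  have "\<alpha> \<in> rec_roots (convex hull B)"
    using assms(3) by (simp add: rec_roots_def bounded_dirs_convex_hull)
  then have "p + \<alpha> \<in> convex hull B"
    using assms hull_inc[of p B convex] M_polyhedron_add_rec_root unfolding M_set_def by blast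
  moreover have "p + \<alpha> \<in> lattice"
    using assms root_in_lattice lattice_add unfolding M_set_def rec_roots_def by blast
  ultimately show ?thesis using assms(1) unfolding M_set_def by blast
qed

text \<open>All normal cones are polars of subsets of the finite \<Phi>, so only finitely many
  occur; one point is kept for each.\<close>

lemma M_set_finite_maximizers:
  assumes "M_set B"
  shows "\<exists>B\<^sub>0. finite B\<^sub>0 \<and> B\<^sub>0 \<subseteq> B \<and> (\<forall>x\<in>bounded_dirs B. \<exists>p\<in>B\<^sub>0. x \<in> normal_cone_at B p)"
proof -
  have "normal_cone_at B ` B \<subseteq> polar ` Pow \<Phi>" using M_set_normal_cones[OF assms] by blast
  then have "finite (normal_cone_at B ` B)"
    by (rule finite_subset) (simp add: finite_roots)
  then obtain B\<^sub>0 where "B\<^sub>0 \<subseteq> B" "finite B\<^sub>0" "normal_cone_at B ` B = normal_cone_at B ` B\<^sub>0"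
    by (metis finite_subset_image order_refl)
  then show ?thesis using M_set_attained[OF assms] by (metis (no_types, lifting) image_iff)
qed

section \<open>Spherical submodular functions\<close>

definition L_sub :: "('a \<Rightarrow> ereal) \<Rightarrow> bool" where
  "L_sub \<sigma> \<longleftrightarrow> proper_fun \<sigma> \<and> polyhedron (ereal_epigraph \<sigma>) \<and> cone (ereal_epigraph \<sigma>) \<and>
     (\<forall>p. argmin (\<lambda>x. \<sigma> x - ereal (p \<bullet> x)) \<noteq> {} \<longrightarrow>
       (\<exists>A\<subseteq>\<Phi>. argmin (\<lambda>x. \<sigma> x - ereal (p \<bullet> x)) = polar A))"

definition integral_L_sub :: "('a \<Rightarrow> ereal) \<Rightarrow> bool" where
  "integral_L_sub \<sigma> \<longleftrightarrow> L_sub \<sigma> \<and>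
     (\<exists>B\<^sub>0. finite B\<^sub>0 \<and> B\<^sub>0 \<noteq> {} \<and> B\<^sub>0 \<subseteq> lattice \<and>
        (\<forall>x. \<sigma> x < \<infinity> \<longrightarrow> \<sigma> x = ereal (Max ((\<lambda>p. p \<bullet> x) ` B\<^sub>0))))"

definition base :: "'a set \<Rightarrow> ('a \<Rightarrow> ereal) \<Rightarrow> 'a set" where
  "base S \<sigma> = {p. \<forall>x\<in>S. ereal (p \<bullet> x) \<le> \<sigma> x}"

lemma L_sub_cell_closed:
  assumes "L_sub \<sigma>" "x \<in> argmin (\<lambda>x. \<sigma> x - ereal (p \<bullet> x))" "y \<in> cell x"
  shows "y \<in> argmin (\<lambda>x. \<sigma> x - ereal (p \<bullet> x))"
proof -
  obtain A where "A \<subseteq> \<Phi>" "argmin (\<lambda>x. \<sigma> x - ereal (p \<bullet> x)) = polar A"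
    using assms(1,2) unfolding L_sub_def by blast
  then show ?thesis using cell_closed_polar[of A] assms(2,3) by (auto simp: cell_closed_def)
qed

lemma ereal_diff_le_iff: "(s :: ereal) - ereal a \<le> ereal b \<longleftrightarrow> s \<le> ereal (a + b)"
  by (cases s) auto

text \<open>\<sigma> is the support function of the hull. On the barrier cone it is a maximum over
  finitely many lattice points, one for each normal cone, which makes its epigraph
  polyhedral.\<close>

lemma M_set_imp_integral_L_sub:
  assumes B: "M_set B"
  obtains \<sigma> where "integral_L_sub \<sigma>" "\<And>S. spherical S \<Longrightarrow> base S \<sigma> = convex hull B"
proof -
  define P where "P = convex hull B"
  have P: "M_polyhedron P" "P \<noteq> {}" and BL: "B \<subseteq> lattice" and BP: "B \<subseteq> P"
    using B hull_subset[of B convex] by (auto simp: P_def M_set_def M_polyhedron_def)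
  define D where "D = bounded_dirs P"
  have D_polar: "D = polar (rec_roots P)" using M_polyhedron_bounded_dirs[OF P(1)] by (simp add: D_def)
  have DB: "D = bounded_dirs B" by (simp add: D_def P_def bounded_dirs_convex_hull)
  obtain B\<^sub>0 where B\<^sub>0: "finite B\<^sub>0" "B\<^sub>0 \<subseteq> B" "\<And>x. x \<in> D \<Longrightarrow> \<exists>p\<in>B\<^sub>0. x \<in> normal_cone_at P p"
    using M_set_finite_maximizers[OF B] unfolding DB P_def normal_cone_at_convex_hull by blast
  have D0: "0 \<in> D" using convex_cone_bounded_dirs convex_cone_contains_0 by (auto simp: D_def)
  then have ne: "B\<^sub>0 \<noteq> {}" using B\<^sub>0(3) by blast
  define m where "m x = Max ((\<lambda>p. p \<bullet> x) ` B\<^sub>0)" for x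
  define \<sigma> where "\<sigma> x = (if x \<in> D then ereal (m x) else \<infinity>)" for x
  have m_eq: "m x = p \<bullet> x" if "p \<in> P" "x \<in> normal_cone_at P p" for x p
  proof -
    have xD: "x \<in> D" using that normal_cone_at_subset_bounded_dirs by (auto simp: D_def)
    obtain b where b: "b \<in> B\<^sub>0" "x \<in> normal_cone_at P b" using B\<^sub>0(3)[OF xD] by blast
    have "m x = b \<bullet> x"
      unfolding m_def
      by (rule Max_eqI) (use B\<^sub>0 BP b in \<open>auto simp: normal_cone_at_def\<close>)
    moreover have "b \<bullet> x = p \<bullet> x"
    proof (rule antisym)
      show "b \<bullet> x \<le> p \<bullet> x" using b(1) that(2) B\<^sub>0(2) BP by (auto simp: normal_cone_at_def)
      show "p \<bullet> x \<le> b \<bullet> x" using b(2) that(1) by (simp add: normal_cone_at_def)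
    qed
    ultimately show ?thesis by simp
  qed
  have upper: "ereal (p \<bullet> x) \<le> \<sigma> x" if "p \<in> P" for p x
  proof (cases "x \<in> D")
    case True
    then obtain b where b: "b \<in> B\<^sub>0" "x \<in> normal_cone_at P b" using B\<^sub>0(3) by blast
    then have "m x = b \<bullet> x" using B\<^sub>0 BP by (intro m_eq) auto
    then show ?thesis using b that True by (auto simp: \<sigma>_def normal_cone_at_def)
  qed (simp add: \<sigma>_def)
  have le_imp: "q \<in> P" if q: "\<And>s. s \<in> S \<Longrightarrow> ereal (q \<bullet> s) \<le> \<sigma> s" and S: "spherical S" for q S
  proof (rule M_polyhedron_memI[OF P(1) S])
    fix s p assume sp: "s \<in> S" "p \<in> P" "s \<in> normal_cone_at P p"
    then have "s \<in> D" using normal_cone_at_subset_bounded_dirs by (auto simp: D_def)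
    then show "q \<bullet> s \<le> p \<bullet> s" using q[OF sp(1)] m_eq[OF sp(2,3)] by (simp add: \<sigma>_def)
  qed
  have base: "base S \<sigma> = convex hull B" if "spherical S" for S
    using upper le_imp[OF _ that] by (auto simp: base_def P_def)
  obtain S where S: "spherical S" using ex_spherical ..
  have epi: "ereal_epigraph \<sigma> = {(x, t). x \<in> D \<and> (\<forall>b\<in>B\<^sub>0. b \<bullet> x \<le> t)}"
  proof -
    have "m x \<le> t \<longleftrightarrow> (\<forall>b\<in>B\<^sub>0. b \<bullet> x \<le> t)" for x t
      unfolding m_def using B\<^sub>0(1) ne by (subst Max_le_iff) auto
    then show ?thesis by (auto simp: ereal_epigraph_def \<sigma>_def split: if_splits)
  qed
  have "ereal_epigraph \<sigma> = (\<Inter>\<alpha>\<in>rec_roots P. {z. (\<alpha>, 0) \<bullet> z \<le> 0}) \<inter> (\<Inter>b\<in>B\<^sub>0. {z. (b, -1) \<bullet> z \<le> 0})"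
    unfolding epi D_polar by (auto simp: polar_def)
  then have poly: "polyhedron (ereal_epigraph \<sigma>)"
    using B\<^sub>0(1) finite_roots
    by (auto intro!: polyhedron_Int polyhedron_Inter simp: polyhedron_halfspace_le rec_roots_def)
  have coneD: "c *\<^sub>R x \<in> D" if "x \<in> D" "0 \<le> c" for c x
    using convex_cone_scaleR[OF convex_cone_bounded_dirs, of c x P] that by (simp add: D_def)
  have cone: "cone (ereal_epigraph \<sigma>)"
    unfolding cone_def epi by (auto intro!: coneD mult_left_mono)
  have \<sigma>0: "\<sigma> 0 = 0" using D0 ne B\<^sub>0(1) by (simp add: \<sigma>_def m_def zero_ereal_def)
  have proper: "proper_fun \<sigma>"
    unfolding proper_fun_def by (auto simp: \<sigma>_def intro!: exI[of _ 0] D0)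
  have arg: "\<exists>A\<subseteq>\<Phi>. argmin (\<lambda>x. \<sigma> x - ereal (p \<bullet> x)) = polar A"
    if ne_arg: "argmin (\<lambda>x. \<sigma> x - ereal (p \<bullet> x)) \<noteq> {}" for p
  proof -
    obtain x\<^sub>0 where x\<^sub>0: "\<And>y. \<sigma> x\<^sub>0 - ereal (p \<bullet> x\<^sub>0) \<le> \<sigma> y - ereal (p \<bullet> y)"
      using ne_arg by (auto simp: argmin_def)
    have "\<sigma> x\<^sub>0 - ereal (p \<bullet> x\<^sub>0) \<le> 0" using x\<^sub>0[of 0] \<sigma>0 by (simp add: zero_ereal_def)
    then have x\<^sub>0D: "x\<^sub>0 \<in> D" by (auto simp: \<sigma>_def split: if_splits)
    define v where "v = m x\<^sub>0 - p \<bullet> x\<^sub>0"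
    \<comment> \<open>If \<sigma> were below \<open>p\<close> at \<open>y\<close>, homogeneity would
      make \<open>\<sigma> - p\<close> unbounded below along the multiples of \<open>y\<close>, and
      there would be no minimizer.\<close>
    have ge: "ereal (p \<bullet> y) \<le> \<sigma> y" for y
    proof (cases "y \<in> D")
      case True
      then obtain b where b: "b \<in> B\<^sub>0" "y \<in> normal_cone_at P b" using B\<^sub>0(3) by blast
      have v: "v \<le> k * (b \<bullet> y - p \<bullet> y)" if "0 \<le> k" for k
      proof -
        have "k *\<^sub>R y \<in> normal_cone_at P b"
          using b(2) that by (intro convex_cone_scaleR[OF convex_cone_normal_cone_at])
        then have "m (k *\<^sub>R y) = k * (b \<bullet> y)" using m_eq[of b "k *\<^sub>R y"] b B\<^sub>0 BP by auto
        then show ?thesis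
          using x\<^sub>0[of "k *\<^sub>R y"] coneD[OF True that] x\<^sub>0D by (simp add: \<sigma>_def v_def algebra_simps)
      qed
      have "0 \<le> b \<bullet> y - p \<bullet> y"
      proof (rule ccontr)
        assume neg: "\<not> 0 \<le> b \<bullet> y - p \<bullet> y"
        \<comment> \<open>The factor makes the right-hand side equal to
          \<open>- (\<bar>v\<bar> + 1)\<close>, which is below \<open>v\<close>.\<close>
        have "v \<le> ((\<bar>v\<bar> + 1) / (p \<bullet> y - b \<bullet> y)) * (b \<bullet> y - p \<bullet> y)"
          using neg by (intro v) auto
        also have "\<dots> = - (\<bar>v\<bar> + 1)" using neg by (simp add: field_simps)
        finally show False by simp
      qed
      moreover have "m y = b \<bullet> y" using m_eq[of b y] b B\<^sub>0 BP by auto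
      ultimately show ?thesis using True by (simp add: \<sigma>_def)
    qed (simp add: \<sigma>_def)
    then have p: "p \<in> P" using le_imp S by blast
    have "argmin (\<lambda>x. \<sigma> x - ereal (p \<bullet> x)) = normal_cone_at P p"
    proof
      show "argmin (\<lambda>x. \<sigma> x - ereal (p \<bullet> x)) \<subseteq> normal_cone_at P p"
      proof
        fix x assume "x \<in> argmin (\<lambda>x. \<sigma> x - ereal (p \<bullet> x))"
        then have "\<sigma> x - ereal (p \<bullet> x) \<le> \<sigma> 0 - ereal (p \<bullet> 0)" unfolding argmin_def by blast
        then have "\<sigma> x \<le> ereal (p \<bullet> x)" using ereal_diff_le_iff[of "\<sigma> x" "p \<bullet> x" 0] \<sigma>0
          by (simp add: zero_ereal_def)
        then have "ereal (q \<bullet> x) \<le> ereal (p \<bullet> x)" if "q \<in> P" for q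
          using upper[OF that, of x] by (rule order_trans[rotated])
        then show "x \<in> normal_cone_at P p" by (auto simp: normal_cone_at_def)
      qed
      show "normal_cone_at P p \<subseteq> argmin (\<lambda>x. \<sigma> x - ereal (p \<bullet> x))"
      proof
        fix x assume x: "x \<in> normal_cone_at P p"
        then have "\<sigma> x = ereal (p \<bullet> x)"
          using m_eq[OF p x] normal_cone_at_subset_bounded_dirs[of P p] by (auto simp: \<sigma>_def D_def)
        moreover have "0 \<le> \<sigma> y - ereal (p \<bullet> y)" for y
          using ge[of y] by (cases "\<sigma> y") auto
        ultimately show "x \<in> argmin (\<lambda>x. \<sigma> x - ereal (p \<bullet> x))" by (simp add: argmin_def)
      qed
    qed
    then show ?thesis using P(1) p by (auto simp: M_polyhedron_def)
  qed
  have "integral_L_sub \<sigma>"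
    unfolding integral_L_sub_def L_sub_def
    using proper poly cone arg B\<^sub>0 ne BL
    by (auto intro!: exI[of _ B\<^sub>0] simp: \<sigma>_def m_def split: if_splits)
  then show thesis using that base by blast
qed

text \<open>On its domain \<open>D\<close>, \<sigma> is a maximum over \<open>B\<^sub>0\<close>, so
  the set \<open>P\<close> of functionals below \<sigma> should be the hull of
  \<open>B\<^sub>0\<close> plus the polar of \<open>D\<close>. This sum \<open>C\<close> is closed,
  and as \<open>B\<^sub>0\<close> and the generating roots of the cone are lattice vectors,
  \<open>P \<subseteq> C \<subseteq> convex hull B \<subseteq> P\<close>.\<close>

lemma integral_L_sub_imp_M_set:
  assumes \<sigma>: "integral_L_sub \<sigma>" and S: "spherical S"
    and B: "B = base S \<sigma> \<inter> lattice"
  shows "M_set B"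
proof -
  have L: "L_sub \<sigma>" using \<sigma> by (simp add: integral_L_sub_def)
  obtain B\<^sub>0 where B\<^sub>0: "finite B\<^sub>0" "B\<^sub>0 \<noteq> {}" "B\<^sub>0 \<subseteq> lattice"
    and \<sigma>_Max: "\<And>x. \<sigma> x < \<infinity> \<Longrightarrow> \<sigma> x = ereal (Max ((\<lambda>p. p \<bullet> x) ` B\<^sub>0))"
    using \<sigma> unfolding integral_L_sub_def by blast
  define D where "D = {x. \<sigma> x < \<infinity>}"
  define P where "P = {p. \<forall>x. ereal (p \<bullet> x) \<le> \<sigma> x}"
  have B\<^sub>0P: "B\<^sub>0 \<subseteq> P"
    unfolding P_def
  proof clarify
    fix b x assume "b \<in> B\<^sub>0"
    then show "ereal (b \<bullet> x) \<le> \<sigma> x"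
      using \<sigma>_Max[of x] B\<^sub>0(1) by (cases "\<sigma> x < \<infinity>") auto
  qed
  have proper: "proper_fun \<sigma>" and poly: "polyhedron (ereal_epigraph \<sigma>)"
    and cone: "cone (ereal_epigraph \<sigma>)" using L by (auto simp: L_sub_def)
  have epi_iff: "x \<in> D \<longleftrightarrow> (\<exists>t. (x, t) \<in> ereal_epigraph \<sigma>)" for x
    using \<sigma>_Max[of x] by (auto simp: D_def ereal_epigraph_def)
  have epi_cone: "convex_cone (ereal_epigraph \<sigma>)"
    unfolding convex_cone_def
  proof (intro conjI)
    show "ereal_epigraph \<sigma> \<noteq> {}"
      using proper epi_iff by (auto simp: proper_fun_def D_def less_top[symmetric])
    show "convex (ereal_epigraph \<sigma>)" using poly by (rule polyhedron_imp_convex)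
    show "conic (ereal_epigraph \<sigma>)" using cone by (simp add: cone_def conic_def)
  qed
  have D_cone: "convex_cone D"
    unfolding convex_cone_iff
  proof (intro conjI ballI allI impI)
    show "0 \<in> D" using convex_cone_contains_0[OF epi_cone] epi_iff[of 0] by (auto simp: zero_prod_def)
    fix x y assume "x \<in> D" "y \<in> D"
    then show "x + y \<in> D" using convex_cone_add[OF epi_cone] epi_iff by fastforce
  next
    fix x c assume "x \<in> D" "0 \<le> (c::real)"
    then show "c *\<^sub>R x \<in> D" using convex_cone_scaleR[OF epi_cone] epi_iff by fastforce
  qed
  have \<sigma>0: "\<sigma> 0 = 0"
    using \<sigma>_Max[of 0] convex_cone_contains_0[OF D_cone] B\<^sub>0 by (simp add: D_def zero_ereal_def)
  have argmin_eq: "argmin (\<lambda>x. \<sigma> x - ereal (p \<bullet> x)) = {x. \<sigma> x = ereal (p \<bullet> x)}" if "p \<in> P" for p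
  proof -
    have ge: "ereal (p \<bullet> y) \<le> \<sigma> y" for y using that by (simp add: P_def)
    have 0: "0 \<le> \<sigma> y - ereal (p \<bullet> y)" for y
      using ge[of y] by (cases "\<sigma> y") auto
    show ?thesis
    proof
      show "{x. \<sigma> x = ereal (p \<bullet> x)} \<subseteq> argmin (\<lambda>x. \<sigma> x - ereal (p \<bullet> x))"
        using 0 by (auto simp: argmin_def)
      show "argmin (\<lambda>x. \<sigma> x - ereal (p \<bullet> x)) \<subseteq> {x. \<sigma> x = ereal (p \<bullet> x)}"
      proof clarify
        fix x assume "x \<in> argmin (\<lambda>x. \<sigma> x - ereal (p \<bullet> x))"
        then have "\<sigma> x - ereal (p \<bullet> x) \<le> \<sigma> 0 - ereal (p \<bullet> 0)" unfolding argmin_def by blast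
        then have "\<sigma> x \<le> ereal (p \<bullet> x)" using ereal_diff_le_iff[of "\<sigma> x" "p \<bullet> x" 0] \<sigma>0
          by (simp add: zero_ereal_def)
        then show "\<sigma> x = ereal (p \<bullet> x)" using ge[of x] by simp
      qed
    qed
  qed
  have tight_polar: "\<exists>A\<subseteq>\<Phi>. {x. \<sigma> x = ereal (p \<bullet> x)} = polar A" if "p \<in> P" for p
  proof -
    have "argmin (\<lambda>x. \<sigma> x - ereal (p \<bullet> x)) \<noteq> {}"
      unfolding argmin_eq[OF that] using \<sigma>0 by (auto simp: zero_ereal_def intro!: exI[of _ 0])
    then have "\<exists>A\<subseteq>\<Phi>. argmin (\<lambda>x. \<sigma> x - ereal (p \<bullet> x)) = polar A"
      using L unfolding L_sub_def by blast
    then show ?thesis by (simp only: argmin_eq[OF that])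
  qed
  have attained: "\<exists>b\<in>B\<^sub>0. \<sigma> x = ereal (b \<bullet> x)" if "x \<in> D" for x
  proof -
    have "Max ((\<lambda>p. p \<bullet> x) ` B\<^sub>0) \<in> (\<lambda>p. p \<bullet> x) ` B\<^sub>0" using B\<^sub>0 by (intro Max_in) auto
    then show ?thesis using \<sigma>_Max[of x] that by (auto simp: D_def)
  qed
  \<comment> \<open>Linearity of \<sigma> on closed cells: the points where \<open>p\<close> touches
    \<sigma> form an L-convex cone, which contains the closed cell of each of its points.\<close>
  have tight_cell: "\<sigma> y = ereal (p \<bullet> y)" if "p \<in> P" "\<sigma> x = ereal (p \<bullet> x)" "y \<in> cell x" for p x y
    using L_sub_cell_closed[OF L, of x p y] argmin_eq[OF that(1)] that by auto
  have D_cell: "cell_closed D"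
    unfolding cell_closed_def
  proof (intro ballI subsetI)
    fix x y assume "x \<in> D" "y \<in> cell x"
    then obtain b where "b \<in> B\<^sub>0" "\<sigma> x = ereal (b \<bullet> x)" using attained by blast
    then have "\<sigma> y = ereal (b \<bullet> y)" using tight_cell \<open>y \<in> cell x\<close> B\<^sub>0P by blast
    then show "y \<in> D" by (simp add: D_def)
  qed
  define \<Phi>D where "\<Phi>D = {\<alpha>\<in>\<Phi>. \<forall>x\<in>D. \<alpha> \<bullet> x \<le> 0}"
  have D_polar: "D = polar \<Phi>D"
    unfolding \<Phi>D_def by (rule cell_closed_convex_cone_eq_polar[OF D_cone D_cell])
  have fin\<Phi>D: "finite \<Phi>D" using finite_roots by (simp add: \<Phi>D_def)
  have base_eq: "base S \<sigma> = P"
  proof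
    show "P \<subseteq> base S \<sigma>" by (auto simp: P_def base_def)
    show "base S \<sigma> \<subseteq> P"
      unfolding P_def
    proof clarify
      fix q x assume q: "q \<in> base S \<sigma>"
      show "ereal (q \<bullet> x) \<le> \<sigma> x"
      proof (cases "x \<in> D")
        case True
        then obtain b where b: "b \<in> B\<^sub>0" "\<sigma> x = ereal (b \<bullet> x)" using attained by blast
        have "(q - b) \<bullet> x \<le> 0"
        proof (rule inner_le_if_spherical[OF S])
          fix s assume "s \<in> S" "s \<in> cell x"
          moreover from this have "\<sigma> s = ereal (b \<bullet> s)" using tight_cell b B\<^sub>0P by blast
          ultimately show "(q - b) \<bullet> s \<le> 0" using q by (force simp: base_def inner_diff_left)
        qed
        then show ?thesis using b by (simp add: inner_diff_left)
      qed (simp add: D_def)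
    qed
  qed
  have P_shift: "p + \<alpha> \<in> P" if "p \<in> P" "\<alpha> \<in> \<Phi>D" for p \<alpha>
    unfolding P_def
  proof clarify
    fix x show "ereal ((p + \<alpha>) \<bullet> x) \<le> \<sigma> x"
    proof (cases "x \<in> D")
      case True
      then have "\<alpha> \<bullet> x \<le> 0" using that(2) by (simp add: \<Phi>D_def)
      then have "ereal ((p + \<alpha>) \<bullet> x) \<le> ereal (p \<bullet> x)" by (simp add: inner_add_left)
      also have "\<dots> \<le> \<sigma> x" using that(1) by (simp add: P_def)
      finally show ?thesis .
    qed (simp add: D_def)
  qed
  define C where "C = (\<Union>b\<in>convex hull B\<^sub>0. \<Union>r\<in>convex_cone hull \<Phi>D. {b + r})"
  have Bdef: "B = P \<inter> lattice" using B base_eq by simp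
  have P_convex: "convex P"
  proof -
    have "P = (\<Inter>x\<in>D. {p. x \<bullet> p \<le> real_of_ereal (\<sigma> x)})"
    proof -
      have "ereal (p \<bullet> x) \<le> \<sigma> x \<longleftrightarrow> (x \<in> D \<longrightarrow> x \<bullet> p \<le> real_of_ereal (\<sigma> x))" for p x
        using attained[of x] by (cases "x \<in> D") (auto simp: inner_commute D_def)
      then show ?thesis unfolding P_def by blast
    qed
    then show ?thesis by (simp add: convex_INT convex_halfspace_le)
  qed
  have normal: "normal_cone_at P p = {x. \<sigma> x = ereal (p \<bullet> x)}" if p: "p \<in> P" for p
  proof
    show "{x. \<sigma> x = ereal (p \<bullet> x)} \<subseteq> normal_cone_at P p"
    proof clarify
      fix x assume x: "\<sigma> x = ereal (p \<bullet> x)"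
      have "q \<bullet> x \<le> p \<bullet> x" if "q \<in> P" for q
      proof -
        have "ereal (q \<bullet> x) \<le> \<sigma> x" using that by (simp add: P_def)
        then show ?thesis using x by simp
      qed
      then show "x \<in> normal_cone_at P p" by (simp add: normal_cone_at_def)
    qed
    show "normal_cone_at P p \<subseteq> {x. \<sigma> x = ereal (p \<bullet> x)}"
    proof clarify
      fix x assume x: "x \<in> normal_cone_at P p"
      \<comment> \<open>Moving from \<open>p\<close> along the roots in \<open>\<Phi>D\<close> stays
        in \<open>P\<close>, which forces the normal direction \<open>x\<close> into the domain of
        \<sigma>.\<close>
      have "\<alpha> \<bullet> x \<le> 0" if "\<alpha> \<in> \<Phi>D" for \<alpha>
        using x P_shift[OF p that] by (force simp: normal_cone_at_def inner_add_left)
      then have "x \<in> D" by (simp add: D_polar polar_def)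
      then obtain b where b: "b \<in> B\<^sub>0" "\<sigma> x = ereal (b \<bullet> x)" using attained by blast
      then have "\<sigma> x \<le> ereal (p \<bullet> x)" using x B\<^sub>0P by (auto simp: normal_cone_at_def)
      moreover have "ereal (p \<bullet> x) \<le> \<sigma> x" using p by (simp add: P_def)
      ultimately show "\<sigma> x = ereal (p \<bullet> x)" by simp
    qed
  qed
  have C_closed: "closed C"
    unfolding C_def using B\<^sub>0(1) fin\<Phi>D
    by (intro compact_closed_sums) (auto intro: closed_convex_cone_hull finite_imp_compact_convex_hull)
  have C_convex: "convex C"
    unfolding C_def by (intro convex_sums convex_convex_hull convex_convex_cone_hull)
  have B\<^sub>0C: "B\<^sub>0 \<subseteq> C"
    using hull_subset[of B\<^sub>0 convex] convex_cone_hull_contains_0[of \<Phi>D] unfolding C_def by force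
  have PC: "P \<subseteq> C"
  proof
    fix p assume p: "p \<in> P"
    show "p \<in> C"
    proof (rule mem_closed_convexI[OF C_closed C_convex])
      show "C \<noteq> {}" using B\<^sub>0C B\<^sub>0(2) by blast
      fix x assume "x \<in> bounded_dirs C"
      then obtain M where M: "\<And>q. q \<in> C \<Longrightarrow> q \<bullet> x \<le> M" by (auto simp: bounded_dirs_def bdd_above_def)
      obtain b\<^sub>0 where b\<^sub>0: "b\<^sub>0 \<in> B\<^sub>0" using B\<^sub>0(2) by blast
      have "\<alpha> \<bullet> x \<le> 0" if "\<alpha> \<in> \<Phi>D" for \<alpha>
      proof (rule ccontr)
        assume pos: "\<not> \<alpha> \<bullet> x \<le> 0"
        \<comment> \<open>Large enough to push the value of
          \<open>b\<^sub>0 + t *\<^sub>R \<alpha>\<close> at \<open>x\<close> beyond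
          \<open>M\<close>.\<close>
        define t where "t = (\<bar>M - b\<^sub>0 \<bullet> x\<bar> + 1) / (\<alpha> \<bullet> x)"
        have "t *\<^sub>R \<alpha> \<in> convex_cone hull \<Phi>D"
          using that pos by (intro convex_cone_hull_mul hull_inc) (auto simp: t_def)
        then have "b\<^sub>0 + t *\<^sub>R \<alpha> \<in> C" using hull_inc[OF b\<^sub>0, of convex] unfolding C_def by blast
        from M[OF this] show False using pos by (simp add: inner_add_left t_def)
      qed
      then have "x \<in> D" by (simp add: D_polar polar_def)
      then obtain b where b: "b \<in> B\<^sub>0" "\<sigma> x = ereal (b \<bullet> x)" using attained by blast
      have "ereal (p \<bullet> x) \<le> ereal (b \<bullet> x)" using p unfolding P_def b(2)[symmetric] by blast
      then show "\<exists>q\<in>C. p \<bullet> x \<le> q \<bullet> x" using b B\<^sub>0C by auto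
    qed
  qed
  have CP: "C \<subseteq> convex hull B"
  proof
    fix p assume "p \<in> C"
    then obtain b r where p: "p = b + r" "b \<in> convex hull B\<^sub>0" "r \<in> convex_cone hull \<Phi>D"
      by (auto simp: C_def)
    have "B\<^sub>0 \<subseteq> B" using B\<^sub>0P B\<^sub>0(3) by (auto simp: Bdef)
    then have b: "b \<in> convex hull B" using p(2) hull_mono by blast
    show "p \<in> convex hull B"
      unfolding p(1)
    proof (rule add_convex_cone_hull_mem[OF fin\<Phi>D convex_convex_hull _ p(3) b])
      fix q \<alpha> assume q: "q \<in> convex hull B" and a: "\<alpha> \<in> \<Phi>D"
      have "(+) \<alpha> ` B \<subseteq> B"
        using P_shift a root_in_lattice lattice_add
        by (auto simp: Bdef \<Phi>D_def add.commute[of \<alpha>])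
      then have "(+) \<alpha> ` (convex hull B) \<subseteq> convex hull B"
        by (metis convex_hull_translation hull_mono)
      then show "q + \<alpha> \<in> convex hull B" using q by (auto simp: add.commute[of q])
    qed
  qed
  have "convex hull B \<subseteq> P" using P_convex by (intro hull_minimal) (auto simp: Bdef)
  then have PB: "P = convex hull B" "P = C" using PC CP by auto
  have "M_polyhedron P"
    unfolding M_polyhedron_def
    using tight_polar normal C_closed C_convex PB(2) B\<^sub>0P B\<^sub>0(2) by auto
  then show ?thesis unfolding M_set_def PB(1)[symmetric] using Bdef by blast
qed

end

section \<open>Closedness of convex hulls\<close>

text \<open>
  Lexicographic maximization of \<open>x\<close> and then \<open>y\<close> is maximization of a small perturbation of \<open>x\<close>, as
  for a polyhedron.  The case \<open>x = 0\<close> says that linear functions that are bounded above have a maximum.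
\<close>

definition regular :: "'a::real_inner set \<Rightarrow> bool" where
  "regular B \<longleftrightarrow> (\<forall>x y. exposed B x \<noteq> {} \<longrightarrow> y \<in> bounded_dirs (exposed B x) \<longrightarrow>
     (\<exists>p\<in>exposed B x. \<exists>\<epsilon>>0. p \<in> exposed B (x + \<epsilon> *\<^sub>R y)))"

lemma regularD:
  assumes "regular B" "exposed B x \<noteq> {}" "y \<in> bounded_dirs (exposed B x)"
  obtains p \<epsilon> where "p \<in> exposed B x" "0 < \<epsilon>" "p \<in> exposed B (x + \<epsilon> *\<^sub>R y)"
  using assms unfolding regular_def by blast

lemma exposed_le: "p \<in> exposed B x \<Longrightarrow> q \<in> B \<Longrightarrow> q \<bullet> x \<le> p \<bullet> x"
  by (simp add: exposed_def)

lemma exposed_eq: "p \<in> exposed B x \<Longrightarrow> q \<in> exposed B x \<Longrightarrow> q \<bullet> x = p \<bullet> x"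
  by (auto simp: exposed_def intro: antisym)

lemma exposed_subset: "exposed B x \<subseteq> B"
  by (auto simp: exposed_def)

lemma exposedI: "p \<in> B \<Longrightarrow> (\<And>q. q \<in> B \<Longrightarrow> q \<bullet> x \<le> p \<bullet> x) \<Longrightarrow> p \<in> exposed B x"
  by (simp add: exposed_def)

lemma exposed_nonempty_bounded_dirs: "exposed B x \<noteq> {} \<Longrightarrow> x \<in> bounded_dirs B"
  by (auto simp: exposed_def bounded_dirs_def bdd_above_def)

text \<open>A face of a face is itself a face: by regularity
  \<open>exposed (exposed B x) y\<^sub>1\<close> is \<open>exposed B w\<close> for a small
  perturbation \<open>w\<close> of \<open>x\<close>. A perturbation of \<open>w\<close> by
  \<open>y\<^sub>2\<close>, restricted to the face, is one of \<open>y\<^sub>1\<close> by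
  \<open>y\<^sub>2\<close>.\<close>

lemma regular_exposed:
  assumes B: "regular B" and ne: "exposed B x \<noteq> {}"
  shows "regular (exposed B x)"
  unfolding regular_def
proof (intro allI impI)
  fix y\<^sub>1 y\<^sub>2
  assume ne1: "exposed (exposed B x) y\<^sub>1 \<noteq> {}"
    and bd2: "y\<^sub>2 \<in> bounded_dirs (exposed (exposed B x) y\<^sub>1)"
  obtain p\<^sub>0 \<epsilon> where p\<^sub>0: "p\<^sub>0 \<in> exposed B x" "0 < \<epsilon>" "p\<^sub>0 \<in> exposed B (x + \<epsilon> *\<^sub>R y\<^sub>1)"
    using regularD[OF B ne exposed_nonempty_bounded_dirs[OF ne1]] by blast
  \<comment> \<open>Half the step that regularity permits: \<open>p\<^sub>0\<close> maximizes both
    \<open>x\<close> and \<open>x + \<epsilon> *\<^sub>R y\<^sub>1\<close>, so a maximizer of their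
    average \<open>w\<close> has to maximize both.\<close>
  define w where "w = x + (\<epsilon> / 2) *\<^sub>R y\<^sub>1"
  have w: "2 * (q \<bullet> w) = q \<bullet> x + q \<bullet> (x + \<epsilon> *\<^sub>R y\<^sub>1)" for q
    by (simp add: w_def inner_add_right)
  have p\<^sub>0B: "p\<^sub>0 \<in> B" using p\<^sub>0(1) exposed_subset by blast
  have p\<^sub>0w: "p\<^sub>0 \<in> exposed B w"
  proof (rule exposedI[OF p\<^sub>0B])
    fix q assume "q \<in> B"
    then show "q \<bullet> w \<le> p\<^sub>0 \<bullet> w"
      using exposed_le[OF p\<^sub>0(1), of q] exposed_le[OF p\<^sub>0(3), of q] w[of q] w[of p\<^sub>0] by linarith
  qed
  have p\<^sub>0y: "p\<^sub>0 \<in> exposed (exposed B x) y\<^sub>1"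
  proof (rule exposedI[OF p\<^sub>0(1)])
    fix q assume q: "q \<in> exposed B x"
    then have "q \<bullet> (x + \<epsilon> *\<^sub>R y\<^sub>1) \<le> p\<^sub>0 \<bullet> (x + \<epsilon> *\<^sub>R y\<^sub>1)"
      using exposed_le[OF p\<^sub>0(3)] exposed_subset by blast
    then show "q \<bullet> y\<^sub>1 \<le> p\<^sub>0 \<bullet> y\<^sub>1"
      using exposed_eq[OF p\<^sub>0(1) q] p\<^sub>0(2) by (simp add: inner_add_right)
  qed
  have eq: "exposed B w = exposed (exposed B x) y\<^sub>1"
  proof
    show "exposed B w \<subseteq> exposed (exposed B x) y\<^sub>1"
    proof
      fix p assume p: "p \<in> exposed B w"
      have pB: "p \<in> B" using p exposed_subset by blast
      have "p \<bullet> w = p\<^sub>0 \<bullet> w" using exposed_eq[OF p\<^sub>0w p] .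
      then have px: "p \<bullet> x = p\<^sub>0 \<bullet> x"
        using exposed_le[OF p\<^sub>0(1) pB] exposed_le[OF p\<^sub>0(3) pB] w[of p] w[of p\<^sub>0] by linarith
      then have "p \<in> exposed B x" using p\<^sub>0(1) pB by (simp add: exposed_def)
      moreover have "p \<bullet> y\<^sub>1 = p\<^sub>0 \<bullet> y\<^sub>1"
        using px \<open>p \<bullet> w = p\<^sub>0 \<bullet> w\<close> p\<^sub>0(2) by (simp add: w_def inner_add_right)
      ultimately show "p \<in> exposed (exposed B x) y\<^sub>1" using p\<^sub>0y by (simp add: exposed_def)
    qed
    show "exposed (exposed B x) y\<^sub>1 \<subseteq> exposed B w"
    proof
      fix p assume p: "p \<in> exposed (exposed B x) y\<^sub>1"
      then have "p \<in> exposed B x" "p \<in> B" using exposed_subset by blast+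
      moreover have "p \<bullet> y\<^sub>1 = p\<^sub>0 \<bullet> y\<^sub>1" using exposed_eq[OF p\<^sub>0y p] .
      ultimately have "p \<bullet> w = p\<^sub>0 \<bullet> w"
        using exposed_eq[OF p\<^sub>0(1)] by (simp add: w_def inner_add_right)
      then show "p \<in> exposed B w" using p\<^sub>0w \<open>p \<in> B\<close> by (simp add: exposed_def)
    qed
  qed
  obtain p \<delta> where p: "p \<in> exposed B w" "0 < \<delta>" "p \<in> exposed B (w + \<delta> *\<^sub>R y\<^sub>2)"
    using regularD[OF B, of w y\<^sub>2] ne1 bd2 unfolding eq by blast
  have pe: "p \<in> exposed (exposed B x) y\<^sub>1" using p(1) eq by simp
  then have px: "p \<in> exposed B x" using exposed_subset by blast
  \<comment> \<open>On the face \<open>x\<close> is constant, and what remains of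
    \<open>w + \<delta> *\<^sub>R y\<^sub>2\<close> is \<open>\<epsilon> / 2\<close> times the new
    direction.\<close>
  have "p \<in> exposed (exposed B x) (y\<^sub>1 + (2 * \<delta> / \<epsilon>) *\<^sub>R y\<^sub>2)"
  proof (rule exposedI[OF px])
    fix q assume q: "q \<in> exposed B x"
    then have "q \<bullet> (w + \<delta> *\<^sub>R y\<^sub>2) \<le> p \<bullet> (w + \<delta> *\<^sub>R y\<^sub>2)"
      using exposed_le[OF p(3)] exposed_subset by blast
    then have "(\<epsilon> / 2) * (q \<bullet> y\<^sub>1) + \<delta> * (q \<bullet> y\<^sub>2) \<le> (\<epsilon> / 2) * (p \<bullet> y\<^sub>1) + \<delta> * (p \<bullet> y\<^sub>2)"
      using exposed_eq[OF px q] by (simp add: w_def inner_add_right)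
    then have "(2 / \<epsilon>) * ((\<epsilon> / 2) * (q \<bullet> y\<^sub>1) + \<delta> * (q \<bullet> y\<^sub>2))
        \<le> (2 / \<epsilon>) * ((\<epsilon> / 2) * (p \<bullet> y\<^sub>1) + \<delta> * (p \<bullet> y\<^sub>2))"
      using p\<^sub>0(2) by (intro mult_left_mono) auto
    moreover have "(2 / \<epsilon>) * ((\<epsilon> / 2) * a + \<delta> * b) = a + (2 * \<delta> / \<epsilon>) * b" for a b
      using p\<^sub>0(2) by (simp add: field_simps)
    ultimately show "q \<bullet> (y\<^sub>1 + (2 * \<delta> / \<epsilon>) *\<^sub>R y\<^sub>2) \<le> p \<bullet> (y\<^sub>1 + (2 * \<delta> / \<epsilon>) *\<^sub>R y\<^sub>2)"
      by (simp add: inner_add_right)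
  qed
  then show "\<exists>p\<in>exposed (exposed B x) y\<^sub>1. \<exists>\<epsilon>>0. p \<in> exposed (exposed B x) (y\<^sub>1 + \<epsilon> *\<^sub>R y\<^sub>2)"
    using pe p(2) p\<^sub>0(2) by (intro bexI[of _ p] exI[of _ "2 * \<delta> / \<epsilon>"]) auto
qed

lemma closure_convex_hull_le:
  assumes "q \<in> closure (convex hull B)" "\<And>b. b \<in> B \<Longrightarrow> b \<bullet> x \<le> c"
  shows "q \<bullet> x \<le> c"
proof -
  have "closure (convex hull B) \<subseteq> {q. x \<bullet> q \<le> c}"
    using assms(2) by (intro closure_minimal hull_minimal closed_halfspace_le convex_halfspace_le)
      (auto simp: inner_commute)
  then show ?thesis using assms(1) by (auto simp: inner_commute)
qed

text \<open>A point \<open>q\<close> of the closure outside the hull is not in its relative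
  interior, so it has a supporting hyperplane that cuts out a face of smaller dimension. Regularity
  at 0 makes this face nonempty, its hull is closed by induction, and regularity at \<open>x\<close>
  shows that no direction separates \<open>q\<close> from it.\<close>

lemma closed_convex_hull_regular:
  fixes B :: "'a::euclidean_space set"
  assumes "regular B"
  shows "closed (convex hull B)"
  using assms
\<comment> \<open>The empty set has affine dimension -1, hence the shift by 1.\<close>
proof (induction "nat (aff_dim B + 1)" arbitrary: B rule: less_induct)
  case less
  have "closure (convex hull B) \<subseteq> convex hull B"
  proof (rule ccontr)
    assume "\<not> ?thesis"
    then obtain q where q: "q \<in> closure (convex hull B)" "q \<notin> convex hull B" by blast
    have B_ne: "B \<noteq> {}" using q(1) by auto
    have "q \<notin> rel_interior (convex hull B)" using q(2) rel_interior_subset by blast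
    then obtain a where a: "\<And>y. y \<in> closure (convex hull B) \<Longrightarrow> a \<bullet> q \<le> a \<bullet> y"
      "\<And>y. y \<in> rel_interior (convex hull B) \<Longrightarrow> a \<bullet> q < a \<bullet> y"
      using supporting_hyperplane_relative_frontier[OF convex_convex_hull q(1)] by metis
    define x where "x = - a"
    have qx: "b \<bullet> x \<le> q \<bullet> x" if "b \<in> B" for b
    proof -
      have "b \<in> closure (convex hull B)" using hull_inc[OF that, of convex] closure_subset by blast
      from a(1)[OF this] show ?thesis by (simp add: x_def inner_commute)
    qed
    have "exposed B 0 = B" by (auto simp: exposed_def)
    moreover have "x \<in> bounded_dirs B"
      using qx by (auto simp: bounded_dirs_def bdd_above_def)
    ultimately obtain p \<epsilon> where p: "p \<in> B" "0 < \<epsilon>" "p \<in> exposed B (0 + \<epsilon> *\<^sub>R x)"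
      using regularD[OF less.prems, of 0 x] B_ne by (metis (no_types))
    have px: "p \<in> exposed B x"
      using p by (auto simp: exposed_def)
    have eq: "p \<bullet> x = q \<bullet> x"
    proof (rule antisym[OF qx[OF p(1)]])
      show "q \<bullet> x \<le> p \<bullet> x" by (rule closure_convex_hull_le[OF q(1)]) (rule exposed_le[OF px])
    qed
    define B' where "B' = exposed B x"
    have "B' \<subseteq> {y. x \<bullet> y = q \<bullet> x}"
      using exposed_eq[OF px] eq by (auto simp: B'_def inner_commute)
    then have aff: "affine hull B' \<subseteq> {y. x \<bullet> y = q \<bullet> x}"
      by (rule hull_minimal) (rule affine_hyperplane)
    have "affine hull B' \<noteq> affine hull B"
    proof
      assume "affine hull B' = affine hull B"
      then have "convex hull B \<subseteq> {y. x \<bullet> y = q \<bullet> x}"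
        using aff convex_hull_subset_affine_hull by blast
      moreover have "rel_interior (convex hull B) \<noteq> {}"
        using B_ne by (simp add: rel_interior_eq_empty)
      then obtain y where "y \<in> rel_interior (convex hull B)" by blast
      ultimately show False
        using a(2) rel_interior_subset[of "convex hull B"] by (fastforce simp: x_def inner_commute)
    qed
    then have "affine hull B' \<subset> affine hull B"
      using hull_mono[OF exposed_subset[of B x], of affine] unfolding B'_def by blast
    then have "aff_dim B' < aff_dim B" by (rule aff_dim_psubset)
    moreover have "regular B'" using regular_exposed less.prems px unfolding B'_def by blast
    ultimately have "closed (convex hull B')"
      using aff_dim_geq[of B'] by (intro less.hyps) auto
    then have "q \<in> convex hull B'"
    proof (rule mem_closed_convexI[OF _ convex_convex_hull])
      show "convex hull B' \<noteq> {}" using px by (auto simp: B'_def)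
      fix y assume "y \<in> bounded_dirs (convex hull B')"
      then have "y \<in> bounded_dirs (exposed B x)" by (simp add: bounded_dirs_convex_hull B'_def)
      then obtain r \<epsilon> where r: "r \<in> exposed B x" "0 < \<epsilon>" "r \<in> exposed B (x + \<epsilon> *\<^sub>R y)"
        using regularD[OF less.prems] px by blast
      \<comment> \<open>A maximum over all of \<open>B\<close> bounds the closure, whereas a bound
        over the face alone would say nothing about \<open>q\<close> yet; the equal values at
        \<open>x\<close> then cancel.\<close>
      have "q \<bullet> (x + \<epsilon> *\<^sub>R y) \<le> r \<bullet> (x + \<epsilon> *\<^sub>R y)"
        by (rule closure_convex_hull_le[OF q(1)]) (rule exposed_le[OF r(3)])
      then have "q \<bullet> y \<le> r \<bullet> y"
        using exposed_eq[OF px r(1)] eq r(2) by (simp add: inner_add_right)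
      then show "\<exists>r\<in>convex hull B'. q \<bullet> y \<le> r \<bullet> y"
        using hull_inc[OF r(1), of convex] by (auto simp: B'_def)
    qed
    then show False using q(2) hull_mono[OF exposed_subset[of B x], of convex] by (auto simp: B'_def)
  qed
  then show ?case by (simp add: closure_subset_eq)
qed

context root_arrangement
begin

text \<open>Points of the hull inherit the cell condition: if \<open>x\<close> is normal at a convex
  combination \<open>p\<close>, it is normal at every point of positive weight, and moving
  \<open>x\<close> within its closed cell keeps it normal at each of these, hence at
  \<open>p\<close>.\<close>

lemma M_polyhedron_regular:
  assumes "B \<noteq> {}" "regular B" and cc: "\<And>p. p \<in> B \<Longrightarrow> cell_closed (normal_cone_at B p)"
  shows "M_polyhedron (convex hull B)"
  unfolding M_polyhedron_def
proof (intro conjI ballI)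
  show "convex hull B \<noteq> {}" using assms(1) by simp
  show "closed (convex hull B)" by (rule closed_convex_hull_regular[OF assms(2)])
  show "convex (convex hull B)" by (rule convex_convex_hull)
  fix p assume "p \<in> convex hull B"
  then obtain T u where T: "finite T" "T \<subseteq> B" "\<forall>v\<in>T. 0 \<le> u v" "sum u T = 1" "p = (\<Sum>v\<in>T. u v *\<^sub>R v)"
    unfolding convex_hull_explicit by blast
  have ip: "p \<bullet> x - c = (\<Sum>v\<in>T. u v * (v \<bullet> x - c))" for x c
    using T(4) by (simp add: T(5) inner_sum_left right_diff_distrib sum_subtractf flip: sum_distrib_right)
  have "cell_closed (normal_cone_at B p)"
    unfolding cell_closed_def
  proof (intro ballI subsetI)
    fix x y assume x: "x \<in> normal_cone_at B p" and y: "y \<in> cell x"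
    have "(\<Sum>v\<in>T. u v * (p \<bullet> x - v \<bullet> x)) = 0"
      using ip[of x "p \<bullet> x"] by (simp add: algebra_simps sum_subtractf)
    then have zero: "u v * (p \<bullet> x - v \<bullet> x) = 0" if "v \<in> T" for v
      using sum_nonneg_eq_0_iff[OF T(1), of "\<lambda>v. u v * (p \<bullet> x - v \<bullet> x)"] x T(2,3) that
      by (auto simp: normal_cone_at_def subset_iff)
    have "q \<bullet> y \<le> p \<bullet> y" if q: "q \<in> B" for q
    proof -
      have "0 \<le> u v * (v \<bullet> y - q \<bullet> y)" if v: "v \<in> T" for v
      proof (cases "u v = 0")
        case False
        then have "v \<bullet> x = p \<bullet> x" using zero[OF v] by simp
        then have "x \<in> normal_cone_at B v" using x by (simp add: normal_cone_at_def)
        then have "y \<in> normal_cone_at B v" using cc[of v] y v T(2) by (auto simp: cell_closed_def)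
        then show ?thesis using q T(3) v by (simp add: normal_cone_at_def)
      qed simp
      then have "0 \<le> p \<bullet> y - q \<bullet> y" unfolding ip by (rule sum_nonneg)
      then show ?thesis by simp
    qed
    then show "y \<in> normal_cone_at B p" by (simp add: normal_cone_at_def)
  qed
  then have "normal_cone_at B p = polar {\<alpha>\<in>\<Phi>. \<forall>x\<in>normal_cone_at B p. \<alpha> \<bullet> x \<le> 0}"
    by (rule cell_closed_convex_cone_eq_polar[OF convex_cone_normal_cone_at])
  then show "\<exists>A\<subseteq>\<Phi>. normal_cone_at (convex hull B) p = polar A"
    unfolding normal_cone_at_convex_hull
    by (intro exI[of _ "{\<alpha>\<in>\<Phi>. \<forall>x\<in>normal_cone_at B p. \<alpha> \<bullet> x \<le> 0}"]) simp
qed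

section \<open>The cone condition\<close>

definition root_cone :: "'a set \<Rightarrow> bool" where
  "root_cone B \<longleftrightarrow> (\<forall>p\<in>B. \<forall>q\<in>B. q - p \<in> convex_cone hull {\<alpha>\<in>\<Phi>. p + \<alpha> \<in> B})"

text \<open>Maximality at \<open>p\<close> becomes a local condition, involving only the finitely
  many admissible roots.\<close>

lemma root_cone_normal_cone:
  assumes "root_cone B" "p \<in> B"
  shows "normal_cone_at B p = polar {\<alpha>\<in>\<Phi>. p + \<alpha> \<in> B}"
proof
  show "normal_cone_at B p \<subseteq> polar {\<alpha>\<in>\<Phi>. p + \<alpha> \<in> B}"
  proof
    fix x assume "x \<in> normal_cone_at B p"
    then have "(p + \<alpha>) \<bullet> x \<le> p \<bullet> x" if "p + \<alpha> \<in> B" for \<alpha>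
      using that unfolding normal_cone_at_def by blast
    then show "x \<in> polar {\<alpha>\<in>\<Phi>. p + \<alpha> \<in> B}" by (simp add: polar_def inner_add_left)
  qed
  show "polar {\<alpha>\<in>\<Phi>. p + \<alpha> \<in> B} \<subseteq> normal_cone_at B p"
  proof
    fix x assume x: "x \<in> polar {\<alpha>\<in>\<Phi>. p + \<alpha> \<in> B}"
    have "(q - p) \<bullet> x \<le> 0" if "q \<in> B" for q
      using convex_cone_hull_inner_le[of "q - p" "{\<alpha>\<in>\<Phi>. p + \<alpha> \<in> B}" x] assms that x
      by (auto simp: root_cone_def polar_def)
    then show "x \<in> normal_cone_at B p" by (simp add: normal_cone_at_def inner_diff_left)
  qed
qed

text \<open>Inside the face of \<open>x\<close>, climb by admissible roots that increase
  \<open>y\<close>. There are finitely many roots, so each step gains a fixed amount, and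
  boundedness stops the climb. At the end point all admissible roots are nonpositive on a small
  perturbation of \<open>x\<close>.\<close>

lemma root_cone_regular:
  assumes B: "root_cone B"
  shows "regular B"
  unfolding regular_def
proof (intro allI impI)
  fix x y assume ne: "exposed B x \<noteq> {}" and bd: "y \<in> bounded_dirs (exposed B x)"
  obtain M where M: "\<And>q. q \<in> exposed B x \<Longrightarrow> q \<bullet> y \<le> M"
    using bd by (auto simp: bounded_dirs_def bdd_above_def)
  have "\<exists>p\<in>exposed B x. \<forall>\<alpha>\<in>\<Phi>. p + \<alpha> \<in> exposed B x \<longrightarrow> \<alpha> \<bullet> y \<le> 0"
  proof (rule ccontr)
    assume "\<not> ?thesis"
    then have step: "\<exists>\<alpha>\<in>\<Phi>. p + \<alpha> \<in> exposed B x \<and> 0 < \<alpha> \<bullet> y" if "p \<in> exposed B x" for p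
      using that by (auto simp: not_le)
    \<comment> \<open>The least gain of a climbing step; the inserted 1 makes the minimum meaningful
      when no root increases \<open>y\<close>.\<close>
    define \<delta> where "\<delta> = Min (insert 1 ((\<lambda>\<alpha>. \<alpha> \<bullet> y) ` {\<alpha>\<in>\<Phi>. 0 < \<alpha> \<bullet> y}))"
    have fin: "finite (insert 1 ((\<lambda>\<alpha>. \<alpha> \<bullet> y) ` {\<alpha>\<in>\<Phi>. 0 < \<alpha> \<bullet> y}))" using finite_roots by simp
    have \<delta>: "0 < \<delta>" using fin by (auto simp: \<delta>_def Min_gr_iff)
    have \<delta>_le: "\<delta> \<le> \<alpha> \<bullet> y" if "\<alpha> \<in> \<Phi>" "0 < \<alpha> \<bullet> y" for \<alpha>
      unfolding \<delta>_def using fin that by (intro Min_le) auto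
    obtain p\<^sub>0 where p\<^sub>0: "p\<^sub>0 \<in> exposed B x" using ne by blast
    have "\<exists>p\<in>exposed B x. p\<^sub>0 \<bullet> y + real n * \<delta> \<le> p \<bullet> y" for n
    proof (induction n)
      case (Suc n)
      then obtain p where p: "p \<in> exposed B x" "p\<^sub>0 \<bullet> y + real n * \<delta> \<le> p \<bullet> y" by blast
      obtain \<alpha> where a: "\<alpha> \<in> \<Phi>" "p + \<alpha> \<in> exposed B x" "0 < \<alpha> \<bullet> y" using step[OF p(1)] by blast
      have "p\<^sub>0 \<bullet> y + real (Suc n) * \<delta> \<le> (p + \<alpha>) \<bullet> y"
        using p(2) \<delta>_le[OF a(1,3)] by (simp add: inner_add_left algebra_simps)
      then show ?case using a(2) by blast
    qed (use p\<^sub>0 in auto)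
    then have "p\<^sub>0 \<bullet> y + real n * \<delta> \<le> M" for n using M by (meson order_trans)
    moreover obtain n where "(M - p\<^sub>0 \<bullet> y) / \<delta> < real n" using reals_Archimedean2 by blast
    then have "M < p\<^sub>0 \<bullet> y + real n * \<delta>" using \<delta> by (simp add: field_simps)
    ultimately show False by (meson not_le)
  qed
  then obtain p where p: "p \<in> exposed B x"
    and py: "\<And>\<alpha>. \<alpha> \<in> \<Phi> \<Longrightarrow> p + \<alpha> \<in> exposed B x \<Longrightarrow> \<alpha> \<bullet> y \<le> 0" by blast
  have pB: "p \<in> B" using p exposed_subset by blast
  \<comment> \<open>Keeps roots negative at \<open>x\<close> negative at
    \<open>x + \<epsilon> *\<^sub>R y\<close>. The other admissible roots vanish at \<open>x\<close>
    and lead to points of the face, where \<open>py\<close> applies.\<close>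
  obtain \<epsilon> where e: "\<epsilon> > 0" "\<And>\<gamma>. \<gamma> \<in> \<Phi> \<Longrightarrow> 0 < \<gamma> \<bullet> (- x) \<Longrightarrow> 0 < \<gamma> \<bullet> (- x + \<epsilon> *\<^sub>R (- y))"
    using finite_positive_stable[OF finite_roots, of "- x" "- y"] by blast
  have "\<alpha> \<bullet> (x + \<epsilon> *\<^sub>R y) \<le> 0" if a: "\<alpha> \<in> \<Phi>" "p + \<alpha> \<in> B" for \<alpha>
  proof (cases "\<alpha> \<bullet> x < 0")
    case True
    then show ?thesis using e(2)[OF a(1)] by (simp add: inner_add_right inner_diff_right)
  next
    case False
    then have 0: "\<alpha> \<bullet> x = 0" using exposed_le[OF p a(2)] by (simp add: inner_add_left)
    then have "p + \<alpha> \<in> exposed B x" using p a(2) by (simp add: exposed_def inner_add_left)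
    then show ?thesis using py[OF a(1)] 0 e(1) by (simp add: inner_add_right mult_nonneg_nonpos)
  qed
  then have "x + \<epsilon> *\<^sub>R y \<in> normal_cone_at B p"
    unfolding root_cone_normal_cone[OF B pB] by (simp add: polar_def)
  then have "p \<in> exposed B (x + \<epsilon> *\<^sub>R y)" using pB by (simp add: exposed_iff)
  then show "\<exists>p\<in>exposed B x. \<exists>\<epsilon>>0. p \<in> exposed B (x + \<epsilon> *\<^sub>R y)" using p e(1) by blast
qed

lemma root_cone_imp_M_set:
  assumes "B \<noteq> {}" "B = convex hull B \<inter> lattice" "root_cone B"
  shows "M_set B"
  unfolding M_set_def
proof (rule conjI[OF M_polyhedron_regular[OF assms(1) root_cone_regular[OF assms(3)]] assms(2)])
  fix p assume "p \<in> B"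
  then show "cell_closed (normal_cone_at B p)"
    unfolding root_cone_normal_cone[OF assms(3) \<open>p \<in> B\<close>] by (intro cell_closed_polar) auto
qed

section \<open>Simple systems and the maximality property\<close>

definition simple :: "'a set \<Rightarrow> bool" where
  "simple \<Delta> \<longleftrightarrow> \<Delta> \<subseteq> \<Phi> \<and> independent \<Delta> \<and> span \<Delta> = UNIV \<and>
     (\<forall>\<alpha>\<in>\<Phi>. \<alpha> \<in> convex_cone hull \<Delta> \<or> - \<alpha> \<in> convex_cone hull \<Delta>)"

definition maximality :: "'a set \<Rightarrow> bool" where
  "maximality B \<longleftrightarrow> (\<forall>p\<in>B. \<forall>q\<in>B. \<forall>\<Delta>. simple \<Delta> \<longrightarrow>
     (\<exists>r\<in>B. r - p \<in> convex_cone hull \<Delta> \<and> r - q \<in> convex_cone hull \<Delta>))"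

text \<open>For a simple system the \<open>\<omega> \<alpha>\<close> are the fundamental coweights;
  they are the vectors that represent the coordinate functionals.\<close>

lemma dual_basis:
  fixes \<Delta> :: "'b::euclidean_space set"
  assumes "independent \<Delta>" "span \<Delta> = UNIV" "finite \<Delta>"
  obtains \<omega> where "\<And>q. q = (\<Sum>\<alpha>\<in>\<Delta>. (q \<bullet> \<omega> \<alpha>) *\<^sub>R \<alpha>)"
    "\<And>\<alpha> \<beta>. \<alpha> \<in> \<Delta> \<Longrightarrow> \<beta> \<in> \<Delta> \<Longrightarrow> \<beta> \<bullet> \<omega> \<alpha> = (if \<beta> = \<alpha> then 1 else 0)"
proof -
  define \<omega> where "\<omega> \<alpha> = adjoint (\<lambda>q. representation \<Delta> q \<alpha>) 1" for \<alpha>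
  have lin: "linear (\<lambda>q. representation \<Delta> q \<alpha>)" for \<alpha>
    by (intro linearI)
      (simp_all add: representation_add[OF assms(1)] representation_scale[OF assms(1)] assms(2))
  have rep: "representation \<Delta> q \<alpha> = q \<bullet> \<omega> \<alpha>" for q \<alpha>
    using adjoint_works[OF lin, of q \<alpha> 1] by (simp add: \<omega>_def)
  show thesis
  proof (rule that)
    show "q = (\<Sum>\<alpha>\<in>\<Delta>. (q \<bullet> \<omega> \<alpha>) *\<^sub>R \<alpha>)" for q
      using sum_representation_eq[OF assms(1) _ assms(3) order_refl, of q] assms(2)
      by (simp add: rep)
    show "\<beta> \<bullet> \<omega> \<alpha> = (if \<beta> = \<alpha> then 1 else 0)" if "\<beta> \<in> \<Delta>" for \<alpha> \<beta>
      using representation_basis[OF assms(1) that] by (simp flip: rep)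
  qed
qed

lemma M_set_imp_maximality:
  assumes B: "M_set B"
  shows "maximality B"
  unfolding maximality_def
proof (intro ballI allI impI)
  fix p q \<Delta> assume p: "p \<in> B" and q: "q \<in> B" and \<Delta>: "simple \<Delta>"
  have fin: "finite \<Delta>" using \<Delta> finite_roots finite_subset by (auto simp: simple_def)
  obtain \<omega> where \<omega>: "\<And>q. q = (\<Sum>\<alpha>\<in>\<Delta>. (q \<bullet> \<omega> \<alpha>) *\<^sub>R \<alpha>)"
    "\<And>\<alpha> \<beta>. \<alpha> \<in> \<Delta> \<Longrightarrow> \<beta> \<in> \<Delta> \<Longrightarrow> \<beta> \<bullet> \<omega> \<alpha> = (if \<beta> = \<alpha> then 1 else 0)"
  proof (rule dual_basis[of \<Delta>])
    show "independent \<Delta>" "span \<Delta> = UNIV" "finite \<Delta>"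
      using \<Delta> fin by (simp_all add: simple_def)
  qed (rule that)
  have coneI: "d \<in> convex_cone hull \<Delta>" if "\<And>\<alpha>. \<alpha> \<in> \<Delta> \<Longrightarrow> 0 \<le> d \<bullet> \<omega> \<alpha>" for d
    by (subst \<omega>(1)[of d]) (rule convex_cone_hull_sum, use that in \<open>auto intro: hull_inc\<close>)
  have cone_nonneg: "0 \<le> d \<bullet> \<omega> \<alpha>" if "d \<in> convex_cone hull \<Delta>" "\<alpha> \<in> \<Delta>" for d \<alpha>
  proof -
    have "d \<bullet> (- \<omega> \<alpha>) \<le> 0"
      by (rule convex_cone_hull_inner_le[OF that(1)]) (simp add: \<omega>(2)[OF that(2)])
    then show ?thesis by simp
  qed
  define D where "D = bounded_dirs B"
  have Dc: "convex_cone D" by (simp add: D_def convex_cone_bounded_dirs)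
  define I where "I = {\<alpha>\<in>\<Delta>. \<omega> \<alpha> \<in> D}"
  have I: "finite I" "I \<subseteq> \<Delta>" using fin by (auto simp: I_def)
  have "(\<Sum>\<alpha>\<in>J. \<omega> \<alpha>) \<in> D" if "J \<subseteq> I" for J
    using finite_subset[OF that I(1)] that
    by (induction J) (auto simp: I_def convex_cone_contains_0[OF Dc] convex_cone_add[OF Dc])
  then have "(\<Sum>\<alpha>\<in>I. \<omega> \<alpha>) \<in> bounded_dirs B" by (simp add: D_def)
  then obtain r\<^sub>0 where r\<^sub>0: "r\<^sub>0 \<in> B" "(\<Sum>\<alpha>\<in>I. \<omega> \<alpha>) \<in> normal_cone_at B r\<^sub>0"
    using M_set_attained[OF B] by blast
  have root_\<omega>: "(\<forall>\<alpha>\<in>\<Delta>. 0 \<le> \<beta> \<bullet> \<omega> \<alpha>) \<or> (\<forall>\<alpha>\<in>\<Delta>. \<beta> \<bullet> \<omega> \<alpha> \<le> 0)" if b: "\<beta> \<in> \<Phi>" for \<beta>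
  proof -
    have "\<beta> \<in> convex_cone hull \<Delta> \<or> - \<beta> \<in> convex_cone hull \<Delta>" using \<Delta> b by (simp add: simple_def)
    then show ?thesis using cone_nonneg[of \<beta>] cone_nonneg[of "- \<beta>"] by fastforce
  qed
  \<comment> \<open>A root has coordinates of one sign. If it is nonpositive on a sum of coweights,
    it is so on each of them, so a maximizer of the sum maximizes all the bounded coordinates
    simultaneously.\<close>
  have in_cell: "\<omega> \<alpha> \<in> cell (\<Sum>\<alpha>\<in>I. \<omega> \<alpha>)" if a: "\<alpha> \<in> I" for \<alpha>
    unfolding cell_def
  proof clarify
    fix \<beta> assume b: "\<beta> \<in> \<Phi>" "\<beta> \<bullet> (\<Sum>\<alpha>\<in>I. \<omega> \<alpha>) \<le> 0"
    from root_\<omega>[OF b(1)] show "\<beta> \<bullet> \<omega> \<alpha> \<le> 0"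
    proof
      assume nn: "\<forall>\<alpha>\<in>\<Delta>. 0 \<le> \<beta> \<bullet> \<omega> \<alpha>"
      have "\<beta> \<bullet> \<omega> \<alpha> \<le> (\<Sum>\<alpha>\<in>I. \<beta> \<bullet> \<omega> \<alpha>)"
        using a nn I by (intro member_le_sum) auto
      then show ?thesis using b(2) by (simp add: inner_sum_right)
    qed (use a I in auto)
  qed
  have r\<^sub>0I: "s \<bullet> \<omega> \<alpha> \<le> r\<^sub>0 \<bullet> \<omega> \<alpha>" if "\<alpha> \<in> I" "s \<in> B" for \<alpha> s
    using M_set_cell_closed[OF B r\<^sub>0(1)] r\<^sub>0(2) in_cell[OF that(1)] that(2)
    by (auto simp: cell_closed_def normal_cone_at_def)
  have "\<exists>r\<in>B. \<forall>\<alpha>\<in>I \<union> J. p \<bullet> \<omega> \<alpha> \<le> r \<bullet> \<omega> \<alpha> \<and> q \<bullet> \<omega> \<alpha> \<le> r \<bullet> \<omega> \<alpha>" if "J \<subseteq> \<Delta> - I" for J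
    using finite_subset[OF that finite_Diff[OF fin]] that
  proof (induction J rule: finite_induct)
    case empty
    then show ?case using r\<^sub>0(1) r\<^sub>0I p q by blast
  next
    case (insert j J)
    then obtain r where r: "r \<in> B" "\<forall>\<alpha>\<in>I \<union> J. p \<bullet> \<omega> \<alpha> \<le> r \<bullet> \<omega> \<alpha> \<and> q \<bullet> \<omega> \<alpha> \<le> r \<bullet> \<omega> \<alpha>" by blast
    have j: "j \<in> \<Delta>" "\<omega> j \<notin> D" using insert.prems by (auto simp: I_def)
    \<comment> \<open>An unbounded coweight is positive on some recession root. One positive
      coordinate makes all coordinates of that root nonnegative, so adding it spoils none of the
      inequalities already achieved.\<close>
    then obtain \<alpha> where a: "\<alpha> \<in> rec_roots B" "0 < \<alpha> \<bullet> \<omega> j"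
      using M_set_bounded_dirs[OF B] by (auto simp: D_def polar_def not_le)
    then have nn: "0 \<le> \<alpha> \<bullet> \<omega> \<beta>" if "\<beta> \<in> \<Delta>" for \<beta>
      using root_\<omega>[of \<alpha>] j(1) that by (force simp: rec_roots_def)
    have shift: "r + real n *\<^sub>R \<alpha> \<in> B" for n
    proof (induction n)
      case (Suc n)
      then have "(r + real n *\<^sub>R \<alpha>) + \<alpha> \<in> B" by (rule M_set_add_rec_root[OF B _ a(1)])
      then show ?case by (simp add: algebra_simps)
    qed (use r in simp)
    define c where "c = max (p \<bullet> \<omega> j) (q \<bullet> \<omega> j)"
    obtain n where "(c - r \<bullet> \<omega> j) / (\<alpha> \<bullet> \<omega> j) < real n" using reals_Archimedean2 by blast
    then have "c \<le> (r + real n *\<^sub>R \<alpha>) \<bullet> \<omega> j" using a(2) by (simp add: inner_add_left field_simps)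
    moreover have "r \<bullet> \<omega> \<beta> \<le> (r + real n *\<^sub>R \<alpha>) \<bullet> \<omega> \<beta>" if "\<beta> \<in> I \<union> J" for \<beta>
      using nn[of \<beta>] that I(2) insert.prems by (auto simp: inner_add_left)
    ultimately show ?case
      using r(2) shift[of n] by (intro bexI[of _ "r + real n *\<^sub>R \<alpha>"]) (auto simp: c_def intro: order_trans)
  qed
  from this[of "\<Delta> - I"] obtain r where "r \<in> B" "\<forall>\<alpha>\<in>\<Delta>. p \<bullet> \<omega> \<alpha> \<le> r \<bullet> \<omega> \<alpha> \<and> q \<bullet> \<omega> \<alpha> \<le> r \<bullet> \<omega> \<alpha>"
    using I(2) by auto
  then show "\<exists>r\<in>B. r - p \<in> convex_cone hull \<Delta> \<and> r - q \<in> convex_cone hull \<Delta>"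
    by (intro bexI[of _ r] conjI coneI) (auto simp: inner_diff_left)
qed

end

section \<open>Existence of simple systems adapted to a direction\<close>

lemma ex_generic_vector:
  fixes G :: "'a::real_inner set"
  assumes "finite G" "0 \<notin> G"
  shows "\<exists>u. \<forall>\<gamma>\<in>G. \<gamma> \<bullet> u \<noteq> 0"
  using assms
proof (induction G)
  case (insert \<alpha> F)
  then obtain u where u: "\<forall>\<gamma>\<in>F. \<gamma> \<bullet> u \<noteq> 0" by auto
  show ?case
  proof (cases "\<alpha> \<bullet> u = 0")
    case True
    \<comment> \<open>Negatives are included so that both signs survive the perturbation. Moving
      along \<alpha> itself makes \<alpha> nonzero.\<close>
    have fin: "finite (F \<union> uminus ` F)" using insert.hyps by simp
    obtain \<epsilon> where e: "\<epsilon> > 0" "\<And>\<gamma>. \<gamma> \<in> F \<union> uminus ` F \<Longrightarrow> 0 < \<gamma> \<bullet> u \<Longrightarrow> 0 < \<gamma> \<bullet> (u + \<epsilon> *\<^sub>R \<alpha>)"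
      using finite_positive_stable[OF fin, of u \<alpha>] by blast
    have "\<gamma> \<bullet> (u + \<epsilon> *\<^sub>R \<alpha>) \<noteq> 0" if "\<gamma> \<in> F" for \<gamma>
      using e(2)[of \<gamma>] e(2)[of "- \<gamma>"] u that by (cases "0 < \<gamma> \<bullet> u") fastforce+
    moreover have "\<alpha> \<bullet> (u + \<epsilon> *\<^sub>R \<alpha>) \<noteq> 0"
      using True e(1) insert.prems by (auto simp: inner_add_right)
    ultimately show ?thesis by (intro exI[of _ "u + \<epsilon> *\<^sub>R \<alpha>"]) auto
  qed (use u in auto)
qed auto

text \<open>In a linear relation move the negative coefficients to the other side. Both sides equal
  the same vector \<open>x\<close>, obtuseness gives \<open>x \<bullet> x \<le> 0\<close>, and
  pairing \<open>x = 0\<close> with \<open>w\<close> kills all coefficients.\<close>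

lemma obtuse_independent:
  fixes \<Delta> :: "'a::real_inner set"
  assumes "finite \<Delta>" and pos: "\<And>\<alpha>. \<alpha> \<in> \<Delta> \<Longrightarrow> 0 < \<alpha> \<bullet> w"
    and obtuse: "\<And>\<alpha> \<beta>. \<alpha> \<in> \<Delta> \<Longrightarrow> \<beta> \<in> \<Delta> \<Longrightarrow> \<alpha> \<noteq> \<beta> \<Longrightarrow> \<alpha> \<bullet> \<beta> \<le> 0"
  shows "independent \<Delta>"
proof
  assume "dependent \<Delta>"
  then obtain u where u: "\<exists>v\<in>\<Delta>. u v \<noteq> 0" "(\<Sum>v\<in>\<Delta>. u v *\<^sub>R v) = 0"
    using dependent_finite[OF assms(1)] by auto
  define P N where "P = {v\<in>\<Delta>. 0 < u v}" and "N = {v\<in>\<Delta>. u v < 0}"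
  have fin: "finite P" "finite N" using assms(1) by (auto simp: P_def N_def)
  define x where "x = (\<Sum>v\<in>P. u v *\<^sub>R v)"
  have "(\<Sum>v\<in>\<Delta>. u v *\<^sub>R v) = (\<Sum>v\<in>P \<union> N. u v *\<^sub>R v)"
    by (rule sum.mono_neutral_right) (use assms(1) in \<open>auto simp: P_def N_def\<close>)
  also have "\<dots> = x + (\<Sum>v\<in>N. u v *\<^sub>R v)"
    unfolding x_def by (rule sum.union_disjoint) (use fin in \<open>auto simp: P_def N_def\<close>)
  finally have x2: "x = (\<Sum>v\<in>N. (- u v) *\<^sub>R v)"
    using u(2) by (simp add: sum_negf eq_neg_iff_add_eq_0)
  have "x \<bullet> x = (\<Sum>v\<in>P. u v *\<^sub>R v) \<bullet> (\<Sum>v\<in>N. (- u v) *\<^sub>R v)"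
    by (simp only: x2[symmetric] x_def[symmetric])
  also have "\<dots> = (\<Sum>v\<in>P. \<Sum>v'\<in>N. u v * (- u v') * (v \<bullet> v'))"
    unfolding inner_sum_left by (simp add: inner_sum_right sum_negf sum_distrib_left mult_ac)
  also have "\<dots> \<le> 0"
  proof (intro sum_nonpos)
    fix v v' assume "v \<in> P" "v' \<in> N"
    then have "v \<bullet> v' \<le> 0" "0 \<le> u v * (- u v')"
      by (auto simp: P_def N_def mult_nonneg_nonpos intro!: obtuse)
    then show "u v * (- u v') * (v \<bullet> v') \<le> 0" by (rule mult_nonneg_nonpos[rotated])
  qed
  finally have x0: "x = 0" by (metis inner_gt_zero_iff not_le)
  have "(\<Sum>v\<in>P. u v * (v \<bullet> w)) = 0"
    using arg_cong[OF x0, of "\<lambda>x. x \<bullet> w"] by (simp add: x_def inner_sum_left)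
  then have "\<forall>v\<in>P. u v * (v \<bullet> w) = 0"
    using fin(1) pos by (subst (asm) sum_nonneg_eq_0_iff) (auto simp: P_def less_imp_le)
  then have "P = {}" using pos by (force simp: P_def)
  have "(\<Sum>v\<in>N. - u v * (v \<bullet> w)) = 0"
    using arg_cong[OF x0, of "\<lambda>x. x \<bullet> w"] by (simp add: x2 inner_sum_left)
  then have "\<forall>v\<in>N. - u v * (v \<bullet> w) = 0"
    using fin(2) pos by (subst (asm) sum_nonneg_eq_0_iff) (auto simp: N_def less_imp_le mult_nonpos_nonneg)
  then have "N = {}" using pos by (force simp: N_def)
  with \<open>P = {}\<close> have "u v = 0" if "v \<in> \<Delta>" for v
    using that by (force simp: P_def N_def not_less intro: antisym)
  then show False using u(1) by blast
qed

locale reflection_arrangement = root_arrangement +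
  assumes reflect: "\<alpha> \<in> \<Phi> \<Longrightarrow> \<beta> \<in> \<Phi> \<Longrightarrow> \<beta> - (2 * (\<beta> \<bullet> \<alpha>) / (\<alpha> \<bullet> \<alpha>)) *\<^sub>R \<alpha> \<in> \<Phi>"
    and cartan: "\<alpha> \<in> \<Phi> \<Longrightarrow> \<beta> \<in> \<Phi> \<Longrightarrow> 2 * (\<beta> \<bullet> \<alpha>) / (\<alpha> \<bullet> \<alpha>) \<in> \<int>"
    and zero_notin: "0 \<notin> \<Phi>"
    and reduced: "\<alpha> \<in> \<Phi> \<Longrightarrow> c *\<^sub>R \<alpha> \<in> \<Phi> \<Longrightarrow> c = 1 \<or> c = -1"
begin

text \<open>Tilting \<open>w\<close> to a generic \<open>w'\<close> defines positive roots that are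
  nonnegative at \<open>w\<close>. A smallest generating set of their cone is obtuse because of the
  reflections, hence a basis; integrality of coordinates follows by descent.\<close>

lemma ex_simple:
  obtains \<Delta> where "simple \<Delta>" "finite \<Delta>" "\<And>\<alpha>. \<alpha> \<in> \<Delta> \<Longrightarrow> 0 \<le> \<alpha> \<bullet> w"
    "\<And>q. q \<in> lattice \<Longrightarrow> \<exists>c::'a \<Rightarrow> int. q = (\<Sum>\<alpha>\<in>\<Delta>. of_int (c \<alpha>) *\<^sub>R \<alpha>)"
proof -
  obtain u where u: "\<forall>\<gamma>\<in>\<Phi>. \<gamma> \<bullet> u \<noteq> 0"
    using ex_generic_vector[OF finite_roots zero_notin] by blast
  obtain \<epsilon> where e: "\<epsilon> > 0" "\<And>\<gamma>. \<gamma> \<in> \<Phi> \<Longrightarrow> 0 < \<gamma> \<bullet> w \<Longrightarrow> 0 < \<gamma> \<bullet> (w + \<epsilon> *\<^sub>R u)"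
    using finite_positive_stable[OF finite_roots, of w u] by blast
  define w' where "w' = w + \<epsilon> *\<^sub>R u"
  have w'_ne: "\<gamma> \<bullet> w' \<noteq> 0" if g: "\<gamma> \<in> \<Phi>" for \<gamma>
  proof (cases "\<gamma> \<bullet> w = 0")
    case True
    then show ?thesis using u g e(1) by (simp add: w'_def inner_add_right)
  next
    case False
    then have "0 < \<gamma> \<bullet> w \<or> 0 < (- \<gamma>) \<bullet> w" by auto
    then have "0 < \<gamma> \<bullet> w' \<or> 0 < (- \<gamma>) \<bullet> w'"
      using e(2)[OF g] e(2)[OF uminus_roots[OF g]] unfolding w'_def by blast
    then show ?thesis by auto
  qed
  define pos where "pos = {\<alpha>\<in>\<Phi>. 0 < \<alpha> \<bullet> w'}"
  have pos_cases: "\<gamma> \<in> pos \<or> - \<gamma> \<in> pos" if "\<gamma> \<in> \<Phi>" for \<gamma>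
    using w'_ne[OF that] that uminus_roots by (auto simp: pos_def)
  have w_nonneg: "0 \<le> \<alpha> \<bullet> w" if "\<alpha> \<in> pos" for \<alpha>
    using e(2)[of "- \<alpha>"] that uminus_roots unfolding pos_def w'_def by (force simp: not_le)
  obtain \<Delta> where D: "\<Delta> \<subseteq> pos" "pos \<subseteq> convex_cone hull \<Delta>"
    and D_min: "\<And>\<Delta>'. \<Delta>' \<subseteq> pos \<Longrightarrow> pos \<subseteq> convex_cone hull \<Delta>' \<Longrightarrow> card \<Delta> \<le> card \<Delta>'"
    using ex_has_least_nat[of "\<lambda>\<Delta>. \<Delta> \<subseteq> pos \<and> pos \<subseteq> convex_cone hull \<Delta>" pos card]
      hull_subset[of pos convex_cone] by auto
  have fin: "finite \<Delta>" using D(1) finite_roots finite_subset[of \<Delta> \<Phi>] by (auto simp: pos_def)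
  have Dpos: "0 < \<alpha> \<bullet> w'" "\<alpha> \<in> \<Phi>" if "\<alpha> \<in> \<Delta>" for \<alpha> using that D(1) by (auto simp: pos_def)
  have irred: "\<beta> \<notin> convex_cone hull (\<Delta> - {\<beta>})" if b: "\<beta> \<in> \<Delta>" for \<beta>
  proof
    assume "\<beta> \<in> convex_cone hull (\<Delta> - {\<beta>})"
    then have "x \<in> convex_cone hull (\<Delta> - {\<beta>})" if "x \<in> \<Delta>" for x
      using that by (cases "x = \<beta>") (auto intro: hull_inc)
    then have "\<Delta> \<subseteq> convex_cone hull (\<Delta> - {\<beta>})" ..
    then have "convex_cone hull \<Delta> \<subseteq> convex_cone hull (\<Delta> - {\<beta>})"
      by (rule hull_minimal) (rule convex_cone_convex_cone_hull)
    then have "card \<Delta> \<le> card (\<Delta> - {\<beta>})" using D by (intro D_min) auto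
    then show False using b fin by (metis card_Diff1_less not_le)
  qed
  \<comment> \<open>Solving the equation for \<beta> would make this generator redundant; positivity
    at \<open>w'\<close> ensures that its coefficient \<open>t - d \<beta>\<close> is
    positive.\<close>
  have indec: False
    if *: "\<beta> \<in> \<Delta>" "\<alpha> \<in> \<Delta>" "\<alpha> \<noteq> \<beta>" "\<gamma> \<in> pos" "0 < c" "t *\<^sub>R \<beta> = \<gamma> + c *\<^sub>R \<alpha>" for \<alpha> \<beta> \<gamma> c t
  proof -
    obtain d where d: "\<gamma> = (\<Sum>\<delta>\<in>\<Delta>. d \<delta> *\<^sub>R \<delta>)" "\<forall>\<delta>\<in>\<Delta>. 0 \<le> d \<delta>"
      using D(2) *(4) convex_cone_hull_finite[OF fin] by auto
    define v where "v = (\<Sum>\<delta>\<in>\<Delta> - {\<beta>}. d \<delta> *\<^sub>R \<delta>) + c *\<^sub>R \<alpha>"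
    have v_in: "v \<in> convex_cone hull (\<Delta> - {\<beta>})"
      unfolding v_def using * d(2)
      by (intro convex_cone_hull_add convex_cone_hull_sum convex_cone_hull_mul) (auto intro: hull_inc)
    have "0 \<le> (\<Sum>\<delta>\<in>\<Delta> - {\<beta>}. d \<delta> * (\<delta> \<bullet> w'))"
      using d(2) Dpos by (intro sum_nonneg mult_nonneg_nonneg) (auto simp: less_imp_le)
    then have v_pos: "0 < v \<bullet> w'"
      using * Dpos by (simp add: v_def inner_add_left inner_sum_left add_nonneg_pos)
    have "\<gamma> = d \<beta> *\<^sub>R \<beta> + (\<Sum>\<delta>\<in>\<Delta> - {\<beta>}. d \<delta> *\<^sub>R \<delta>)"
      using fin *(1) by (simp add: d(1) sum.remove)
    then have eq: "(t - d \<beta>) *\<^sub>R \<beta> = v" using *(6) by (simp add: v_def scaleR_diff_left)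
    then have "0 < (t - d \<beta>) * (\<beta> \<bullet> w')" using v_pos by (metis inner_scaleR_left)
    then have "0 < t - d \<beta>" using Dpos[OF *(1)] by (simp add: zero_less_mult_iff)
    moreover from this have "\<beta> = (1 / (t - d \<beta>)) *\<^sub>R v" by (simp flip: eq)
    ultimately have "\<beta> \<in> convex_cone hull (\<Delta> - {\<beta>})"
      using v_in convex_cone_hull_mul[of v "\<Delta> - {\<beta>}" "1 / (t - d \<beta>)"] by simp
    then show False using irred *(1) by blast
  qed
  have obtuse: "\<alpha> \<bullet> \<beta> \<le> 0" if ab: "\<alpha> \<in> \<Delta>" "\<beta> \<in> \<Delta>" "\<alpha> \<noteq> \<beta>" for \<alpha> \<beta>
  proof (rule ccontr)
    assume acute: "\<not> \<alpha> \<bullet> \<beta> \<le> 0"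
    define c where "c = 2 * (\<beta> \<bullet> \<alpha>) / (\<alpha> \<bullet> \<alpha>)"
    have "\<alpha> \<noteq> 0" using ab Dpos zero_notin by auto
    then have c: "0 < c" using acute by (simp add: c_def inner_commute)
    define \<gamma> where "\<gamma> = \<beta> - c *\<^sub>R \<alpha>"
    have "\<gamma> \<in> \<Phi>" unfolding \<gamma>_def c_def using ab Dpos by (intro reflect)
    \<comment> \<open>One of \<open>\<gamma>\<close> and \<open>- \<gamma>\<close> is positive: the
      first case decomposes \<beta>, the second \<open>c *\<^sub>R \<alpha>\<close>.\<close>
    then consider "\<gamma> \<in> pos" | "- \<gamma> \<in> pos" using pos_cases by blast
    then show False
    proof cases
      case 1
      show False by (rule indec[of \<beta> \<alpha> \<gamma> c 1]) (use 1 ab c in \<open>auto simp: \<gamma>_def\<close>)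
    next
      case 2
      show False by (rule indec[of \<alpha> \<beta> "- \<gamma>" 1 c]) (use 2 ab in \<open>auto simp: \<gamma>_def\<close>)
    qed
  qed
  have ind: "independent \<Delta>" by (rule obtuse_independent[OF fin Dpos(1) obtuse])
  have hull_roots: "\<alpha> \<in> convex_cone hull \<Delta> \<or> - \<alpha> \<in> convex_cone hull \<Delta>" if "\<alpha> \<in> \<Phi>" for \<alpha>
    using pos_cases[OF that] D(2) by blast
  have "convex_cone hull \<Delta> \<subseteq> span \<Delta>"
    by (rule hull_minimal) (auto intro: span_base convex_cone_span)
  then have "\<Phi> \<subseteq> span \<Delta>" using hull_roots span_neg[of _ \<Delta>] by fastforce
  then have sp: "span \<Delta> = UNIV" using span_roots by (metis span_minimal subspace_span top.extremum_uniqueI)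
  have simple: "simple \<Delta>" unfolding simple_def using ind sp hull_roots Dpos by blast
  obtain \<omega> where \<omega>: "\<And>q. q = (\<Sum>\<alpha>\<in>\<Delta>. (q \<bullet> \<omega> \<alpha>) *\<^sub>R \<alpha>)"
    "\<And>\<alpha> \<beta>. \<alpha> \<in> \<Delta> \<Longrightarrow> \<beta> \<in> \<Delta> \<Longrightarrow> \<beta> \<bullet> \<omega> \<alpha> = (if \<beta> = \<alpha> then 1 else 0)"
    by (rule dual_basis[OF ind sp fin]) (rule that)
  have cone_nonneg: "0 \<le> d \<bullet> \<omega> \<alpha>" if "d \<in> pos" "\<alpha> \<in> \<Delta>" for d \<alpha>
  proof -
    have "d \<in> convex_cone hull \<Delta>" using that D(2) by blast
    then have "d \<bullet> (- \<omega> \<alpha>) \<le> 0"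
      by (rule convex_cone_hull_inner_le) (simp add: \<omega>(2)[OF that(2)])
    then show ?thesis by simp
  qed
  \<comment> \<open>Descent on the value at \<open>w'\<close>: a positive root outside \<Delta> has
    positive product with some \<delta> in \<Delta>, and reflecting in \<delta> subtracts an
    integral multiple of \<delta>.\<close>
  have pos_int: "\<beta> \<bullet> \<omega> \<alpha> \<in> \<int>" if "\<beta> \<in> pos" "\<alpha> \<in> \<Delta>" for \<alpha> \<beta>
    using that
  proof (induction "card {\<gamma>\<in>pos. \<gamma> \<bullet> w' < \<beta> \<bullet> w'}" arbitrary: \<beta> rule: less_induct)
    case less
    show ?case
    proof (cases "\<beta> \<in> \<Delta>")
      case True
      then show ?thesis using \<omega>(2)[OF less.prems(2) True] by simp
    next
      case False
      have b: "\<beta> \<in> \<Phi>" "\<beta> \<noteq> 0" using less.prems by (auto simp: pos_def)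
      have "\<exists>\<delta>\<in>\<Delta>. 0 < \<delta> \<bullet> \<beta>"
      proof (rule ccontr)
        assume "\<not> ?thesis"
        then have "(\<Sum>\<delta>\<in>\<Delta>. (\<beta> \<bullet> \<omega> \<delta>) * (\<delta> \<bullet> \<beta>)) \<le> 0"
          using cone_nonneg[OF less.prems(1)] by (intro sum_nonpos mult_nonneg_nonpos) (auto simp: not_less)
        moreover have "\<beta> \<bullet> \<beta> = (\<Sum>\<delta>\<in>\<Delta>. (\<beta> \<bullet> \<omega> \<delta>) * (\<delta> \<bullet> \<beta>))"
          by (subst (1) \<omega>(1)[of \<beta>]) (simp add: inner_sum_left)
        ultimately show False using b(2) by (metis inner_gt_zero_iff not_le)
      qed
      then obtain \<delta> where d: "\<delta> \<in> \<Delta>" "0 < \<delta> \<bullet> \<beta>" by blast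
      define n where "n = 2 * (\<beta> \<bullet> \<delta>) / (\<delta> \<bullet> \<delta>)"
      have "\<delta> \<noteq> 0" using Dpos[OF d(1)] zero_notin by auto
      then have n: "0 < n" "n \<in> \<int>" unfolding n_def
        using d Dpos[OF d(1)] b cartan[of \<delta> \<beta>] by (auto simp: inner_commute)
      define \<gamma> where "\<gamma> = \<beta> - n *\<^sub>R \<delta>"
      have g: "\<gamma> \<in> \<Phi>" unfolding \<gamma>_def n_def using d Dpos b by (intro reflect) auto
      \<comment> \<open>\<beta> and \<gamma> differ only in the coordinate of \<delta>. If \<gamma>
        were negative, all other coordinates would vanish, and reducedness would make \<beta> equal
        to \<delta>.\<close>
      have "\<gamma> \<in> pos"
      proof (rule ccontr)
        assume "\<gamma> \<notin> pos"
        then have neg: "- \<gamma> \<in> pos" using pos_cases[OF g] by blast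
        have "\<beta> \<bullet> \<omega> \<eta> = 0" if "\<eta> \<in> \<Delta>" "\<eta> \<noteq> \<delta>" for \<eta>
          using cone_nonneg[OF neg that(1)] cone_nonneg[OF less.prems(1) that(1)] \<omega>(2)[OF that(1) d(1)] that
          by (simp add: \<gamma>_def inner_diff_left)
        then have "(\<Sum>\<eta>\<in>\<Delta>. (\<beta> \<bullet> \<omega> \<eta>) *\<^sub>R \<eta>) = (\<Sum>\<eta>\<in>{\<delta>}. (\<beta> \<bullet> \<omega> \<eta>) *\<^sub>R \<eta>)"
          by (intro sum.mono_neutral_right) (use fin d in auto)
        then have eq: "\<beta> = (\<beta> \<bullet> \<omega> \<delta>) *\<^sub>R \<delta>" using \<omega>(1)[of \<beta>] by simp
        then have "\<beta> \<bullet> \<omega> \<delta> = 1 \<or> \<beta> \<bullet> \<omega> \<delta> = -1"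
          using reduced[of \<delta> "\<beta> \<bullet> \<omega> \<delta>"] Dpos[OF d(1)] b by simp
        then have "\<beta> \<bullet> \<omega> \<delta> = 1" using cone_nonneg[OF less.prems(1) d(1)] by auto
        then have "\<beta> = \<delta>" using eq by simp
        then show False using False d(1) by simp
      qed
      have lt: "\<gamma> \<bullet> w' < \<beta> \<bullet> w'" using n(1) Dpos[OF d(1)] by (simp add: \<gamma>_def inner_diff_left)
      have "card {\<eta>\<in>pos. \<eta> \<bullet> w' < \<gamma> \<bullet> w'} < card {\<eta>\<in>pos. \<eta> \<bullet> w' < \<beta> \<bullet> w'}"
      proof (rule psubset_card_mono)
        show "finite {\<eta>\<in>pos. \<eta> \<bullet> w' < \<beta> \<bullet> w'}" using finite_roots by (simp add: pos_def)
        show "{\<eta>\<in>pos. \<eta> \<bullet> w' < \<gamma> \<bullet> w'} \<subset> {\<eta>\<in>pos. \<eta> \<bullet> w' < \<beta> \<bullet> w'}"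
          using lt \<open>\<gamma> \<in> pos\<close> by auto
      qed
      then have "\<gamma> \<bullet> \<omega> \<alpha> \<in> \<int>" using less.hyps \<open>\<gamma> \<in> pos\<close> less.prems(2) by blast
      moreover have "\<beta> \<bullet> \<omega> \<alpha> = \<gamma> \<bullet> \<omega> \<alpha> + n * (\<delta> \<bullet> \<omega> \<alpha>)" by (simp add: \<gamma>_def inner_diff_left)
      ultimately show ?thesis using n(2) \<omega>(2)[OF less.prems(2) d(1)] by auto
    qed
  qed
  have root_int: "\<exists>k::int. \<beta> \<bullet> \<omega> \<alpha> = 1 * of_int k" if b: "\<beta> \<in> \<Phi>" and a: "\<alpha> \<in> \<Delta>" for \<alpha> \<beta>
  proof -
    have "\<beta> \<bullet> \<omega> \<alpha> \<in> \<int>"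
      using pos_cases[OF b]
    proof
      assume "- \<beta> \<in> pos"
      from pos_int[OF this a] have "- (\<beta> \<bullet> \<omega> \<alpha>) \<in> \<int>" by simp
      then show ?thesis by (simp only: minus_in_Ints_iff)
    qed (rule pos_int[OF _ a])
    then show ?thesis by (auto elim: Ints_cases)
  qed
  have "\<exists>c::'a \<Rightarrow> int. q = (\<Sum>\<alpha>\<in>\<Delta>. of_int (c \<alpha>) *\<^sub>R \<alpha>)" if q: "q \<in> lattice" for q
  proof -
    have "\<forall>\<alpha>\<in>\<Delta>. \<exists>k::int. q \<bullet> \<omega> \<alpha> = of_int k"
      using lattice_inner_multiple[OF q, of _ 1] root_int by simp
    then obtain c :: "'a \<Rightarrow> int" where "\<forall>\<alpha>\<in>\<Delta>. q \<bullet> \<omega> \<alpha> = of_int (c \<alpha>)" by metis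
    then have "(\<Sum>\<alpha>\<in>\<Delta>. (q \<bullet> \<omega> \<alpha>) *\<^sub>R \<alpha>) = (\<Sum>\<alpha>\<in>\<Delta>. of_int (c \<alpha>) *\<^sub>R \<alpha>)" by simp
    then show ?thesis using \<omega>(1)[of q] by metis
  qed
  then show thesis using that simple fin w_nonneg D(1) by blast
qed

text \<open>Take a simple system that is nonnegative at \<open>x\<close>, hence at \<open>z\<close>,
  and a common upper bound \<open>r\<close> of \<open>p\<close> and \<open>q\<close>. As
  \<open>p\<close> maximizes \<open>x\<close>, \<open>r - p\<close> involves only simple roots
  vanishing at \<open>x\<close>; these vanish at \<open>z\<close>, so
  \<open>q \<bullet> z \<le> r \<bullet> z = p \<bullet> z\<close>.\<close>

lemma maximality_cell_closed:
  assumes B: "maximality B" and p: "p \<in> B"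
  shows "cell_closed (normal_cone_at B p)"
  unfolding cell_closed_def
proof (intro ballI subsetI)
  fix x z assume x: "x \<in> normal_cone_at B p" and z: "z \<in> cell x"
  obtain \<Delta> where \<Delta>: "simple \<Delta>" "finite \<Delta>" "\<And>\<alpha>. \<alpha> \<in> \<Delta> \<Longrightarrow> 0 \<le> \<alpha> \<bullet> x"
    by (rule ex_simple[of x]) (rule that)
  have \<Delta>z: "0 \<le> \<alpha> \<bullet> z" if "\<alpha> \<in> \<Delta>" for \<alpha>
    using cell_nonneg[OF z _ \<Delta>(3)[OF that]] \<Delta>(1) that by (auto simp: simple_def)
  have "q \<bullet> z \<le> p \<bullet> z" if q: "q \<in> B" for q
  proof -
    obtain r where r: "r \<in> B" "r - p \<in> convex_cone hull \<Delta>" "r - q \<in> convex_cone hull \<Delta>"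
      using B p q \<Delta>(1) unfolding maximality_def by blast
    obtain c where c: "r - p = (\<Sum>\<alpha>\<in>\<Delta>. c \<alpha> *\<^sub>R \<alpha>)" "\<forall>\<alpha>\<in>\<Delta>. 0 \<le> c \<alpha>"
      using r(2) convex_cone_hull_finite[OF \<Delta>(2)] by auto
    have inner: "(r - p) \<bullet> y = (\<Sum>\<alpha>\<in>\<Delta>. c \<alpha> * (\<alpha> \<bullet> y))" for y
      by (simp add: c(1) inner_sum_left)
    have nn: "\<forall>\<alpha>\<in>\<Delta>. 0 \<le> c \<alpha> * (\<alpha> \<bullet> x)" using c(2) \<Delta>(3) by simp
    have "(r - p) \<bullet> x \<le> 0" using x r(1) by (simp add: normal_cone_at_def inner_diff_left)
    then have "(\<Sum>\<alpha>\<in>\<Delta>. c \<alpha> * (\<alpha> \<bullet> x)) = 0"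
      using nn by (simp add: inner antisym sum_nonneg)
    then have "\<forall>\<alpha>\<in>\<Delta>. c \<alpha> * (\<alpha> \<bullet> x) = 0"
      using sum_nonneg_eq_0_iff[OF \<Delta>(2), of "\<lambda>\<alpha>. c \<alpha> * (\<alpha> \<bullet> x)"] nn by blast
    then have "c \<alpha> * (\<alpha> \<bullet> z) = 0" if "\<alpha> \<in> \<Delta>" for \<alpha>
      using cell_zero[OF z] that \<Delta>(1) by (auto simp: simple_def)
    then have "(r - p) \<bullet> z = 0" unfolding inner by (intro sum.neutral ballI)
    moreover have "(r - q) \<bullet> (- z) \<le> 0"
      by (rule convex_cone_hull_inner_le[OF r(3)]) (simp add: \<Delta>z)
    ultimately show ?thesis by (simp add: inner_diff_left)
  qed
  then show "z \<in> normal_cone_at B p" by (simp add: normal_cone_at_def)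
qed

text \<open>Integral coordinates make the values at \<open>w\<close> of lattice points in the simple
  cone discrete near 0. A point of the face within that gap of the supremum cannot be improved by an
  upper bound, so it is a maximizer of \<open>w\<close> over all of \<open>B\<close>.\<close>

lemma maximality_regular:
  assumes B: "maximality B" and BL: "B \<subseteq> lattice"
  shows "regular B"
  unfolding regular_def
proof (intro allI impI)
  fix x y assume ne: "exposed B x \<noteq> {}" and bd: "y \<in> bounded_dirs (exposed B x)"
  define B' where "B' = exposed B x"
  obtain \<epsilon> where e: "\<epsilon> > 0" "\<And>\<gamma>. \<gamma> \<in> \<Phi> \<Longrightarrow> 0 < \<gamma> \<bullet> x \<Longrightarrow> 0 < \<gamma> \<bullet> (x + \<epsilon> *\<^sub>R y)"
    using finite_positive_stable[OF finite_roots, of x y] by blast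
  define w where "w = x + \<epsilon> *\<^sub>R y"
  \<comment> \<open>Hence a simple system that is nonnegative at \<open>w\<close> is nonnegative at
    \<open>x\<close> too, and upper bounds of points of the face stay in the face.\<close>
  have cell: "x \<in> cell w" using e(2) by (force simp: cell_def w_def not_le)
  obtain \<Delta> where \<Delta>: "simple \<Delta>" "finite \<Delta>" "\<And>\<alpha>. \<alpha> \<in> \<Delta> \<Longrightarrow> 0 \<le> \<alpha> \<bullet> w"
    and int: "\<And>q. q \<in> lattice \<Longrightarrow> \<exists>c::'a \<Rightarrow> int. q = (\<Sum>\<alpha>\<in>\<Delta>. of_int (c \<alpha>) *\<^sub>R \<alpha>)"
    by (rule ex_simple[of w]) (rule that)
  have ind: "independent \<Delta>" and sp: "span \<Delta> = UNIV" using \<Delta>(1) by (auto simp: simple_def)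
  have \<Delta>x: "0 \<le> \<alpha> \<bullet> x" if "\<alpha> \<in> \<Delta>" for \<alpha>
    using cell_nonneg[OF cell _ \<Delta>(3)[OF that]] \<Delta>(1) that by (auto simp: simple_def)
  have cone_x: "0 \<le> d \<bullet> x" "0 \<le> d \<bullet> w" if "d \<in> convex_cone hull \<Delta>" for d
    using convex_cone_hull_inner_le[OF that, of "- x"] convex_cone_hull_inner_le[OF that, of "- w"] \<Delta>x \<Delta>(3)
    by auto
  have up: "r \<in> B'" if "p \<in> B'" "r \<in> B" "r - p \<in> convex_cone hull \<Delta>" for p r
  proof -
    have "p \<bullet> x \<le> r \<bullet> x" using cone_x(1)[OF that(3)] by (simp add: inner_diff_left)
    then show ?thesis using that(1,2) unfolding B'_def exposed_def by (auto intro: order_trans)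
  qed
  define \<delta> where "\<delta> = Min (insert 1 ((\<lambda>\<alpha>. \<alpha> \<bullet> w) ` {\<alpha>\<in>\<Delta>. 0 < \<alpha> \<bullet> w}))"
  have fin: "finite (insert 1 ((\<lambda>\<alpha>. \<alpha> \<bullet> w) ` {\<alpha>\<in>\<Delta>. 0 < \<alpha> \<bullet> w}))" using \<Delta>(2) by simp
  have \<delta>: "0 < \<delta>" using fin by (auto simp: \<delta>_def Min_gr_iff)
  \<comment> \<open>A lattice vector in the cone has natural coefficients, so a nonzero value
    contains at least one whole simple root that is positive at \<open>w\<close>.\<close>
  have gap: "d \<bullet> w = 0" if d: "d \<in> lattice" "d \<in> convex_cone hull \<Delta>" "d \<bullet> w < \<delta>" for d
  proof (rule ccontr)
    assume nz: "d \<bullet> w \<noteq> 0"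
    obtain k :: "'a \<Rightarrow> int" where k: "d = (\<Sum>\<alpha>\<in>\<Delta>. of_int (k \<alpha>) *\<^sub>R \<alpha>)" using int[OF d(1)] by blast
    obtain c where c: "d = (\<Sum>\<alpha>\<in>\<Delta>. c \<alpha> *\<^sub>R \<alpha>)" "\<forall>\<alpha>\<in>\<Delta>. 0 \<le> c \<alpha>"
      using d(2) convex_cone_hull_finite[OF \<Delta>(2)] by auto
    have "(\<Sum>\<alpha>\<in>\<Delta>. (c \<alpha> - of_int (k \<alpha>)) *\<^sub>R \<alpha>) = 0"
      using k c(1) by (simp add: scaleR_diff_left sum_subtractf)
    then have ck: "c \<alpha> = of_int (k \<alpha>)" if "\<alpha> \<in> \<Delta>" for \<alpha>
      using ind independentD[OF ind \<Delta>(2) order_refl _ that, of "\<lambda>\<alpha>. c \<alpha> - of_int (k \<alpha>)"] by simp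
    have dw: "d \<bullet> w = (\<Sum>\<alpha>\<in>\<Delta>. c \<alpha> * (\<alpha> \<bullet> w))" by (simp add: c(1) inner_sum_left)
    then obtain \<alpha> where a: "\<alpha> \<in> \<Delta>" "c \<alpha> * (\<alpha> \<bullet> w) \<noteq> 0" using nz by (metis (no_types, lifting) sum.neutral)
    then have "0 < \<alpha> \<bullet> w" "0 < c \<alpha>" using \<Delta>(3)[OF a(1)] c(2) by (auto simp: less_le)
    then have "1 \<le> c \<alpha>" "\<delta> \<le> \<alpha> \<bullet> w" using ck[OF a(1)] fin a(1) by (auto simp: \<delta>_def intro!: Min_le)
    then have "1 * \<delta> \<le> c \<alpha> * (\<alpha> \<bullet> w)" using \<delta> by (intro mult_mono) auto
    also have "\<dots> \<le> d \<bullet> w"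
      unfolding dw using a(1) c(2) \<Delta>(2,3) by (intro member_le_sum) auto
    finally show False using d(3) by simp
  qed
  obtain M where M: "\<And>q. q \<in> B' \<Longrightarrow> q \<bullet> y \<le> M"
    using bd by (auto simp: bounded_dirs_def bdd_above_def B'_def)
  obtain p\<^sub>0 where p\<^sub>0: "p\<^sub>0 \<in> B'" using ne by (auto simp: B'_def)
  define s where "s = Sup ((\<lambda>q. q \<bullet> w) ` B')"
  have "q \<bullet> w \<le> p\<^sub>0 \<bullet> x + \<epsilon> * M" if q: "q \<in> B'" for q
    using M[OF q] e(1) exposed_eq[of p\<^sub>0 B x q] p\<^sub>0 q
    by (simp add: w_def inner_add_right B'_def)
  then have bdd: "bdd_above ((\<lambda>q. q \<bullet> w) ` B')" by (auto simp: bdd_above_def)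
  have "\<exists>v\<in>(\<lambda>q. q \<bullet> w) ` B'. s - \<delta> < v"
    unfolding s_def using p\<^sub>0 \<delta> bdd by (subst less_cSup_iff[symmetric]) (auto simp: s_def)
  then obtain p where p: "p \<in> B'" "s - \<delta> < p \<bullet> w" by blast
  have pB: "p \<in> B" using p(1) exposed_subset by (auto simp: B'_def)
  have "p \<in> exposed B w"
  proof (rule exposedI[OF pB])
    fix q assume q: "q \<in> B"
    obtain r where r: "r \<in> B" "r - p \<in> convex_cone hull \<Delta>" "r - q \<in> convex_cone hull \<Delta>"
      using B pB q \<Delta>(1) unfolding maximality_def by blast
    have "r \<bullet> w \<le> s" unfolding s_def using up[OF p(1) r(1,2)] bdd by (intro cSup_upper) auto
    then have "(r - p) \<bullet> w = 0"
      using p(2) r pB BL by (intro gap lattice_diff) (auto simp: inner_diff_left)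
    moreover have "0 \<le> (r - q) \<bullet> w" using cone_x(2)[OF r(3)] .
    ultimately show "q \<bullet> w \<le> p \<bullet> w" by (simp add: inner_diff_left)
  qed
  then show "\<exists>p\<in>exposed B x. \<exists>\<epsilon>>0. p \<in> exposed B (x + \<epsilon> *\<^sub>R y)"
    using p(1) e(1) by (auto simp: B'_def w_def)
qed

lemma maximality_imp_M_set:
  assumes "B \<noteq> {}" "B = convex hull B \<inter> lattice" "maximality B"
  shows "M_set B"
  unfolding M_set_def
proof (rule conjI[OF M_polyhedron_regular assms(2)])
  show "B \<noteq> {}" by (rule assms(1))
  show "regular B" by (rule maximality_regular[OF assms(3)]) (use assms(2) in blast)
qed (rule maximality_cell_closed[OF assms(3)])

end

section \<open>Components in coordinates\<close>

definition sign_vector :: "nat \<Rightarrow> (nat \<Rightarrow> real) \<Rightarrow> bool" where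
  "sign_vector n z \<longleftrightarrow> (\<forall>k<n. z k \<in> {-1, 0, 1})"

lemma sign_vectorD: "sign_vector n z \<Longrightarrow> k < n \<Longrightarrow> z k = -1 \<or> z k = 0 \<or> z k = 1"
  by (auto simp: sign_vector_def)

text \<open>Applied to all coordinates, such a map keeps a vector in its closed cell for each
  classical type. Two instances are used: the sign and the shrinking map below.\<close>

definition odd_mono :: "(real \<Rightarrow> real) \<Rightarrow> bool" where
  "odd_mono \<phi> \<longleftrightarrow> mono \<phi> \<and> (\<forall>s. \<phi> (- s) = - \<phi> s)"

lemma odd_mono_sgn: "odd_mono sgn"
  by (auto simp: odd_mono_def sgn_minus intro!: monoI) (auto simp: sgn_if)

text \<open>Soft thresholding: what remains of \<open>s\<close> after its absolute value is reduced
  by \<open>c\<close>, but not below 0.\<close>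

lemma odd_mono_shrink: "0 \<le> c \<Longrightarrow> odd_mono (\<lambda>s. max (s - c) 0 + min (s + c) 0)"
  by (auto simp: odd_mono_def max_def min_def intro!: monoI)

text \<open>A common frame for the classical types, in which \<open>E k\<close> represents the
  \<open>k\<close>-th coordinate on \<Psi>. The last assumption reflects that the sign of a
  classical root at a vector is decided by comparing two signed coordinates, or one with 0.\<close>

locale component = root_arrangement +
  fixes \<Psi> :: "'a set" and E :: "nat \<Rightarrow> 'a" and n :: nat
  assumes component_subset: "\<Psi> \<subseteq> \<Phi>"
    and outside: "\<alpha> \<in> \<Phi> \<Longrightarrow> \<alpha> \<notin> \<Psi> \<Longrightarrow> k < n \<Longrightarrow> \<alpha> \<bullet> E k = 0"
    and spanning: "\<exists>a. \<forall>\<alpha>\<in>\<Psi>. \<alpha> \<bullet> y = \<alpha> \<bullet> (\<Sum>k<n. a k *\<^sub>R E k)"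
    and integral: "\<alpha> \<in> \<Psi> \<Longrightarrow> k < n \<Longrightarrow> \<alpha> \<bullet> E k \<in> \<int>"
    and odd_mono_root: "odd_mono \<phi> \<Longrightarrow> \<alpha> \<in> \<Psi> \<Longrightarrow> \<alpha> \<bullet> (\<Sum>k<n. a k *\<^sub>R E k) \<le> 0 \<Longrightarrow>
      \<alpha> \<bullet> (\<Sum>k<n. \<phi> (a k) *\<^sub>R E k) \<le> 0"
begin

definition V :: "(nat \<Rightarrow> real) \<Rightarrow> 'a" where
  "V a = (\<Sum>k<n. a k *\<^sub>R E k)"

lemma V_inner: "x \<bullet> V a = (\<Sum>k<n. a k * (x \<bullet> E k))"
  by (simp add: V_def inner_sum_right)

lemma V_cong: "(\<And>k. k < n \<Longrightarrow> a k = b k) \<Longrightarrow> V a = V b"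
  unfolding V_def by (rule sum.cong) auto

lemma V_add: "V (\<lambda>k. a k + b k) = V a + V b"
  by (simp add: V_def scaleR_add_left sum.distrib)

lemma V_scale: "V (\<lambda>k. c * a k) = c *\<^sub>R V a"
  by (simp add: V_def scaleR_sum_right)

lemma outside_V: "\<alpha> \<in> \<Phi> \<Longrightarrow> \<alpha> \<notin> \<Psi> \<Longrightarrow> \<alpha> \<bullet> V a = 0"
  by (simp add: V_inner outside)

lemma V_in_cellI: "(\<And>\<alpha>. \<alpha> \<in> \<Psi> \<Longrightarrow> \<alpha> \<bullet> V a \<le> 0 \<Longrightarrow> \<alpha> \<bullet> V b \<le> 0) \<Longrightarrow> V b \<in> cell (V a)"
  unfolding cell_def using outside_V by force

lemma odd_mono_cell: "odd_mono \<phi> \<Longrightarrow> V (\<lambda>k. \<phi> (a k)) \<in> cell (V a)"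
  by (rule V_in_cellI) (simp add: V_def odd_mono_root)

text \<open>Peel off layers: with \<open>c\<close> the least nonzero absolute value,
  \<open>a\<close> is \<open>c\<close> times its sign vector plus the part shrunk by
  \<open>c\<close>. Both summands lie in the closed cell of \<open>V a\<close>, and the second has
  smaller support.\<close>

lemma inner_V_nonneg_if_sign_vectors:
  assumes "\<And>z. sign_vector n z \<Longrightarrow> V z \<in> cell (V a) \<Longrightarrow> (pos \<longrightarrow> (\<forall>k<n. 0 \<le> z k)) \<Longrightarrow> 0 \<le> d \<bullet> V z"
    and "pos \<longrightarrow> (\<forall>k<n. 0 \<le> a k)"
  shows "0 \<le> d \<bullet> V a"
  using assms
proof (induction "card {k. k < n \<and> a k \<noteq> 0}" arbitrary: a rule: less_induct)
  case less
  define K where "K = {k. k < n \<and> a k \<noteq> 0}"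
  have finK: "finite K" by (simp add: K_def)
  show ?case
  proof (cases "K = {}")
    case True
    then have "V a = V (\<lambda>_. 0)" by (intro V_cong) (auto simp: K_def)
    then show ?thesis by (simp add: V_def)
  next
    case False
    define c where "c = Min ((\<lambda>k. \<bar>a k\<bar>) ` K)"
    have "c \<in> (\<lambda>k. \<bar>a k\<bar>) ` K" unfolding c_def using finK False by (intro Min_in) auto
    then obtain k\<^sub>0 where k\<^sub>0: "k\<^sub>0 \<in> K" "c = \<bar>a k\<^sub>0\<bar>" by blast
    have c: "0 < c" using k\<^sub>0 by (auto simp: K_def)
    have c_le: "c \<le> \<bar>a k\<bar>" if "k \<in> K" for k unfolding c_def using finK that by (intro Min_le) auto
    define z where "z k = sgn (a k)" for k
    define b where "b k = max (a k - c) 0 + min (a k + c) 0" for k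
    have z: "sign_vector n z" by (auto simp: sign_vector_def z_def sgn_if)
    have z_cell: "V z \<in> cell (V a)" unfolding z_def by (rule odd_mono_cell) (rule odd_mono_sgn)
    have b_cell: "V b \<in> cell (V a)"
      unfolding b_def using odd_mono_cell[OF odd_mono_shrink, of c a] c by simp
    have ab: "a k = c * z k + b k" if "k < n" for k
      using c_le[of k] c that by (cases "k \<in> K") (auto simp: K_def z_def b_def sgn_if max_def min_def)
    have "V a = c *\<^sub>R V z + V b"
      using V_cong[OF ab] by (simp add: V_add V_scale)
    moreover have "0 \<le> d \<bullet> V z"
      by (rule less.prems(1)[OF z z_cell]) (use less.prems(2) in \<open>auto simp: z_def sgn_if\<close>)
    moreover have "0 \<le> d \<bullet> V b"
    proof (rule less.hyps)
      have "{k. k < n \<and> b k \<noteq> 0} \<subseteq> K - {k\<^sub>0}"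
        using c k\<^sub>0 by (auto simp: K_def b_def max_def min_def split: if_splits)
      then show "card {k. k < n \<and> b k \<noteq> 0} < card {k. k < n \<and> a k \<noteq> 0}"
        unfolding K_def[symmetric] using k\<^sub>0(1) finK by (intro psubset_card_mono) auto
      show "pos \<longrightarrow> (\<forall>k<n. 0 \<le> b k)"
        using less.prems(2) c by (auto simp: b_def max_def min_def)
      show "0 \<le> d \<bullet> V z" if "sign_vector n z" "V z \<in> cell (V b)" "pos \<longrightarrow> (\<forall>k<n. 0 \<le> z k)" for z
        by (rule less.prems(1)[OF that(1) cell_trans[OF that(2) b_cell] that(3)])
    qed
    ultimately show ?thesis using c by (simp add: inner_add_right)
  qed
qed

lemma span_inner_eq:
  assumes "\<epsilon> \<in> span \<Psi>" "\<And>\<alpha>. \<alpha> \<in> \<Psi> \<Longrightarrow> \<alpha> \<bullet> x = \<alpha> \<bullet> y"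
  shows "\<epsilon> \<bullet> x = \<epsilon> \<bullet> y"
proof -
  have "orthogonal (x - y) \<epsilon>"
    by (rule orthogonal_to_span[OF assms(1)])
      (use assms(2) in \<open>auto simp: orthogonal_def inner_diff_left inner_diff_right inner_commute\<close>)
  then show ?thesis by (simp add: orthogonal_def inner_diff_left inner_diff_right inner_commute)
qed

lemma sign_vector_root_int: "sign_vector n z \<Longrightarrow> \<alpha> \<in> \<Phi> \<Longrightarrow> \<exists>k::int. \<alpha> \<bullet> V z = 1 * of_int k"
proof -
  assume z: "sign_vector n z" and a: "\<alpha> \<in> \<Phi>"
  have "\<alpha> \<bullet> V z \<in> \<int>"
  proof (cases "\<alpha> \<in> \<Psi>")
    case True
    have "z k \<in> \<int>" if "k < n" for k using sign_vectorD[OF z that] by auto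
    then show ?thesis unfolding V_inner using integral[OF True] by (intro Ints_sum Ints_mult) auto
  qed (simp add: a outside_V)
  then show ?thesis by (auto elim: Ints_cases)
qed

end

section \<open>Testing hull membership on sign vectors\<close>

locale component_at = component +
  fixes B :: "'a set" and p :: 'a
  assumes M_set: "M_set B" and p_in: "p \<in> B"
begin

definition tangent :: "'a \<Rightarrow> bool" where
  "tangent \<alpha> \<longleftrightarrow> (\<forall>x\<in>normal_cone_at B p. \<alpha> \<bullet> x \<le> 0)"

definition steps :: "'a set" where
  "steps = {\<alpha>\<in>\<Phi>. p + \<alpha> \<in> B}"

lemma B_cell: "r \<in> B \<Longrightarrow> x \<in> normal_cone_at B r \<Longrightarrow> y \<in> cell x \<Longrightarrow> y \<in> normal_cone_at B r"
  using M_set_cell_closed[OF M_set] by (auto simp: cell_closed_def)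

text \<open>
  The flag \<open>pos\<close> is for type A, where coordinates matter only up to a common summand, so that sign
  vectors can be taken nonnegative; then a root is at most \<open>1\<close> on them.
\<close>

lemma convex_hull_memI:
  assumes \<epsilon>: "\<epsilon> \<in> span \<Psi>" and shift: "pos \<longrightarrow> (\<forall>a. \<exists>b. (\<forall>k<n. 0 \<le> b k) \<and> V b = V a)"
    and le: "\<And>z r. sign_vector n z \<Longrightarrow> (pos \<longrightarrow> (\<forall>k<n. 0 \<le> z k)) \<Longrightarrow> r \<in> B \<Longrightarrow> V z \<in> normal_cone_at B r \<Longrightarrow>
      \<epsilon> \<bullet> V z \<le> (r - p) \<bullet> V z"
  shows "p + \<epsilon> \<in> convex hull B"
proof -
  obtain S where S: "spherical S" using ex_spherical ..
  have M: "M_polyhedron (convex hull B)" using M_set by (simp add: M_set_def)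
  show ?thesis
  proof (rule M_polyhedron_memI[OF M S])
    fix s p' assume "p' \<in> convex hull B" "s \<in> normal_cone_at (convex hull B) p'"
    then obtain r where r: "r \<in> B" "r \<bullet> s = p' \<bullet> s" "s \<in> normal_cone_at B r"
      using exposed_convex_hull_nonempty by blast
    obtain a where a: "\<forall>\<alpha>\<in>\<Psi>. \<alpha> \<bullet> s = \<alpha> \<bullet> V a" "pos \<longrightarrow> (\<forall>k<n. 0 \<le> a k)"
      using spanning[of s, folded V_def] shift by (cases pos) metis+
    \<comment> \<open>\<open>V a\<close> agrees with \<open>s\<close> on \<Psi> and vanishes on the
      other roots, so both parts of \<open>s\<close> lie in its closed cell. The displacement
      \<epsilon> sees only the part \<open>V a\<close>.\<close>
    have 1: "V a \<in> cell s" "s - V a \<in> cell s"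
      unfolding cell_def using a outside_V by (force simp: inner_diff_right)+
    have "0 \<le> (r - p - \<epsilon>) \<bullet> V a"
    proof (rule inner_V_nonneg_if_sign_vectors[OF _ a(2)])
      fix z assume z: "sign_vector n z" "V z \<in> cell (V a)" "pos \<longrightarrow> (\<forall>k<n. 0 \<le> z k)"
      have "V z \<in> normal_cone_at B r"
        using B_cell[OF r(1,3)] cell_trans[OF z(2) 1(1)] by blast
      then show "0 \<le> (r - p - \<epsilon>) \<bullet> V z" using le[OF z(1,3) r(1)] by (simp add: inner_diff_left)
    qed
    moreover have "s - V a \<in> normal_cone_at B r" by (rule B_cell[OF r(1,3) 1(2)])
    then have "p \<bullet> (s - V a) \<le> r \<bullet> (s - V a)" using p_in by (simp add: normal_cone_at_def)
    moreover have "\<epsilon> \<bullet> s = \<epsilon> \<bullet> V a" by (rule span_inner_eq[OF \<epsilon>]) (use a in blast)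
    ultimately show "(p + \<epsilon>) \<bullet> s \<le> p' \<bullet> s"
      using r(2) by (simp add: inner_diff_left inner_diff_right inner_add_left)
  qed
qed

lemma steps_memI:
  assumes "\<beta> \<in> \<Psi>" "p + \<beta> \<in> convex hull B"
  shows "\<beta> \<in> steps"
proof -
  have b: "\<beta> \<in> \<Phi>" using assms(1) component_subset by blast
  have "p \<in> lattice" using M_set p_in unfolding M_set_def by blast
  then have "p + \<beta> \<in> lattice" using b root_in_lattice lattice_add by blast
  then have "p + \<beta> \<in> B" using M_set assms(2) unfolding M_set_def by blast
  then show ?thesis using b by (simp add: steps_def)
qed

lemma diff_int:
  assumes "sign_vector n z" "r \<in> B"
  shows "\<exists>k::int. (r - p) \<bullet> V z = of_int k"
proof -
  have "r \<in> lattice" "p \<in> lattice" using M_set assms(2) p_in unfolding M_set_def by blast+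
  then show ?thesis
    using lattice_inner_multiple[of "r - p" "V z" 1] lattice_diff sign_vector_root_int[OF assms(1)] by simp
qed

lemma diff_nonneg: "r \<in> B \<Longrightarrow> x \<in> normal_cone_at B r \<Longrightarrow> 0 \<le> (r - p) \<bullet> x"
  using p_in by (simp add: normal_cone_at_def inner_diff_left)

lemma tight_if_diff_zero: "x \<in> normal_cone_at B r \<Longrightarrow> (r - p) \<bullet> x = 0 \<Longrightarrow> x \<in> normal_cone_at B p"
  by (simp add: normal_cone_at_def inner_diff_left)

text \<open>The slack is a nonnegative integer, and slack 0 would make the direction normal at
  \<open>p\<close>.\<close>

lemma diff_ge_one:
  assumes "sign_vector n z" "r \<in> B" "V z \<in> normal_cone_at B r" "V z \<notin> normal_cone_at B p"
  shows "1 \<le> (r - p) \<bullet> V z"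
proof -
  obtain k :: int where k: "(r - p) \<bullet> V z = of_int k" using diff_int[OF assms(1,2)] by blast
  moreover have "(r - p) \<bullet> V z \<noteq> 0" using tight_if_diff_zero assms(3,4) by blast
  ultimately show ?thesis using diff_nonneg[OF assms(2,3)] by simp
qed

lemma convex_hull_memI_le_one:
  assumes \<epsilon>: "\<epsilon> \<in> span \<Psi>" and shift: "pos \<longrightarrow> (\<forall>a. \<exists>b. (\<forall>k<n. 0 \<le> b k) \<and> V b = V a)"
    and tight: "\<And>z. sign_vector n z \<Longrightarrow> V z \<in> normal_cone_at B p \<Longrightarrow> \<epsilon> \<bullet> V z \<le> 0"
    and one: "\<And>z. sign_vector n z \<Longrightarrow> (pos \<longrightarrow> (\<forall>k<n. 0 \<le> z k)) \<Longrightarrow> \<epsilon> \<bullet> V z \<le> 1"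
  shows "p + \<epsilon> \<in> convex hull B"
proof (rule convex_hull_memI[OF \<epsilon> shift])
  fix z r assume z: "sign_vector n z" "pos \<longrightarrow> (\<forall>k<n. 0 \<le> z k)" and r: "r \<in> B" "V z \<in> normal_cone_at B r"
  show "\<epsilon> \<bullet> V z \<le> (r - p) \<bullet> V z"
  proof (cases "V z \<in> normal_cone_at B p")
    case True
    then show ?thesis using tight[OF z(1)] diff_nonneg[OF r] by force
  next
    case False
    then show ?thesis using one[OF z] diff_ge_one[OF z(1) r] by linarith
  qed
qed

end

section \<open>Components of type B, C and D\<close>

definition pair_root :: "(nat \<Rightarrow> 'a::real_vector) \<Rightarrow> nat \<Rightarrow> 'a \<Rightarrow> bool" where
  "pair_root e n \<alpha> \<longleftrightarrow> (\<exists>i j s t. i < n \<and> j < n \<and> i \<noteq> j \<and> s \<in> {1, -1} \<and> t \<in> {1, -1} \<and>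
     \<alpha> = s *\<^sub>R e i + t *\<^sub>R e j)"

definition single_root :: "real \<Rightarrow> (nat \<Rightarrow> 'a::real_vector) \<Rightarrow> nat \<Rightarrow> 'a \<Rightarrow> bool" where
  "single_root m e n \<alpha> \<longleftrightarrow> (\<exists>i s. i < n \<and> s \<in> {1, -1} \<and> \<alpha> = (m * s) *\<^sub>R e i)"

locale signed_component = root_arrangement +
  fixes \<Psi> :: "'a set" and e E :: "nat \<Rightarrow> 'a" and n :: nat
  assumes signed_subset: "\<Psi> \<subseteq> \<Phi>"
    and signed_outside: "\<alpha> \<in> \<Phi> \<Longrightarrow> \<alpha> \<notin> \<Psi> \<Longrightarrow> k < n \<Longrightarrow> \<alpha> \<bullet> E k = 0"
    and dual: "i < n \<Longrightarrow> k < n \<Longrightarrow> e i \<bullet> E k = (if i = k then 1 else 0)"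
    and e_span: "i < n \<Longrightarrow> e i \<in> span \<Psi>"
    and D_roots: "pair_root e n \<alpha> \<Longrightarrow> \<alpha> \<in> \<Psi>"
    and signed_cases: "\<alpha> \<in> \<Psi> \<Longrightarrow> pair_root e n \<alpha> \<or> single_root 1 e n \<alpha> \<or> single_root 2 e n \<alpha>"
begin

lemma e_sum: "i < n \<Longrightarrow> e i \<bullet> (\<Sum>k<n. a k *\<^sub>R E k) = a i"
  by (simp add: inner_sum_right dual if_distrib cong: if_cong)

sublocale component
proof
  show "\<Psi> \<subseteq> \<Phi>" by (rule signed_subset)
  show "\<alpha> \<bullet> E k = 0" if "\<alpha> \<in> \<Phi>" "\<alpha> \<notin> \<Psi>" "k < n" for \<alpha> k by (rule signed_outside[OF that])
  show "\<exists>a. \<forall>\<alpha>\<in>\<Psi>. \<alpha> \<bullet> y = \<alpha> \<bullet> (\<Sum>k<n. a k *\<^sub>R E k)" for y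
  proof (intro exI[of _ "\<lambda>k. e k \<bullet> y"] ballI)
    fix \<alpha> assume "\<alpha> \<in> \<Psi>"
    from signed_cases[OF this] show "\<alpha> \<bullet> y = \<alpha> \<bullet> (\<Sum>k<n. (e k \<bullet> y) *\<^sub>R E k)"
      unfolding pair_root_def single_root_def
      by (elim disjE exE conjE) (simp_all add: inner_add_left e_sum)
  qed
  show "\<alpha> \<bullet> E k \<in> \<int>" if "\<alpha> \<in> \<Psi>" "k < n" for \<alpha> k
    using signed_cases[OF that(1)] that(2)
    by (auto simp: pair_root_def single_root_def inner_add_left inner_diff_left dual)
  show "\<alpha> \<bullet> (\<Sum>k<n. \<phi> (a k) *\<^sub>R E k) \<le> 0"
    if \<phi>: "odd_mono \<phi>" and a: "\<alpha> \<in> \<Psi>" "\<alpha> \<bullet> (\<Sum>k<n. a k *\<^sub>R E k) \<le> 0" for \<phi> \<alpha> a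
  proof -
    have scale: "\<phi> (s * x) = s * \<phi> x" if "s \<in> {1, -1}" for s x
      using \<phi> that by (auto simp: odd_mono_def)
    have mono: "\<phi> x \<le> \<phi> y" if "x \<le> y" for x y
      using \<phi> that by (auto simp: odd_mono_def mono_def)
    have zero: "\<phi> 0 = 0" using \<phi> by (auto simp: odd_mono_def) (metis add.inverse_neutral equal_neg_zero)
    have single: ?thesis if "i < n" "0 < m" "s \<in> {1, -1}" "\<alpha> = (m * s) *\<^sub>R e i" for i m s
    proof -
      have "s * a i \<le> 0" using a(2) that by (simp add: e_sum mult.assoc mult_le_0_iff)
      then have "s * \<phi> (a i) \<le> 0" using mono[of "s * a i" 0] scale[OF that(3)] zero by simp
      then show ?thesis using that by (simp add: e_sum mult.assoc mult_nonneg_nonpos)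
    qed
    from signed_cases[OF a(1)] show ?thesis
      unfolding pair_root_def single_root_def
    proof (elim disjE exE conjE)
      fix i j s t assume *: "i < n" "j < n" "s \<in> {1, -1}" "t \<in> {1, -1::real}" "\<alpha> = s *\<^sub>R e i + t *\<^sub>R e j"
      then have "s * a i \<le> - (t * a j)" using a(2) by (simp add: inner_add_left e_sum)
      then have "\<phi> (s * a i) \<le> \<phi> (- (t * a j))" by (rule mono)
      also have "\<dots> = - \<phi> (t * a j)" using \<phi> by (simp add: odd_mono_def)
      finally show ?thesis using * scale by (simp add: inner_add_left e_sum)
    qed (use single[of _ 1] single[of _ 2] in auto)
  qed
qed

lemma e_V: "i < n \<Longrightarrow> e i \<bullet> V a = a i"
  by (simp add: V_def e_sum)

end

locale signed_component_at = signed_component +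
  fixes B :: "'a set" and p :: 'a
  assumes M_set_at: "M_set B" and p_in_at: "p \<in> B"
begin

sublocale component_at
  by unfold_locales (rule M_set_at p_in_at)+

text \<open>
  If \<open>p + \<alpha>\<close> is cut off by a sign vector \<open>y\<close> and \<open>z\<close> is tight at \<open>p\<close>, then \<open>y + z\<close> is a sum of two
  sign vectors \<open>a\<close>, \<open>b\<close> of its cell; one of them is tight at \<open>p\<close>, which contradicts the tangency of \<open>\<alpha>\<close>.
\<close>

lemma blocked_pair:
  assumes ij: "i < n" "j < n" "i \<noteq> j" and st: "s \<in> {1, -1}" "t \<in> {1, -1}"
    and tan: "tangent (s *\<^sub>R e i + t *\<^sub>R e j)" and blocked: "s *\<^sub>R e i + t *\<^sub>R e j \<notin> steps"
    and z: "sign_vector n z" "V z \<in> normal_cone_at B p"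
  shows "s * z i \<le> 0"
proof (rule ccontr)
  assume "\<not> s * z i \<le> 0"
  then have szi: "s * z i = 1" using sign_vectorD[OF z(1) ij(1)] st by auto
  define \<alpha> where "\<alpha> = s *\<^sub>R e i + t *\<^sub>R e j"
  have \<alpha>: "\<alpha> \<in> \<Psi>" unfolding \<alpha>_def pair_root_def[of e n] using ij st by (intro D_roots) (auto simp: pair_root_def)
  have \<alpha>V: "\<alpha> \<bullet> V a = s * a i + t * a j" for a using ij by (simp add: \<alpha>_def inner_add_left e_V)
  have "p + \<alpha> \<notin> convex hull B" using blocked \<alpha> steps_memI unfolding \<alpha>_def by blast
  then obtain y r where y: "sign_vector n y" "r \<in> B" "V y \<in> normal_cone_at B r" "(r - p) \<bullet> V y < \<alpha> \<bullet> V y"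
    using convex_hull_memI[of \<alpha> False] span_base[OF \<alpha>] by (force simp: not_le)
  have "V y \<notin> normal_cone_at B p"
    using tan diff_nonneg[OF y(2,3)] y(4) unfolding tangent_def \<alpha>_def[symmetric] by force
  \<comment> \<open>From here on the numbers are forced: the slack of \<open>y\<close> is a positive
    integer below its \<alpha>-value, which is at most 2, so they are 1 and 2.\<close>
  then have ge1: "1 \<le> (r - p) \<bullet> V y" by (rule diff_ge_one[OF y(1-3)])
  have y1: "s * y i = 1" "t * y j = 1"
    using y(4) ge1 sign_vectorD[OF y(1) ij(1)] sign_vectorD[OF y(1) ij(2)] st unfolding \<alpha>V by auto
  obtain k :: int where k: "(r - p) \<bullet> V y = of_int k" using diff_int[OF y(1,2)] by blast
  have "of_int 1 \<le> (of_int k :: real)" "(of_int k :: real) < of_int 2"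
    using k ge1 y(4) y1 unfolding \<alpha>V by simp_all
  then have k1: "(r - p) \<bullet> V y = 1" unfolding k of_int_le_iff of_int_less_iff by simp
  have "\<alpha> \<bullet> V z \<le> 0" using tan z(2) unfolding tangent_def \<alpha>_def by blast
  then have tzj: "t * z j = -1" using szi sign_vectorD[OF z(1) ij(2)] st unfolding \<alpha>V by auto
  define x where "x k = y k + z k" for k
  define a where "a k = sgn (x k)" for k
  define b where "b k = max (x k - 1) 0 + min (x k + 1) 0" for k
  have Vx: "V x = V y + V z" unfolding x_def by (rule V_add)
  have xv: "x k \<in> {-2, -1, 0, 1, 2}" if "k < n" for k
    using sign_vectorD[OF y(1) that] sign_vectorD[OF z(1) that] by (auto simp: x_def)
  have ab: "x k = a k + b k" if "k < n" for k
    using xv[OF that] by (auto simp: a_def b_def)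
  have a_sign: "sign_vector n a" by (auto simp: sign_vector_def a_def sgn_if)
  have b_sign: "sign_vector n b" using xv by (fastforce simp: sign_vector_def b_def)
  have a_cell: "V a \<in> cell (V x)" unfolding a_def by (rule odd_mono_cell) (rule odd_mono_sgn)
  have b_cell: "V b \<in> cell (V x)" unfolding b_def using odd_mono_cell[OF odd_mono_shrink, of 1 x] by simp
  have Vab: "V x = V a + V b" using V_cong[OF ab] by (simp add: V_add)
  have bound: "q \<bullet> V x \<le> r \<bullet> V y + p \<bullet> V z" if "q \<in> B" for q
    using y(3) z(2) that by (auto simp: Vx inner_add_right normal_cone_at_def intro: add_mono)
  then have "V x \<in> bounded_dirs B" by (auto simp: bounded_dirs_def bdd_above_def)
  then obtain r' where r': "r' \<in> B" "V x \<in> normal_cone_at B r'" using M_set_attained[OF M_set] by blast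
  have nc: "V a \<in> normal_cone_at B r'" "V b \<in> normal_cone_at B r'"
    using B_cell[OF r'] a_cell b_cell by blast+
  \<comment> \<open>As \<open>z\<close> is tight at \<open>p\<close>, the slack of
    \<open>y + z\<close> is at most that of \<open>y\<close>, namely 1. It splits into two
    nonnegative integers, one of which must be 0.\<close>
  have "(r' - p) \<bullet> V a + (r' - p) \<bullet> V b \<le> (r - p) \<bullet> V y"
  proof -
    have "q \<bullet> V a + q \<bullet> V b = q \<bullet> V y + q \<bullet> V z" for q
      using Vx Vab by (metis inner_add_right)
    from this[of r'] this[of p] show ?thesis
      using bound[OF r'(1)] by (simp add: Vx inner_diff_left inner_add_right)
  qed
  moreover obtain ka kb :: int where "(r' - p) \<bullet> V a = of_int ka" "(r' - p) \<bullet> V b = of_int kb"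
    using diff_int[OF a_sign r'(1)] diff_int[OF b_sign r'(1)] by blast
  ultimately have "(r' - p) \<bullet> V a = 0 \<or> (r' - p) \<bullet> V b = 0"
    using diff_nonneg[OF r'(1) nc(1)] diff_nonneg[OF r'(1) nc(2)] k1 by auto
  then have tight: "V a \<in> normal_cone_at B p \<or> V b \<in> normal_cone_at B p"
    using tight_if_diff_zero nc by blast
  \<comment> \<open>Coordinate \<open>i\<close> doubles and coordinate \<open>j\<close> cancels; the
    layers share the 2 evenly, so \<alpha> is 1 on each of them.\<close>
  have xi: "s * x i = 2" "x j = 0"
    using szi y1 tzj st by (auto simp: x_def distrib_left)
  have "s * a i = 1" "s * b i = 1" "a j = 0" "b j = 0"
    using xi st by (auto simp: a_def b_def)
  then have "\<alpha> \<bullet> V a = 1" "\<alpha> \<bullet> V b = 1" by (auto simp: \<alpha>V)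
  then show False using tight tan unfolding tangent_def \<alpha>_def[symmetric] by force
qed

text \<open>A single coordinate of a sign vector is at most 1, so it never exceeds a positive
  integral slack.\<close>

lemma unit_in_convex_hull:
  assumes i: "i < n" and s: "s \<in> {1, -1}"
    and tight: "\<And>z. sign_vector n z \<Longrightarrow> V z \<in> normal_cone_at B p \<Longrightarrow> s * z i \<le> 0"
  shows "p + s *\<^sub>R e i \<in> convex hull B"
proof (rule convex_hull_memI_le_one[where pos = False])
  show "s *\<^sub>R e i \<in> span \<Psi>" by (intro span_scale e_span i)
  fix z assume z: "sign_vector n z"
  show "s *\<^sub>R e i \<bullet> V z \<le> 1" using sign_vectorD[OF z i] s by (auto simp: e_V i)
  show "s *\<^sub>R e i \<bullet> V z \<le> 0" if "V z \<in> normal_cone_at B p" using tight[OF z that] by (simp add: e_V i)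
qed simp

lemma tangent_pair_cases:
  assumes ij: "i < n" "j < n" "i \<noteq> j" and st: "s \<in> {1, -1}" "t \<in> {1, -1}"
    and tan: "tangent (s *\<^sub>R e i + t *\<^sub>R e j)"
  shows "s *\<^sub>R e i + t *\<^sub>R e j \<in> steps \<or>
    (\<forall>z. sign_vector n z \<longrightarrow> V z \<in> normal_cone_at B p \<longrightarrow> s * z i \<le> 0 \<and> t * z j \<le> 0)"
  using blocked_pair[OF ij st tan] blocked_pair[of j i t s] ij st tan by (auto simp: add.commute)

lemma tangent_single:
  assumes i: "i < n" and "0 < m" and tan: "tangent ((m * s) *\<^sub>R e i)" and z: "V z \<in> normal_cone_at B p"
  shows "s * z i \<le> 0"
proof -
  have "(m * s) *\<^sub>R e i \<bullet> V z \<le> 0" using tan z unfolding tangent_def by blast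
  then show ?thesis using assms(2) by (simp add: e_V i mult.assoc mult_le_0_iff)
qed

lemma type_B_steps:
  assumes short: "\<And>i s. i < n \<Longrightarrow> s \<in> {1, -1} \<Longrightarrow> s *\<^sub>R e i \<in> \<Psi>"
    and \<alpha>: "pair_root e n \<alpha> \<or> single_root 1 e n \<alpha>" "tangent \<alpha>"
  shows "\<alpha> \<in> convex_cone hull steps"
proof -
  have unit: "s *\<^sub>R e i \<in> convex_cone hull steps"
    if "i < n" "s \<in> {1, -1}" "\<And>z. sign_vector n z \<Longrightarrow> V z \<in> normal_cone_at B p \<Longrightarrow> s * z i \<le> 0" for i s
    using steps_memI[OF short unit_in_convex_hull] that by (intro hull_inc) blast
  from \<alpha>(1) show ?thesis
    unfolding pair_root_def single_root_def
  proof (elim disjE exE conjE)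
    fix i j s t assume *: "i < n" "j < n" "i \<noteq> j" "s \<in> {1, -1}" "t \<in> {1, -1}" "\<alpha> = s *\<^sub>R e i + t *\<^sub>R e j"
    show ?thesis
      using tangent_pair_cases[OF *(1-5)] \<alpha>(2) unit[OF *(1,4)] unit[OF *(2,5)] unfolding *(6)
      by (blast intro: convex_cone_hull_add hull_inc)
  next
    fix i s assume *: "i < n" "s \<in> {1, -1}" "\<alpha> = (1 * s) *\<^sub>R e i"
    then show ?thesis using unit[OF *(1,2)] tangent_single[of i 1 s] \<alpha>(2) by auto
  qed
qed

text \<open>
  The point \<open>p' = p + s e\<^sub>i\<close> has the wrong parity to be a lattice point. If for every \<open>k\<close> some direction
  that is maximized at \<open>p'\<close> had nonzero \<open>k\<close>-th coordinate, then so had a sign vector of full support;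
  but on such a vector the lattice takes values of the parity of \<open>p\<close>.
\<close>

lemma free_coordinate:
  assumes even: "\<And>z \<alpha>. sign_vector n z \<Longrightarrow> (\<forall>k<n. z k \<noteq> 0) \<Longrightarrow> \<alpha> \<in> \<Psi> \<Longrightarrow> \<exists>k::int. \<alpha> \<bullet> V z = 2 * of_int k"
    and i: "i < n" and s: "s \<in> {1, -1}"
    and p': "p + s *\<^sub>R e i \<in> convex hull B"
    and K: "K = normal_cone_at B (p + s *\<^sub>R e i)"
    and flip: "\<And>z. i \<in> F \<or> (sign_vector n z \<longrightarrow> z i = 0 \<longrightarrow> (\<forall>k<n. k \<noteq> i \<longrightarrow> z k \<noteq> 0) \<longrightarrow> V (z(i := 1)) \<in> cell (V z))"
    and F: "F = {..<n} \<or> F = {..<n} - {i}"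
  shows "\<exists>k\<in>F. \<forall>z. sign_vector n z \<longrightarrow> V z \<in> K \<longrightarrow> z k = 0"
proof (rule ccontr)
  assume "\<not> ?thesis"
  then have hit: "\<exists>z. sign_vector n z \<and> V z \<in> K \<and> z k \<noteq> 0" if "k \<in> F" for k using that by blast
  have M: "M_polyhedron (convex hull B)" using M_set by (simp add: M_set_def)
  have Kc: "convex_cone K" unfolding K by (rule convex_cone_normal_cone_at)
  have K_cell: "y \<in> K" if "x \<in> K" "y \<in> cell x" for x y
    using M_polyhedron_cell_closed[OF M p'] that unfolding K normal_cone_at_convex_hull
    by (auto simp: cell_closed_def)
  have "\<exists>a. V a \<in> K \<and> (\<forall>k\<in>J. a k \<noteq> 0)" if "finite J" "J \<subseteq> F" for J
    using that
  proof (induction J)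
    case empty
    have "V (\<lambda>_. 0) = 0" by (simp add: V_def)
    then show ?case using convex_cone_contains_0[OF Kc] by (intro exI[of _ "\<lambda>_. 0"]) simp
  next
    case (insert k J)
    then obtain a where a: "V a \<in> K" "\<forall>k\<in>J. a k \<noteq> 0" by auto
    obtain z where z: "V z \<in> K" "z k \<noteq> 0" using hit[of k] insert.prems by auto
    \<comment> \<open>Each coordinate in \<open>insert k J\<close> rules out at most one \<delta>,
      so some positive \<delta> keeps all of them nonzero.\<close>
    have "infinite {0::real<..}" by (rule infinite_Ioi)
    then obtain \<delta> where d: "0 < \<delta>" "\<delta> \<notin> (\<lambda>l. - a l / z l) ` insert k J"
    proof -
      have "infinite ({0<..} - (\<lambda>l. - a l / z l) ` insert k J)"
        using insert.hyps(1) \<open>infinite {0::real<..}\<close> by (intro Diff_infinite_finite) auto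
      then have "{0<..} - (\<lambda>l. - a l / z l) ` insert k J \<noteq> {}" by (rule infinite_imp_nonempty)
      then show ?thesis using that by blast
    qed
    have "a l + \<delta> * z l \<noteq> 0" if "l \<in> insert k J" for l
    proof
      assume eq: "a l + \<delta> * z l = 0"
      have "z l \<noteq> 0" using eq that a(2) z(2) by auto
      then have "\<delta> = - a l / z l" using eq by (simp add: field_simps)
      then show False using d(2) that by blast
    qed
    moreover have "V (\<lambda>l. a l + \<delta> * z l) \<in> K"
      using a(1) z(1) d(1) by (simp add: V_add V_scale convex_cone_add[OF Kc] convex_cone_scaleR[OF Kc])
    ultimately show ?case by blast
  qed
  moreover have "finite F" using F by auto
  ultimately obtain a where a: "V a \<in> K" "\<forall>k\<in>F. a k \<noteq> 0" by blast
  define z where "z k = sgn (a k)" for k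
  have z: "sign_vector n z" by (auto simp: sign_vector_def z_def sgn_if)
  have zK: "V z \<in> K"
    unfolding z_def using K_cell[OF a(1)] odd_mono_cell[OF odd_mono_sgn] by blast
  have zF: "z k \<noteq> 0" if "k \<in> F" for k using a(2) that by (simp add: z_def sgn_zero_iff)
  \<comment> \<open>If \<open>F\<close> omits \<open>i\<close>, that coordinate of \<open>z\<close>
    may vanish; \<open>flip\<close> then sets it to 1 within the closed cell.\<close>
  have "\<exists>z'. sign_vector n z' \<and> V z' \<in> K \<and> (\<forall>k<n. z' k \<noteq> 0)"
  proof (cases "z i = 0 \<and> i \<notin> F")
    case True
    then have "V (z(i := 1)) \<in> cell (V z)" using flip z zF F by auto
    moreover have "sign_vector n (z(i := 1))" using z by (auto simp: sign_vector_def)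
    moreover have "\<forall>k<n. (z(i := 1)) k \<noteq> 0" using zF F True by auto
    ultimately show ?thesis using K_cell[OF zK] by blast
  next
    case False
    then have "\<forall>k<n. z k \<noteq> 0" using zF F by blast
    then show ?thesis using z zK by blast
  qed
  then obtain z' where z': "sign_vector n z'" "V z' \<in> K" "\<forall>k<n. z' k \<noteq> 0" by blast
  \<comment> \<open>A lattice maximizer \<open>b\<close> differs from \<open>p\<close> by a lattice
    vector, on which \<open>z'\<close> is even, whereas the two values differ by
    \<open>s * z' i\<close>, which is 1 or -1.\<close>
  obtain b where b: "b \<in> B" "b \<bullet> V z' = (p + s *\<^sub>R e i) \<bullet> V z'"
    using exposed_convex_hull_nonempty[OF p', of "V z'"] z'(2) unfolding K normal_cone_at_convex_hull by blast
  have "b - p \<in> lattice" using b(1) p_in M_set lattice_diff unfolding M_set_def by blast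
  moreover have "\<exists>k::int. \<alpha> \<bullet> V z' = 2 * of_int k" if "\<alpha> \<in> \<Phi>" for \<alpha>
    using even[OF z'(1,3)] outside_V[OF that] by (cases "\<alpha> \<in> \<Psi>") (auto intro: exI[of _ 0])
  ultimately obtain k :: int where "(b - p) \<bullet> V z' = 2 * of_int k"
    using lattice_inner_multiple by blast
  then have "s * z' i = of_int (2 * k)"
    using b(2) by (simp add: inner_diff_left inner_add_left e_V i)
  moreover have "s * z' i = of_int 1 \<or> s * z' i = of_int (-1)"
    using sign_vectorD[OF z'(1) i] z'(3) i s by auto
  ultimately have "2 * k = 1 \<or> 2 * k = -1" by (metis of_int_eq_iff)
  then show False by presburger
qed

lemma type_CD_steps:
  assumes CD: "\<And>\<alpha>. \<alpha> \<in> \<Psi> \<Longrightarrow> pair_root e n \<alpha> \<or> single_root 2 e n \<alpha>"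
    and type: "(\<forall>i<n. \<forall>s\<in>{1, -1}. (2 * s) *\<^sub>R e i \<in> \<Psi>) \<or> (\<forall>\<alpha>\<in>\<Psi>. pair_root e n \<alpha>)"
    and \<alpha>: "\<alpha> \<in> \<Psi>" "tangent \<alpha>"
  shows "\<alpha> \<in> convex_cone hull steps"
proof -
  have even: "\<exists>k::int. \<alpha> \<bullet> V z = 2 * of_int k"
    if z: "sign_vector n z" "\<forall>k<n. z k \<noteq> 0" and a: "\<alpha> \<in> \<Psi>" for z \<alpha>
  proof -
    have unit: "s * z i \<in> {1, -1}" if "i < n" "s \<in> {1, -1}" for i s
      using sign_vectorD[OF z(1) that(1)] z(2) that by auto
    have "\<alpha> \<bullet> V z \<in> {2 * of_int (-1), 2 * of_int 0, 2 * of_int 1}"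
      using CD[OF a] unfolding pair_root_def single_root_def
    proof (elim disjE exE conjE)
      fix i j s t assume "i < n" "j < n" "s \<in> {1, -1}" "t \<in> {1, -1}" "\<alpha> = s *\<^sub>R e i + t *\<^sub>R e j"
      then show ?thesis using unit[of i s] unit[of j t] by (auto simp: inner_add_left e_V)
    next
      fix i s assume "i < n" "s \<in> {1, -1}" "\<alpha> = (2 * s) *\<^sub>R e i"
      then show ?thesis using unit[of i s] by (auto simp: e_V)
    qed
    then show ?thesis by blast
  qed
  \<comment> \<open>A pair root that involves \<open>i\<close> has value 1 or -1 at
    \<open>z\<close>, so changing the vanishing coordinate to 1 cannot turn a nonpositive value
    positive.\<close>
  have flip: "V (z(i := 1)) \<in> cell (V z)"
    if D: "\<forall>\<alpha>\<in>\<Psi>. pair_root e n \<alpha>" and z: "sign_vector n z" "z i = 0" "\<forall>k<n. k \<noteq> i \<longrightarrow> z k \<noteq> 0" for i z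
  proof (rule V_in_cellI)
    fix \<alpha> assume a: "\<alpha> \<in> \<Psi>" "\<alpha> \<bullet> V z \<le> 0"
    have "pair_root e n \<alpha>" using D a(1) by blast
    then obtain l m s t where *: "l < n" "m < n" "l \<noteq> m" "s \<in> {1, -1}" "t \<in> {1, -1}" "\<alpha> = s *\<^sub>R e l + t *\<^sub>R e m"
      unfolding pair_root_def by blast
    then show "\<alpha> \<bullet> V (z(i := 1)) \<le> 0"
      using a(2) z(2,3) sign_vectorD[OF z(1) *(1)] sign_vectorD[OF z(1) *(2)]
      by (auto simp: inner_add_left e_V)
  qed
  have double: "(2 * s) *\<^sub>R e i \<in> convex_cone hull steps"
    if i: "i < n" and s: "s \<in> {1, -1}"
      and tight: "\<And>z. sign_vector n z \<Longrightarrow> V z \<in> normal_cone_at B p \<Longrightarrow> s * z i \<le> 0" for i s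
  proof -
    have p': "p + s *\<^sub>R e i \<in> convex hull B" by (rule unit_in_convex_hull[OF i s]) (rule tight)
    define K where "K = normal_cone_at B (p + s *\<^sub>R e i)"
    \<comment> \<open>Without long roots \<open>k = i\<close> has to be excluded, since twice
      \<open>s *\<^sub>R e i\<close> is then not a root.\<close>
    define F where "F = (if \<forall>i<n. \<forall>s\<in>{1, -1}. (2 * s) *\<^sub>R e i \<in> \<Psi> then {..<n} else {..<n} - {i})"
    have "\<exists>k\<in>F. \<forall>z. sign_vector n z \<longrightarrow> V z \<in> K \<longrightarrow> z k = 0"
    proof (rule free_coordinate[OF _ i s p' K_def])
      show "i \<in> F \<or> (sign_vector n z \<longrightarrow> z i = 0 \<longrightarrow> (\<forall>k<n. k \<noteq> i \<longrightarrow> z k \<noteq> 0) \<longrightarrow>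
          V (z(i := 1)) \<in> cell (V z))" for z
        using type i flip unfolding F_def by auto
      show "F = {..<n} \<or> F = {..<n} - {i}" by (simp add: F_def)
    qed (rule even)
    then obtain k where k: "k \<in> F" "\<And>z. sign_vector n z \<Longrightarrow> V z \<in> K \<Longrightarrow> z k = 0" by blast
    have kn: "k < n" using k(1) by (auto simp: F_def split: if_splits)
    have step: "s *\<^sub>R e i + t *\<^sub>R e k \<in> steps"
      if root: "s *\<^sub>R e i + t *\<^sub>R e k \<in> \<Psi>" and t: "t \<in> {1, -1}" for t
    proof (rule steps_memI[OF root], rule convex_hull_memI[where pos = False])
      show "s *\<^sub>R e i + t *\<^sub>R e k \<in> span \<Psi>" by (rule span_base[OF root])
      fix z r assume z: "sign_vector n z" and r: "r \<in> B" "V z \<in> normal_cone_at B r"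
      have val: "(s *\<^sub>R e i + t *\<^sub>R e k) \<bullet> V z = s * z i + t * z k"
        by (simp add: inner_add_left e_V i kn)
      have "(p + s *\<^sub>R e i) \<bullet> V z \<le> r \<bullet> V z"
        using p' r normal_cone_at_convex_hull[of B r] by (auto simp: normal_cone_at_def)
      then have ge: "s * z i \<le> (r - p) \<bullet> V z" by (simp add: inner_diff_left inner_add_left e_V i)
      show "(s *\<^sub>R e i + t *\<^sub>R e k) \<bullet> V z \<le> (r - p) \<bullet> V z"
      proof (cases "V z \<in> K")
        case True
        then show ?thesis using k(2)[OF z] ge val by simp
      next
        case False
        \<comment> \<open>Outside \<open>K\<close> the integral slack exceeds
          \<open>s * z i\<close>, hence by at least 1, which pays for the extra term
          \<open>t * z k\<close>.\<close>
        have "(r - p) \<bullet> V z \<noteq> s * z i"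
        proof
          assume "(r - p) \<bullet> V z = s * z i"
          then have "r \<bullet> V z = (p + s *\<^sub>R e i) \<bullet> V z" by (simp add: inner_diff_left inner_add_left e_V i)
          then show False using r(2) False by (simp add: K_def normal_cone_at_def)
        qed
        moreover obtain l :: int where "(r - p) \<bullet> V z = of_int l" using diff_int[OF z r(1)] by blast
        moreover have "\<exists>m::int. s * z i = of_int m"
        proof -
          have "s * z i \<in> {of_int (-1), of_int 0, of_int 1}" using sign_vectorD[OF z i] s by auto
          then show ?thesis by blast
        qed
        ultimately have "s * z i + 1 \<le> (r - p) \<bullet> V z" using ge by auto
        moreover have "t * z k \<le> 1" using sign_vectorD[OF z kn] t by auto
        ultimately show ?thesis using val by linarith
      qed
    qed simp
    \<comment> \<open>For \<open>k = i\<close> the step itself is the double; otherwise the steps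
      with both signs of \<open>e k\<close> add up to it.\<close>
    show ?thesis
    proof (cases "k = i")
      case True
      then have "(2 * s) *\<^sub>R e i \<in> \<Psi>" using k(1) i s unfolding F_def by (auto split: if_splits)
      moreover have "s *\<^sub>R e i + s *\<^sub>R e k = (2 * s) *\<^sub>R e i" using True by (simp add: scaleR_add_left[symmetric])
      ultimately show ?thesis using step[of s] s by (auto intro: hull_inc)
    next
      case False
      have "s *\<^sub>R e i + t *\<^sub>R e k \<in> convex_cone hull steps" if "t \<in> {1, -1}" for t
        using D_roots[of "s *\<^sub>R e i + t *\<^sub>R e k"] step[of t] i kn False s that
        unfolding pair_root_def by (intro hull_inc) blast
      from convex_cone_hull_add[OF this[of 1] this[of "-1"]]
      show ?thesis by (simp add: scaleR_add_left[symmetric])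
    qed
  qed
  from CD[OF \<alpha>(1)] show ?thesis
    unfolding pair_root_def single_root_def
  proof (elim disjE exE conjE)
    fix i j s t assume *: "i < n" "j < n" "i \<noteq> j" "s \<in> {1, -1}" "t \<in> {1, -1}" "\<alpha> = s *\<^sub>R e i + t *\<^sub>R e j"
    show ?thesis
    proof (cases "\<alpha> \<in> steps")
      case True
      then show ?thesis by (rule hull_inc)
    next
      case False
      then have "(2 * s) *\<^sub>R e i \<in> convex_cone hull steps" "(2 * t) *\<^sub>R e j \<in> convex_cone hull steps"
        using tangent_pair_cases[OF *(1-5)] \<alpha>(2) double[OF *(1,4)] double[OF *(2,5)] *(6) by blast+
      then have "(1 / 2) *\<^sub>R ((2 * s) *\<^sub>R e i + (2 * t) *\<^sub>R e j) \<in> convex_cone hull steps"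
        by (intro convex_cone_hull_mul[OF convex_cone_hull_add]) auto
      then show ?thesis using *(6) by (simp add: scaleR_add_right)
    qed
  next
    fix i s assume *: "i < n" "s \<in> {1, -1}" "\<alpha> = (2 * s) *\<^sub>R e i"
    then show ?thesis using double[OF *(1,2)] tangent_single[of i 2 s] \<alpha>(2) by auto
  qed
qed

end

section \<open>Classical components\<close>

lemma model_A_memI:
  "i < n + 1 \<Longrightarrow> j < n + 1 \<Longrightarrow> i \<noteq> j \<Longrightarrow> (\<lambda>k. unit_coord i k - unit_coord j k) \<in> model_A n"
  unfolding model_A_def by (intro CollectI exI conjI) auto

lemma model_D_memI:
  "i < n \<Longrightarrow> j < n \<Longrightarrow> i \<noteq> j \<Longrightarrow> s \<in> {1, -1} \<Longrightarrow> t \<in> {1, -1} \<Longrightarrow>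
    (\<lambda>k. s * unit_coord i k + t * unit_coord j k) \<in> model_D n"
  unfolding model_D_def by (rule CollectI, rule exI[of _ s], rule exI[of _ t], rule exI[of _ i], rule exI[of _ j]) simp

lemma model_B_memI: "i < n \<Longrightarrow> s \<in> {1, -1} \<Longrightarrow> (\<lambda>k. s * unit_coord i k) \<in> model_B n"
  unfolding model_B_def by (intro UnI2 CollectI exI conjI) auto

lemma model_C_memI: "i < n \<Longrightarrow> s \<in> {1, -1} \<Longrightarrow> (\<lambda>k. 2 * s * unit_coord i k) \<in> model_C n"
  unfolding model_C_def by (intro UnI2 CollectI exI conjI) auto

section \<open>Coordinates on one classical component\<close>

locale model_at = root_arrangement +
  fixes \<Psi> :: "'a set" and g :: "'a \<Rightarrow> nat \<Rightarrow> real" and B :: "'a set" and p :: 'a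
  assumes sub: "\<Psi> \<subseteq> \<Phi>"
    and orth: "\<alpha> \<in> \<Psi> \<Longrightarrow> \<beta> \<in> \<Phi> \<Longrightarrow> \<beta> \<notin> \<Psi> \<Longrightarrow> \<alpha> \<bullet> \<beta> = 0"
    and lin: "linear (\<lambda>q. g q k)"
    and inj: "inj_on g (span \<Psi>)"
    and model_M_set: "M_set B" and model_p_in: "p \<in> B"
begin

text \<open>The vector that represents the \<open>k\<close>-th model coordinate, taken in
  \<open>span \<Psi>\<close> so that the roots outside \<Psi> vanish on it.\<close>

definition E :: "nat \<Rightarrow> 'a" where
  "E k = (SOME v. v \<in> span \<Psi> \<and> (\<forall>q\<in>span \<Psi>. q \<bullet> v = g q k))"

lemma E_prop: "E k \<in> span \<Psi> \<and> (\<forall>q\<in>span \<Psi>. q \<bullet> E k = g q k)"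
proof -
  obtain v w where v: "v \<in> span \<Psi>" and w: "\<And>q. q \<in> span \<Psi> \<Longrightarrow> orthogonal w q"
    and eq: "adjoint (\<lambda>q. g q k) 1 = v + w"
    using orthogonal_subspace_decomp_exists[of \<Psi> "adjoint (\<lambda>q. g q k) 1"] by metis
  have "q \<bullet> v = g q k" if "q \<in> span \<Psi>" for q
    using adjoint_works[OF lin, of q k 1] w[OF that] by (simp add: eq inner_add_right orthogonal_def inner_commute)
  then show ?thesis unfolding E_def by (intro someI_ex[of "\<lambda>v. v \<in> span \<Psi> \<and> _ v"]) (use v in blast)
qed

lemma inner_E: "q \<in> span \<Psi> \<Longrightarrow> q \<bullet> E k = g q k"
  using E_prop by blast

lemma outside_E: "\<beta> \<in> \<Phi> \<Longrightarrow> \<beta> \<notin> \<Psi> \<Longrightarrow> \<beta> \<bullet> E k = 0"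
proof -
  assume b: "\<beta> \<in> \<Phi>" "\<beta> \<notin> \<Psi>"
  have "orthogonal \<beta> (E k)"
    by (rule orthogonal_to_span[of _ \<Psi>])
      (use E_prop orth[OF _ b] in \<open>auto simp: orthogonal_def inner_commute\<close>)
  then show ?thesis by (simp add: orthogonal_def)
qed

lemma g_combination: "g (a *\<^sub>R q + b *\<^sub>R r) k = a * g q k + b * g r k"
  using linear_add[OF lin] linear_scale[OF lin] by simp

lemma g_scale: "g (a *\<^sub>R q) k = a * g q k"
  using linear_scale[OF lin] by simp

lemma eqI: "q \<in> span \<Psi> \<Longrightarrow> r \<in> span \<Psi> \<Longrightarrow> (\<And>k. g q k = g r k) \<Longrightarrow> q = r"
proof -
  assume q: "q \<in> span \<Psi>" "r \<in> span \<Psi>" and eq: "\<And>k. g q k = g r k"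
  have "g q = g r" by (rule ext) (rule eq)
  then show "q = r" using inj_onD[OF inj] q by blast
qed

lemma pair_eqI:
  assumes "q \<in> span \<Psi>" "r \<in> span \<Psi>" "g q = unit_coord i" "g r = unit_coord j"
    and "\<alpha> \<in> \<Psi>" "g \<alpha> = (\<lambda>k. s * unit_coord i k + t * unit_coord j k)"
  shows "s *\<^sub>R q + t *\<^sub>R r = \<alpha>"
  by (rule eqI) (use assms in \<open>simp_all add: g_combination span_add span_scale span_base\<close>)

lemma scale_eqI:
  assumes "q \<in> span \<Psi>" "g q = unit_coord i" "\<alpha> \<in> \<Psi>" "g \<alpha> = (\<lambda>k. s * unit_coord i k)"
  shows "s *\<^sub>R q = \<alpha>"
  by (rule eqI) (use assms in \<open>simp_all add: g_scale span_scale span_base\<close>)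

abbreviation admissible :: "'a set" where
  "admissible \<equiv> {\<beta>\<in>\<Phi>. p + \<beta> \<in> B}"

lemma model_A_admissible:
  assumes model: "g ` \<Psi> = model_A n" and \<alpha>: "\<alpha> \<in> \<Psi>"
    and tan: "\<forall>x\<in>normal_cone_at B p. \<alpha> \<bullet> x \<le> 0"
  shows "\<alpha> \<in> convex_cone hull admissible"
proof -
  \<comment> \<open>In type A a single unit vector is not in the span of the model. Differences with
    the unit vector of index 0 replace them and serve as coordinates up to a common summand.\<close>
  have "\<exists>v\<in>span \<Psi>. \<forall>l. g v l = unit_coord k l - unit_coord 0 l" if "k < n + 1" for k
  proof (cases "k = 0")
    case True
    then show ?thesis using g_scale[of 0 0] span_zero by (intro bexI[of _ 0]) auto
  next
    case False
    then have "(\<lambda>l. unit_coord k l - unit_coord 0 l) \<in> model_A n"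
      using model_A_memI[of k n 0] that by simp
    then obtain v where "v \<in> \<Psi>" "g v = (\<lambda>l. unit_coord k l - unit_coord 0 l)"
      using model by (metis (no_types, lifting) imageE)
    then show ?thesis by (intro bexI[of _ v]) (auto intro: span_base)
  qed
  then obtain \<epsilon> where \<epsilon>: "\<And>k. k < n + 1 \<Longrightarrow> \<epsilon> k \<in> span \<Psi>"
    "\<And>k l. k < n + 1 \<Longrightarrow> g (\<epsilon> k) l = unit_coord k l - unit_coord 0 l" by metis
  have root: "\<exists>i j. i < n + 1 \<and> j < n + 1 \<and> i \<noteq> j \<and> \<beta> = \<epsilon> i - \<epsilon> j \<and> g \<beta> = (\<lambda>l. unit_coord i l - unit_coord j l)"
    if b: "\<beta> \<in> \<Psi>" for \<beta>
  proof -
    have "g \<beta> \<in> model_A n" using model b by blast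
    then obtain i j where ij: "i < n + 1" "j < n + 1" "i \<noteq> j" "g \<beta> = (\<lambda>l. unit_coord i l - unit_coord j l)"
      unfolding model_A_def by blast
    have "\<beta> = \<epsilon> i - \<epsilon> j"
    proof (rule eqI)
      show "g \<beta> k = g (\<epsilon> i - \<epsilon> j) k" for k
        using g_combination[of 1 "\<epsilon> i" "-1" "\<epsilon> j" k] ij \<epsilon>(2) by simp
    qed (use b ij \<epsilon>(1) in \<open>auto intro: span_base span_diff\<close>)
    then show ?thesis using ij by blast
  qed
  have sum_unit: "(\<Sum>k<n + 1. a k * unit_coord i k) = a i" if "i < n + 1" for a i
    using that by (simp add: unit_coord_def if_distrib cong: if_cong)
  have inner_sum: "\<beta> \<bullet> (\<Sum>k<n + 1. a k *\<^sub>R E k) = a i - a j"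
    if "\<beta> \<in> \<Psi>" "i < n + 1" "j < n + 1" "g \<beta> = (\<lambda>l. unit_coord i l - unit_coord j l)" for \<beta> i j a
  proof -
    have "\<beta> \<bullet> (\<Sum>k<n + 1. a k *\<^sub>R E k) = (\<Sum>k<n + 1. a k * (unit_coord i k - unit_coord j k))"
      unfolding inner_sum_right using that by (intro sum.cong) (auto simp: inner_E span_base)
    also have "\<dots> = (\<Sum>k<n + 1. a k * unit_coord i k) - (\<Sum>k<n + 1. a k * unit_coord j k)"
      by (simp only: right_diff_distrib sum_subtractf)
    also have "\<dots> = a i - a j" using sum_unit that by simp
    finally show ?thesis .
  qed
  interpret component_at \<Phi> \<Psi> E "n + 1" B p
  proof (unfold_locales)
    show "\<Psi> \<subseteq> \<Phi>" by (rule sub)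
    show "\<beta> \<bullet> E k = 0" if "\<beta> \<in> \<Phi>" "\<beta> \<notin> \<Psi>" for \<beta> k by (rule outside_E[OF that])
    show "\<exists>a. \<forall>\<beta>\<in>\<Psi>. \<beta> \<bullet> y = \<beta> \<bullet> (\<Sum>k<n + 1. a k *\<^sub>R E k)" for y
    proof (intro exI[of _ "\<lambda>k. \<epsilon> k \<bullet> y"] ballI)
      fix \<beta> assume b: "\<beta> \<in> \<Psi>"
      obtain i j where ij: "i < n + 1" "j < n + 1" "g \<beta> = (\<lambda>l. unit_coord i l - unit_coord j l)"
        and eq: "\<beta> = \<epsilon> i - \<epsilon> j"
        using root[OF b] by blast
      show "\<beta> \<bullet> y = \<beta> \<bullet> (\<Sum>k<n + 1. (\<epsilon> k \<bullet> y) *\<^sub>R E k)"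
        unfolding inner_sum[OF b ij] by (simp only: eq inner_diff_left)
    qed
    show "\<beta> \<bullet> E k \<in> \<int>" if b: "\<beta> \<in> \<Psi>" for \<beta> k
    proof -
      obtain i j where "g \<beta> = (\<lambda>l. unit_coord i l - unit_coord j l)" using root[OF b] by blast
      then have "\<beta> \<bullet> E k = unit_coord i k - unit_coord j k" by (simp add: inner_E span_base b)
      then show ?thesis by (simp add: unit_coord_def)
    qed
    show "\<beta> \<bullet> (\<Sum>k<n + 1. \<phi> (a k) *\<^sub>R E k) \<le> 0"
      if \<phi>: "odd_mono \<phi>" and b: "\<beta> \<in> \<Psi>" and le: "\<beta> \<bullet> (\<Sum>k<n + 1. a k *\<^sub>R E k) \<le> 0" for \<phi> \<beta> a
    proof -
      obtain i j where ij: "i < n + 1" "j < n + 1" "g \<beta> = (\<lambda>l. unit_coord i l - unit_coord j l)"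
        using root[OF b] by blast
      have "a i \<le> a j" using le unfolding inner_sum[OF b ij] by simp
      then have "\<phi> (a i) \<le> \<phi> (a j)" using \<phi> by (simp add: odd_mono_def monoD)
      then show ?thesis unfolding inner_sum[OF b ij] by simp
    qed
  qed (rule model_M_set model_p_in)+
  \<comment> \<open>Roots of type A are differences of coordinates, so constants are invisible;
    subtracting the minimum gives nonnegative representatives.\<close>
  have "V (\<lambda>_. 1) = 0"
  proof (rule eq_zero_if_roots)
    fix \<beta> assume b: "\<beta> \<in> \<Phi>"
    show "\<beta> \<bullet> V (\<lambda>_. 1) = 0"
    proof (cases "\<beta> \<in> \<Psi>")
      case True
      obtain i j where ij: "i < n + 1" "j < n + 1" "g \<beta> = (\<lambda>l. unit_coord i l - unit_coord j l)"
        using root[OF True] by blast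
      show ?thesis using inner_sum[OF True ij, of "\<lambda>_. 1"] by (simp only: V_def)
    qed (rule outside_V[OF b])
  qed
  then have V_shift: "V (\<lambda>k. a k + c) = V a" for a c
    using V_add[of a "\<lambda>_. c * 1"] V_scale[of c "\<lambda>_. 1"]
    by (simp only: mult_1_right scaleR_zero_right add_0_right)
  have shift: "\<exists>b. (\<forall>k<n + 1. 0 \<le> b k) \<and> V b = V a" for a
  proof (intro exI[of _ "\<lambda>k. a k + - Min (a ` {..<n + 1})"] conjI allI impI)
    fix k assume "k < n + 1"
    then have "Min (a ` {..<n + 1}) \<le> a k" by (intro Min_le) auto
    then show "0 \<le> a k + - Min (a ` {..<n + 1})" by simp
  qed (rule V_shift)
  obtain i j where ij: "i < n + 1" "j < n + 1" "g \<alpha> = (\<lambda>l. unit_coord i l - unit_coord j l)"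
    using root[OF \<alpha>] by blast
  have "p + \<alpha> \<in> convex hull B"
  proof (rule convex_hull_memI_le_one[where pos = True])
    show "\<alpha> \<in> span \<Psi>" by (rule span_base[OF \<alpha>])
    show "True \<longrightarrow> (\<forall>a. \<exists>b. (\<forall>k<n + 1. 0 \<le> b k) \<and> V b = V a)" using shift by blast
    show "\<alpha> \<bullet> V z \<le> 0" if "V z \<in> normal_cone_at B p" for z using tan that by blast
    show "\<alpha> \<bullet> V z \<le> 1" if "sign_vector (n + 1) z" "True \<longrightarrow> (\<forall>k<n + 1. 0 \<le> z k)" for z
      using inner_sum[OF \<alpha> ij, of z] sign_vectorD[OF that(1) ij(1)] that(2) ij(2)
      unfolding V_def by force
  qed
  then have "\<alpha> \<in> admissible" using steps_memI[OF \<alpha>] unfolding steps_def by blast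
  then show ?thesis by (rule hull_inc)
qed

lemma pair_rootI:
  assumes e: "\<forall>i<n. e i \<in> span \<Psi> \<and> g (e i) = unit_coord i"
    and a: "\<alpha> \<in> \<Psi>" "g \<alpha> \<in> model_D n"
  shows "pair_root e n \<alpha>"
proof -
  obtain i j s t where *: "i < n" "j < n" "i \<noteq> j" "s \<in> {1, -1}" "t \<in> {1, -1}"
    "g \<alpha> = (\<lambda>k. s * unit_coord i k + t * unit_coord j k)"
    using a(2) unfolding model_D_def by blast
  have "s *\<^sub>R e i + t *\<^sub>R e j = \<alpha>"
    by (rule pair_eqI) (use a(1) * e in simp_all)
  then show ?thesis using * unfolding pair_root_def by blast
qed

lemma single_rootI:
  assumes e: "\<forall>i<n. e i \<in> span \<Psi> \<and> g (e i) = unit_coord i"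
    and a: "\<alpha> \<in> \<Psi>" "g \<alpha> \<in> {(\<lambda>k. m * s * unit_coord i k) | s i. s \<in> {1, -1} \<and> i < n}"
  shows "single_root m e n \<alpha>"
proof -
  obtain i s where *: "i < n" "s \<in> {1, -1}" "g \<alpha> = (\<lambda>k. m * s * unit_coord i k)" using a(2) by blast
  have "(m * s) *\<^sub>R e i = \<alpha>"
    by (rule scale_eqI) (use a(1) * e in simp_all)
  then show ?thesis using * unfolding single_root_def by blast
qed

lemma signed_model:
  assumes D: "model_D n \<subseteq> g ` \<Psi>" and BC: "g ` \<Psi> \<subseteq> model_B n \<union> model_C n"
    and units: "\<And>i. i < n \<Longrightarrow> \<exists>v\<in>span \<Psi>. g v = unit_coord i"
  obtains e where "signed_component_at \<Phi> \<Psi> e E n B p"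
    "\<forall>i<n. e i \<in> span \<Psi> \<and> g (e i) = unit_coord i"
proof -
  obtain e where e: "\<forall>i<n. e i \<in> span \<Psi> \<and> g (e i) = unit_coord i"
    using units by metis
  note pair = pair_rootI[OF e] and single = single_rootI[OF e]
  have "signed_component_at \<Phi> \<Psi> e E n B p"
  proof (unfold_locales)
    show "\<Psi> \<subseteq> \<Phi>" by (rule sub)
    show "\<beta> \<bullet> E k = 0" if "\<beta> \<in> \<Phi>" "\<beta> \<notin> \<Psi>" for \<beta> k by (rule outside_E[OF that])
    show "e i \<bullet> E k = (if i = k then 1 else 0)" if "i < n" for i k
      using e that by (simp add: inner_E unit_coord_def)
    show "e i \<in> span \<Psi>" if "i < n" for i using e that by blast
    show "\<alpha> \<in> \<Psi>" if pr: "pair_root e n \<alpha>" for \<alpha>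
    proof -
      obtain i j s t where *: "i < n" "j < n" "i \<noteq> j" "s \<in> {1, -1}" "t \<in> {1, -1}" "\<alpha> = s *\<^sub>R e i + t *\<^sub>R e j"
        using pr unfolding pair_root_def by blast
      have "(\<lambda>k. s * unit_coord i k + t * unit_coord j k) \<in> model_D n"
        using * by (intro model_D_memI)
      then obtain \<beta> where b: "\<beta> \<in> \<Psi>" "g \<beta> = (\<lambda>k. s * unit_coord i k + t * unit_coord j k)"
        using D by (metis (no_types, lifting) imageE subsetD)
      have "\<alpha> = \<beta>"
        unfolding *(6) by (rule pair_eqI) (use b * e in simp_all)
      then show ?thesis using b by simp
    qed
    show "pair_root e n \<alpha> \<or> single_root 1 e n \<alpha> \<or> single_root 2 e n \<alpha>" if a: "\<alpha> \<in> \<Psi>" for \<alpha>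
    proof -
      have "g \<alpha> \<in> model_B n \<union> model_C n" using BC a by blast
      then show ?thesis
        using pair[OF a] single[OF a, where m = 1] single[OF a, where m = 2] unfolding model_B_def model_C_def
        by (auto simp del: mult_1_left)
    qed
  qed (rule model_M_set model_p_in)+
  then show thesis using that e by blast
qed

lemma model_B_admissible:
  assumes model: "g ` \<Psi> = model_B n" and \<alpha>: "\<alpha> \<in> \<Psi>"
    and tan: "\<forall>x\<in>normal_cone_at B p. \<alpha> \<bullet> x \<le> 0"
  shows "\<alpha> \<in> convex_cone hull admissible"
proof -
  have short: "\<exists>v\<in>\<Psi>. g v = (\<lambda>k. s * unit_coord i k)" if "i < n" "s \<in> {1, -1}" for i s
  proof -
    have "(\<lambda>k. s * unit_coord i k) \<in> g ` \<Psi>" using that unfolding model by (intro model_B_memI)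
    then show ?thesis by (metis (no_types, lifting) imageE)
  qed
  obtain e where e: "signed_component_at \<Phi> \<Psi> e E n B p"
    "\<forall>i<n. e i \<in> span \<Psi> \<and> g (e i) = unit_coord i"
  proof (rule signed_model[of n])
    show "model_D n \<subseteq> g ` \<Psi>" "g ` \<Psi> \<subseteq> model_B n \<union> model_C n" by (auto simp: model model_B_def)
    show "\<exists>v\<in>span \<Psi>. g v = unit_coord i" if "i < n" for i
      using short[OF that, of 1] by (auto intro: span_base)
  qed (rule that)
  note pair = pair_rootI[OF e(2)] and single = single_rootI[OF e(2)]
  interpret signed_component_at \<Phi> \<Psi> e E n B p by (rule e(1))
  have "s *\<^sub>R e i \<in> \<Psi>" if i: "i < n" and s: "s \<in> {1, -1}" for i s
  proof -
    obtain v where v: "v \<in> \<Psi>" "g v = (\<lambda>k. s * unit_coord i k)" using short[OF i s] by blast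
    have "s *\<^sub>R e i = v" by (rule scale_eqI) (use v e(2) i in simp_all)
    then show ?thesis using v by simp
  qed
  moreover have "pair_root e n \<alpha> \<or> single_root 1 e n \<alpha>"
  proof -
    have "g \<alpha> \<in> model_B n" using \<alpha> model by blast
    then show ?thesis using pair[OF \<alpha>] single[OF \<alpha>, where m = 1] unfolding model_B_def by auto
  qed
  ultimately have "\<alpha> \<in> convex_cone hull steps"
    using type_B_steps[of \<alpha>] tan unfolding tangent_def by blast
  then show ?thesis by (simp only: steps_def)
qed

lemma model_C_admissible:
  assumes model: "g ` \<Psi> = model_C n" and \<alpha>: "\<alpha> \<in> \<Psi>"
    and tan: "\<forall>x\<in>normal_cone_at B p. \<alpha> \<bullet> x \<le> 0"
  shows "\<alpha> \<in> convex_cone hull admissible"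
proof -
  have long: "\<exists>v\<in>\<Psi>. g v = (\<lambda>k. 2 * s * unit_coord i k)" if "i < n" "s \<in> {1, -1}" for i s
  proof -
    have "(\<lambda>k. 2 * s * unit_coord i k) \<in> g ` \<Psi>" using that unfolding model by (intro model_C_memI)
    then show ?thesis by (metis (no_types, lifting) imageE)
  qed
  obtain e where e: "signed_component_at \<Phi> \<Psi> e E n B p"
    "\<forall>i<n. e i \<in> span \<Psi> \<and> g (e i) = unit_coord i"
  proof (rule signed_model[of n])
    show "model_D n \<subseteq> g ` \<Psi>" "g ` \<Psi> \<subseteq> model_B n \<union> model_C n" by (auto simp: model model_C_def)
    show "\<exists>v\<in>span \<Psi>. g v = unit_coord i" if i: "i < n" for i
    proof -
      obtain v where v: "v \<in> \<Psi>" "g v = (\<lambda>k. 2 * 1 * unit_coord i k)" using long[OF i, of 1] by blast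
      \<comment> \<open>In type C the unit vectors are the halves of the long roots.\<close>
      have "g ((1 / 2) *\<^sub>R v) = unit_coord i" using v(2) by (intro ext) (simp add: g_scale)
      then show ?thesis using v(1) by (intro bexI[of _ "(1 / 2) *\<^sub>R v"]) (auto intro: span_base span_scale)
    qed
  qed (rule that)
  note pair = pair_rootI[OF e(2)] and single = single_rootI[OF e(2)]
  interpret signed_component_at \<Phi> \<Psi> e E n B p by (rule e(1))
  have "(2 * s) *\<^sub>R e i \<in> \<Psi>" if i: "i < n" and s: "s \<in> {1, -1}" for i s
  proof -
    obtain v where v: "v \<in> \<Psi>" "g v = (\<lambda>k. 2 * s * unit_coord i k)" using long[OF i s] by blast
    have "(2 * s) *\<^sub>R e i = v" by (rule scale_eqI) (use v e(2) i in simp_all)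
    then show ?thesis using v by simp
  qed
  moreover have "pair_root e n \<beta> \<or> single_root 2 e n \<beta>" if b: "\<beta> \<in> \<Psi>" for \<beta>
  proof -
    have "g \<beta> \<in> model_C n" using b model by blast
    then show ?thesis using pair[OF b] single[OF b, where m = 2] unfolding model_C_def by auto
  qed
  ultimately have "\<alpha> \<in> convex_cone hull steps"
    using type_CD_steps[of \<alpha>] tan \<alpha> unfolding tangent_def by blast
  then show ?thesis by (simp only: steps_def)
qed

lemma model_D_admissible:
  assumes model: "g ` \<Psi> = model_D n" and \<alpha>: "\<alpha> \<in> \<Psi>"
    and tan: "\<forall>x\<in>normal_cone_at B p. \<alpha> \<bullet> x \<le> 0"
  shows "\<alpha> \<in> convex_cone hull admissible"
proof -
  \<comment> \<open>The existence of the root \<alpha> forces at least two indices, so that every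
    unit vector is half the sum of two pair roots.\<close>
  have two: "\<exists>i j. i < n \<and> j < n \<and> i \<noteq> j"
  proof -
    have "g \<alpha> \<in> model_D n" using \<alpha> model by blast
    then show ?thesis unfolding model_D_def by blast
  qed
  have units: "\<exists>v\<in>span \<Psi>. g v = unit_coord i" if i: "i < n" for i
  proof -
    obtain j where j: "j < n" "i \<noteq> j" using two by metis
    have "\<exists>v\<in>\<Psi>. g v = (\<lambda>k. 1 * unit_coord i k + t * unit_coord j k)" if "t \<in> {1, -1}" for t
    proof -
      have "(\<lambda>k. 1 * unit_coord i k + t * unit_coord j k) \<in> g ` \<Psi>"
        using i j that unfolding model by (intro model_D_memI) auto
      then show ?thesis by (metis (no_types, lifting) imageE)
    qed
    from this[of 1] this[of "-1"] obtain v w where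
      v: "v \<in> \<Psi>" "g v = (\<lambda>k. 1 * unit_coord i k + 1 * unit_coord j k)" and
      w: "w \<in> \<Psi>" "g w = (\<lambda>k. 1 * unit_coord i k + (-1) * unit_coord j k)" by auto
    have "g ((1 / 2) *\<^sub>R v + (1 / 2) *\<^sub>R w) = unit_coord i"
      using v(2) w(2) by (intro ext) (simp add: g_combination field_simps)
    then show ?thesis using v(1) w(1)
      by (intro bexI[of _ "(1 / 2) *\<^sub>R v + (1 / 2) *\<^sub>R w"]) (auto intro: span_base span_scale span_add)
  qed
  obtain e where e: "signed_component_at \<Phi> \<Psi> e E n B p"
    "\<forall>i<n. e i \<in> span \<Psi> \<and> g (e i) = unit_coord i"
  proof (rule signed_model[of n])
    show "model_D n \<subseteq> g ` \<Psi>" "g ` \<Psi> \<subseteq> model_B n \<union> model_C n" by (auto simp: model model_C_def)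
  qed (erule units, rule that)
  note pair = pair_rootI[OF e(2)]
  interpret signed_component_at \<Phi> \<Psi> e E n B p by (rule e(1))
  have "\<forall>\<beta>\<in>\<Psi>. pair_root e n \<beta>" using pair model by blast
  then have "\<alpha> \<in> convex_cone hull steps"
    using type_CD_steps[of \<alpha>] tan \<alpha> unfolding tangent_def by blast
  then show ?thesis by (simp only: steps_def)
qed

end

context root_arrangement
begin

definition classical :: "'a set \<Rightarrow> bool" where
  "classical \<Psi> \<longleftrightarrow> \<Psi> \<subseteq> \<Phi> \<and> (\<forall>\<alpha>\<in>\<Psi>. \<forall>\<beta>\<in>\<Phi> - \<Psi>. \<alpha> \<bullet> \<beta> = 0) \<and>
     (\<exists>g :: 'a \<Rightarrow> nat \<Rightarrow> real. (\<forall>k. linear (\<lambda>q. g q k)) \<and> inj_on g (span \<Psi>) \<and>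
        (\<exists>n. g ` \<Psi> = model_A n \<or> g ` \<Psi> = model_B n \<or> g ` \<Psi> = model_C n \<or> g ` \<Psi> = model_D n))"

text \<open>By Farkas' lemma \<open>q - p\<close> lies in the cone over the roots that cut out the
  normal cone at \<open>p\<close>. Each of these is tangent and can be treated inside its own
  component.\<close>

lemma M_set_imp_root_cone:
  assumes B: "M_set B" and classical: "\<And>\<alpha>. \<alpha> \<in> \<Phi> \<Longrightarrow> \<exists>\<Psi>. classical \<Psi> \<and> \<alpha> \<in> \<Psi>"
  shows "root_cone B"
  unfolding root_cone_def
proof (intro ballI)
  fix p q assume p: "p \<in> B" and q: "q \<in> B"
  obtain A where A: "A \<subseteq> \<Phi>" "normal_cone_at B p = polar A" using M_set_normal_cones[OF B p] by blast
  have "A \<subseteq> convex_cone hull {\<alpha>\<in>\<Phi>. p + \<alpha> \<in> B}"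
  proof
    fix \<alpha> assume a: "\<alpha> \<in> A"
    then have tan: "\<forall>x\<in>normal_cone_at B p. \<alpha> \<bullet> x \<le> 0" by (auto simp: A(2) polar_def)
    obtain \<Psi> where cl: "classical \<Psi>" "\<alpha> \<in> \<Psi>" using classical[of \<alpha>] a A(1) by blast
    from cl(1) obtain g n where \<Psi>: "\<Psi> \<subseteq> \<Phi>" "\<forall>\<alpha>\<in>\<Psi>. \<forall>\<beta>\<in>\<Phi> - \<Psi>. \<alpha> \<bullet> \<beta> = 0"
      "\<forall>k. linear (\<lambda>q. g q k)" "inj_on g (span \<Psi>)"
      "g ` \<Psi> = model_A n \<or> g ` \<Psi> = model_B n \<or> g ` \<Psi> = model_C n \<or> g ` \<Psi> = model_D n"
      unfolding classical_def by - (elim conjE exE, rule that)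
    interpret model_at \<Phi> \<Psi> g B p
      by (intro model_at.intro root_arrangement_axioms model_at_axioms.intro)
        (use \<Psi>(1-4) B p in blast)+
    show "\<alpha> \<in> convex_cone hull {\<alpha>\<in>\<Phi>. p + \<alpha> \<in> B}"
      using \<Psi>(5) model_A_admissible[OF _ cl(2) tan] model_B_admissible[OF _ cl(2) tan]
        model_C_admissible[OF _ cl(2) tan] model_D_admissible[OF _ cl(2) tan] by blast
  qed
  then have sub: "convex_cone hull A \<subseteq> convex_cone hull {\<alpha>\<in>\<Phi>. p + \<alpha> \<in> B}"
    by (rule hull_minimal) (rule convex_cone_convex_cone_hull)
  have "finite A" using A(1) finite_roots by (rule finite_subset)
  moreover have "(q - p) \<bullet> x \<le> 0" if "x \<in> polar A" for x
    using that q unfolding A(2)[symmetric] by (simp add: normal_cone_at_def inner_diff_left)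
  ultimately have "q - p \<in> convex_cone hull A" by (simp add: mem_convex_cone_hull_finite_iff)
  then show "q - p \<in> convex_cone hull {\<alpha>\<in>\<Phi>. p + \<alpha> \<in> B}" using sub by blast
qed

end

section \<open>Transfer along the Riesz isomorphism\<close>

lemma riesz_unique: "(\<And>x. blinfun_apply p x = v \<bullet> x) \<Longrightarrow> riesz p = v"
proof -
  assume v: "\<And>x. blinfun_apply p x = v \<bullet> x"
  show "riesz p = v"
    unfolding riesz_def
  proof (rule the_equality)
    fix v' assume "\<forall>x. blinfun_apply p x = v' \<bullet> x"
    then have "\<forall>x. v' \<bullet> x = v \<bullet> x" using v by simp
    then show "v' = v" by (simp only: vector_eq_rdot)
  qed (simp add: v)
qed

lemma apply_eq_riesz: "blinfun_apply p x = riesz p \<bullet> x"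
proof -
  have lin: "linear (blinfun_apply p)" by (rule bounded_linear.linear[OF blinfun.bounded_linear_right])
  have "blinfun_apply p x = adjoint (blinfun_apply p) 1 \<bullet> x" for x
    using adjoint_works[OF lin, of x 1] by (simp add: inner_commute)
  then show ?thesis using riesz_unique by metis
qed

lemma linear_riesz: "linear riesz"
  by (intro linearI riesz_unique)
    (simp_all add: blinfun.add_left blinfun.scaleR_left inner_add_left flip: apply_eq_riesz)

lemma riesz_diff: "riesz (p - q) = riesz p - riesz q"
  by (rule linear_diff[OF linear_riesz])

lemma riesz_scaleR: "riesz (c *\<^sub>R p) = c *\<^sub>R riesz p"
  by (rule linear_scale[OF linear_riesz])

lemma riesz_add: "riesz (p + q) = riesz p + riesz q"
  by (rule linear_add[OF linear_riesz])

lemma riesz_neg: "riesz (- p) = - riesz p"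
  by (rule linear_neg[OF linear_riesz])

lemma inj_riesz: "inj riesz"
  by (rule injI) (metis apply_eq_riesz blinfun_eqI)

lemma riesz_eq_iff: "riesz p = riesz q \<longleftrightarrow> p = q"
  using inj_riesz by (auto dest: injD)

lemma surj_riesz: "surj riesz"
proof (rule surjI)
  show "riesz (blinfun_inner_left v) = v" for v
    by (rule riesz_unique) (simp add: inner_commute)
qed

lemma riesz_image_eq_iff: "riesz ` A = riesz ` C \<longleftrightarrow> A = C"
  by (rule inj_image_eq_iff[OF inj_riesz])

lemma riesz_mem_image_iff: "riesz p \<in> riesz ` A \<longleftrightarrow> p \<in> A"
  by (rule inj_image_mem_iff[OF inj_riesz])

lemma all_riesz: "(\<forall>v. Q v) \<longleftrightarrow> (\<forall>p. Q (riesz p))"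
  using surj_riesz by (metis surjD)

lemma ex_riesz_image: "(\<exists>A. Q A) \<longleftrightarrow> (\<exists>A. Q (riesz ` A))"
  by (metis surj_riesz surj_image_vimage_eq)

lemma all_riesz_image: "(\<forall>A. Q A) \<longleftrightarrow> (\<forall>A. Q (riesz ` A))"
  by (metis surj_riesz surj_image_vimage_eq)

text \<open>The bound of the operator norm is sharp at the representing vector itself. Since
  \<open>riesz\<close> is thus an isometry, closures correspond.\<close>

lemma norm_riesz: "norm (riesz p) = norm p"
proof (rule antisym)
  have "norm (riesz p) * norm (riesz p) \<le> norm p * norm (riesz p)"
    using norm_blinfun[of p "riesz p"]
    by (simp add: apply_eq_riesz norm_eq_sqrt_inner[symmetric] dot_square_norm power2_eq_square)
  then show "norm (riesz p) \<le> norm p"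
    by (cases "norm (riesz p) = 0") (auto simp: mult_le_cancel_right)
  show "norm p \<le> norm (riesz p)"
    by (rule norm_blinfun_bound) (auto simp: apply_eq_riesz Cauchy_Schwarz_ineq2)
qed

lemma riesz_closure: "riesz ` closure A = closure (riesz ` A)"
proof -
  have iff: "riesz p \<in> closure (riesz ` A) \<longleftrightarrow> p \<in> closure A" for p
    by (simp add: closure_approachable dist_norm norm_riesz flip: riesz_diff)
  show ?thesis
  proof (rule set_eqI)
    fix v show "v \<in> riesz ` closure A \<longleftrightarrow> v \<in> closure (riesz ` A)"
      using surjD[OF surj_riesz, of v] iff riesz_mem_image_iff by metis
  qed
qed

lemma riesz_closed: "closed (riesz ` A) \<longleftrightarrow> closed A"
  by (metis closure_eq riesz_closure riesz_image_eq_iff)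

lemma riesz_convex_hull: "riesz ` (convex hull A) = convex hull (riesz ` A)"
  by (rule convex_hull_linear_image[OF linear_riesz])

lemma riesz_convex: "convex (riesz ` A) \<longleftrightarrow> convex A"
  by (metis convex_hull_eq riesz_convex_hull riesz_image_eq_iff)

lemma riesz_convex_cone_hull: "riesz ` (convex_cone hull A) = convex_cone hull (riesz ` A)"
  by (rule convex_cone_hull_linear_image[OF linear_riesz, symmetric])

lemma riesz_mem_convex_cone_hull: "riesz p \<in> convex_cone hull (riesz ` A) \<longleftrightarrow> p \<in> convex_cone hull A"
  by (simp add: riesz_mem_image_iff flip: riesz_convex_cone_hull)

lemma riesz_span: "span (riesz ` A) = riesz ` span A"
  by (rule linear_span_image[OF linear_riesz])

lemma riesz_independent:
  fixes A :: "'a::euclidean_space dual set"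
  shows "independent (riesz ` A) \<longleftrightarrow> independent A"
proof
  assume "independent A"
  then show "independent (riesz ` A)"
    by (rule linear_independent_injective_image[OF linear_riesz]) (meson inj_on_subset inj_riesz subset_UNIV)
next
  define h where "h v = (blinfun_inner_left v :: 'a dual)" for v :: 'a
  have h: "riesz (h v) = v" for v
    unfolding h_def by (rule riesz_unique) (simp add: inner_commute)
  then have "linear h"
    by (intro linearI) (simp_all add: riesz_add riesz_scaleR flip: riesz_eq_iff)
  moreover have "inj h" by (metis h injI)
  moreover assume "independent (riesz ` A)"
  ultimately have "independent (h ` riesz ` A)"
    by (intro linear_independent_injective_image[of h]) (auto intro: inj_on_subset)
  moreover have "h (riesz p) = p" for p using h riesz_eq_iff by blast
  ultimately show "independent A" by (simp add: image_image)
qed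

lemma coroot_eq: "coroot \<alpha> = (2 / (riesz \<alpha> \<bullet> riesz \<alpha>)) *\<^sub>R riesz \<alpha>"
  by (simp add: coroot_def dot_square_norm flip: norm_riesz)

lemma apply_coroot: "blinfun_apply \<beta> (coroot \<alpha>) = 2 * (riesz \<beta> \<bullet> riesz \<alpha>) / (riesz \<alpha> \<bullet> riesz \<alpha>)"
  by (simp add: apply_eq_riesz coroot_eq)

lemma riesz_reflection:
  "riesz (reflection \<alpha> \<beta>) =
    riesz \<beta> - (2 * (riesz \<beta> \<bullet> riesz \<alpha>) / (riesz \<alpha> \<bullet> riesz \<alpha>)) *\<^sub>R riesz \<alpha>"
  by (simp add: reflection_def riesz_diff riesz_scaleR apply_coroot)

section \<open>Root systems in the dual and their vector images\<close>

locale dual_root_system =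
  fixes \<Phi> :: "'a::euclidean_space dual set"
  assumes root_system: "root_system \<Phi>" and essential: "essential \<Phi>"
begin

lemma root_uminus: "\<alpha> \<in> \<Phi> \<Longrightarrow> - \<alpha> \<in> \<Phi>"
  using root_system unfolding root_system_def by blast

lemma root_multiple: "\<alpha> \<in> \<Phi> \<Longrightarrow> c *\<^sub>R \<alpha> \<in> \<Phi> \<Longrightarrow> c = 1 \<or> c = -1"
proof -
  assume a: "\<alpha> \<in> \<Phi>" "c *\<^sub>R \<alpha> \<in> \<Phi>"
  have "c *\<^sub>R \<alpha> \<in> span {\<alpha>} \<inter> \<Phi>" using a by (auto intro: span_scale span_base)
  then have "c *\<^sub>R \<alpha> = \<alpha> \<or> c *\<^sub>R \<alpha> = - \<alpha>" using root_system a unfolding root_system_def by blast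
  moreover have "\<alpha> \<noteq> 0" using a root_system unfolding root_system_def by blast
  ultimately show ?thesis
    by (metis scaleR_cancel_right scaleR_minus1_left scaleR_one)
qed

sublocale reflection_arrangement "riesz ` \<Phi>"
proof
  show "finite (riesz ` \<Phi>)" using root_system by (simp add: root_system_def)
  show "- \<alpha> \<in> riesz ` \<Phi>" if "\<alpha> \<in> riesz ` \<Phi>" for \<alpha>
    using that root_uminus by (auto simp: riesz_neg[symmetric])
  show "span (riesz ` \<Phi>) = UNIV"
    using essential surj_riesz by (simp add: riesz_span essential_def)
  show "0 \<notin> riesz ` \<Phi>"
  proof -
    have "riesz 0 \<notin> riesz ` \<Phi>" using root_system by (simp add: riesz_mem_image_iff root_system_def)
    then show ?thesis by (simp only: linear_0[OF linear_riesz] not_False_eq_True)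
  qed
  fix \<alpha> \<beta> assume "\<alpha> \<in> riesz ` \<Phi>" "\<beta> \<in> riesz ` \<Phi>"
  then obtain a b where ab: "a \<in> \<Phi>" "b \<in> \<Phi>" "\<alpha> = riesz a" "\<beta> = riesz b" by blast
  have "reflection a b \<in> \<Phi>" "blinfun_apply b (coroot a) \<in> \<int>"
    using root_system ab unfolding root_system_def by blast+
  then show "\<beta> - (2 * (\<beta> \<bullet> \<alpha>) / (\<alpha> \<bullet> \<alpha>)) *\<^sub>R \<alpha> \<in> riesz ` \<Phi>"
    "2 * (\<beta> \<bullet> \<alpha>) / (\<alpha> \<bullet> \<alpha>) \<in> \<int>"
    unfolding ab apply_coroot riesz_reflection[symmetric] by auto
next
  fix \<alpha> and c :: real assume *: "\<alpha> \<in> riesz ` \<Phi>" "c *\<^sub>R \<alpha> \<in> riesz ` \<Phi>"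
  then obtain a where a: "a \<in> \<Phi>" "\<alpha> = riesz a" by blast
  have "c *\<^sub>R a \<in> \<Phi>" using *(2) unfolding a(2) riesz_scaleR[symmetric] riesz_mem_image_iff .
  then show "c = 1 \<or> c = - 1" by (rule root_multiple[OF a(1)])
qed

lemma lattice_eq: "lattice = riesz ` root_lattice \<Phi>"
proof -
  have sum: "(\<Sum>\<alpha>\<in>riesz ` \<Phi>. of_int (c \<alpha>) *\<^sub>R \<alpha>) = riesz (\<Sum>\<alpha>\<in>\<Phi>. of_int (c (riesz \<alpha>)) *\<^sub>R \<alpha>)" for c
    by (subst sum.reindex)
      (auto simp: linear_sum[OF linear_riesz] riesz_scaleR intro: inj_on_subset[OF inj_riesz])
  show ?thesis
  proof
    show "lattice \<subseteq> riesz ` root_lattice \<Phi>"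
    proof
      fix v assume "v \<in> lattice"
      then obtain c where v: "v = riesz (\<Sum>\<alpha>\<in>\<Phi>. of_int ((c \<circ> riesz) \<alpha>) *\<^sub>R \<alpha>)"
        unfolding lattice_def sum o_def by blast
      have "(\<Sum>\<alpha>\<in>\<Phi>. of_int ((c \<circ> riesz) \<alpha>) *\<^sub>R \<alpha>) \<in> root_lattice \<Phi>"
        unfolding root_lattice_def by (intro CollectI exI[of _ "c \<circ> riesz"]) simp
      then show "v \<in> riesz ` root_lattice \<Phi>" unfolding v by (rule imageI)
    qed
    show "riesz ` root_lattice \<Phi> \<subseteq> lattice"
    proof
      fix v assume "v \<in> riesz ` root_lattice \<Phi>"
      then obtain c :: "'a dual \<Rightarrow> int" where v: "v = riesz (\<Sum>\<alpha>\<in>\<Phi>. of_int (c \<alpha>) *\<^sub>R \<alpha>)"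
        unfolding root_lattice_def by blast
      have "v = (\<Sum>\<alpha>\<in>riesz ` \<Phi>. of_int ((c \<circ> inv riesz) \<alpha>) *\<^sub>R \<alpha>)"
        unfolding sum v by (simp add: inv_f_f[OF inj_riesz])
      then show "v \<in> lattice" unfolding lattice_def by (intro CollectI exI conjI TrueI)
    qed
  qed
qed

lemma M_convex_polyhedron_iff: "M_convex_polyhedron \<Phi> P \<longleftrightarrow> M_polyhedron (riesz ` P)"
proof -
  have tangent: "M_convex_cone \<Phi> (tangent_cone P p) \<longleftrightarrow>
      (\<exists>A\<subseteq>riesz ` \<Phi>. normal_cone_at (riesz ` P) (riesz p) = polar A)" for p
  proof -
    have "riesz ` (tangent_cone P p) = closure (convex_cone hull ((\<lambda>q. q - riesz p) ` (riesz ` P)))"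
      unfolding tangent_cone_def riesz_closure riesz_convex_cone_hull
      by (simp add: image_image riesz_diff)
    then have "tangent_cone P p = convex_cone hull \<Phi>' \<longleftrightarrow>
        normal_cone_at (riesz ` P) (riesz p) = polar (riesz ` \<Phi>')" if "\<Phi>' \<subseteq> \<Phi>" for \<Phi>'
      using tangent_is_finite_cone_iff[of "riesz ` \<Phi>'" "riesz p" "riesz ` P"] finite_roots that
      by (metis finite_subset image_mono riesz_convex_cone_hull riesz_image_eq_iff)
    then show ?thesis unfolding M_convex_cone_def by (metis subset_image_iff)
  qed
  show ?thesis
    unfolding M_convex_polyhedron_def M_polyhedron_def
    by (simp add: riesz_closed riesz_convex tangent)
qed

lemma hole_free_iff: "hole_free \<Phi> B \<longleftrightarrow> riesz ` B = convex hull (riesz ` B) \<inter> lattice"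
  unfolding hole_free_def lattice_eq riesz_convex_hull[symmetric] image_Int[OF inj_riesz, symmetric]
    riesz_image_eq_iff ..

lemma M_convex_set_iff:
  assumes "B \<noteq> {}" "B \<subseteq> root_lattice \<Phi>"
  shows "M_convex_set \<Phi> B \<longleftrightarrow> M_set (riesz ` B)"
proof -
  have "M_convex_set \<Phi> B \<longleftrightarrow> M_convex_polyhedron \<Phi> (convex hull B) \<and> hole_free \<Phi> B"
    unfolding M_convex_set_def integral_M_convex_polyhedron_def hole_free_def using assms by metis
  then show ?thesis
    unfolding M_convex_polyhedron_iff riesz_convex_hull hole_free_iff M_set_def .
qed

lemma simple_system_iff: "simple_system \<Phi> \<Delta> \<longleftrightarrow> simple (riesz ` \<Delta>)"
proof -
  have "span \<Delta> = UNIV \<longleftrightarrow> span (riesz ` \<Delta>) = UNIV"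
    by (metis riesz_image_eq_iff riesz_span surj_riesz)
  then show ?thesis
    unfolding simple_system_def simple_def
    by (simp add: inj_image_subset_iff[OF inj_riesz] riesz_independent riesz_mem_convex_cone_hull
        flip: riesz_neg)
qed

lemma simple_le_iff:
  assumes "simple_system \<Phi> \<Delta>"
  shows "simple_le \<Delta> p q \<longleftrightarrow> riesz q - riesz p \<in> convex_cone hull (riesz ` \<Delta>)"
proof -
  have \<Delta>: "independent \<Delta>" "span \<Delta> = UNIV" "finite \<Delta>"
    using assms root_system finite_subset unfolding simple_system_def root_system_def by auto
  have rep: "(\<Sum>\<alpha>\<in>\<Delta>. representation \<Delta> v \<alpha> *\<^sub>R \<alpha>) = v" for v
    by (rule sum_representation_eq) (use \<Delta> in auto)
  have diff: "representation \<Delta> (q - p) \<alpha> = representation \<Delta> q \<alpha> - representation \<Delta> p \<alpha>" for \<alpha>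
    by (simp add: representation_diff \<Delta>)
  have "simple_le \<Delta> p q \<longleftrightarrow> q - p \<in> convex_cone hull \<Delta>"
    unfolding convex_cone_hull_finite[OF \<Delta>(3)]
  proof
    assume "simple_le \<Delta> p q"
    then have "\<forall>\<alpha>\<in>\<Delta>. 0 \<le> representation \<Delta> (q - p) \<alpha>" by (simp add: simple_le_def diff)
    then show "q - p \<in> {\<Sum>\<alpha>\<in>\<Delta>. c \<alpha> *\<^sub>R \<alpha> | c. \<forall>\<alpha>\<in>\<Delta>. 0 \<le> c \<alpha>}"
      using rep[of "q - p"] by (intro CollectI exI[of _ "representation \<Delta> (q - p)"]) simp
  next
    assume "q - p \<in> {\<Sum>\<alpha>\<in>\<Delta>. c \<alpha> *\<^sub>R \<alpha> | c. \<forall>\<alpha>\<in>\<Delta>. 0 \<le> c \<alpha>}"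
    then obtain c where c: "q - p = (\<Sum>\<alpha>\<in>\<Delta>. c \<alpha> *\<^sub>R \<alpha>)" "\<forall>\<alpha>\<in>\<Delta>. 0 \<le> c \<alpha>" by blast
    have "(\<Sum>\<alpha>\<in>\<Delta>. (representation \<Delta> (q - p) \<alpha> - c \<alpha>) *\<^sub>R \<alpha>) = 0"
      using rep[of "q - p"] c(1) by (simp add: scaleR_diff_left sum_subtractf)
    then have "representation \<Delta> (q - p) \<alpha> = c \<alpha>" if "\<alpha> \<in> \<Delta>" for \<alpha>
      using independentD[OF \<Delta>(1,3) order_refl _ that, of "\<lambda>\<alpha>. representation \<Delta> (q - p) \<alpha> - c \<alpha>"] by simp
    then have "0 \<le> representation \<Delta> (q - p) \<alpha>" if "\<alpha> \<in> \<Delta>" for \<alpha> using c(2) that by simp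
    then show "simple_le \<Delta> p q" by (simp add: simple_le_def diff)
  qed
  then show ?thesis by (simp add: riesz_mem_convex_cone_hull flip: riesz_diff)
qed

lemma maximality_property_iff: "maximality_property \<Phi> B \<longleftrightarrow> maximality (riesz ` B)"
proof -
  have "maximality (riesz ` B) \<longleftrightarrow> (\<forall>p\<in>B. \<forall>q\<in>B. \<forall>\<Delta>. simple (riesz ` \<Delta>) \<longrightarrow>
      (\<exists>r\<in>B. riesz r - riesz p \<in> convex_cone hull (riesz ` \<Delta>) \<and>
        riesz r - riesz q \<in> convex_cone hull (riesz ` \<Delta>)))"
    unfolding maximality_def ball_simps bex_simps by (subst all_riesz_image) (rule refl)
  then show ?thesis
    unfolding maximality_property_def by (auto simp: simple_le_iff simple_system_iff[symmetric])
qed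

lemma root_cone_property_iff: "root_cone_property \<Phi> B \<longleftrightarrow> root_cone (riesz ` B)"
proof -
  have "{\<alpha> \<in> riesz ` \<Phi>. riesz p + \<alpha> \<in> riesz ` B} = riesz ` {\<alpha>\<in>\<Phi>. p + \<alpha> \<in> B}" for p
    by (auto simp: riesz_mem_image_iff riesz_eq_iff simp flip: riesz_add)
  then show ?thesis
    unfolding root_cone_property_def root_cone_def
    by (simp add: riesz_mem_convex_cone_hull flip: riesz_diff)
qed

lemma spherical_expression_iff: "spherical_expression \<Phi> S \<longleftrightarrow> spherical S"
proof -
  have "coxeter_cell \<Phi> = open_cell"
    by (auto simp: coxeter_cell_def open_cell_def apply_eq_riesz fun_eq_iff)
  then show ?thesis
    by (simp add: spherical_expression_def spherical_def coxeter_vertices_def rays_def)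
qed

lemma integral_L_sublinear_iff: "integral_L_sublinear \<Phi> \<sigma> \<longleftrightarrow> integral_L_sub \<sigma>"
proof -
  have cone: "L_convex_cone \<Phi> C \<longleftrightarrow> (\<exists>A\<subseteq>riesz ` \<Phi>. C = polar A)" for C :: "'a set"
  proof -
    have "{x. \<forall>\<alpha>\<in>\<Phi>'. blinfun_apply \<alpha> x \<le> 0} = polar (riesz ` \<Phi>')" for \<Phi>' :: "'a dual set"
      by (auto simp: polar_def apply_eq_riesz)
    then have "L_convex_cone \<Phi> C \<longleftrightarrow> (\<exists>\<Phi>'. \<Phi>' \<subseteq> \<Phi> \<and> C = polar (riesz ` \<Phi>'))"
      by (simp only: L_convex_cone_def)
    also have "\<dots> \<longleftrightarrow> (\<exists>A\<subseteq>riesz ` \<Phi>. C = polar A)" by (auto simp: subset_image_iff)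
    finally show ?thesis .
  qed
  have "(\<forall>p. argmin (\<lambda>x. \<sigma> x - ereal (riesz p \<bullet> x)) \<noteq> {} \<longrightarrow>
        (\<exists>A\<subseteq>riesz ` \<Phi>. argmin (\<lambda>x. \<sigma> x - ereal (riesz p \<bullet> x)) = polar A)) \<longleftrightarrow>
      (\<forall>v. argmin (\<lambda>x. \<sigma> x - ereal (v \<bullet> x)) \<noteq> {} \<longrightarrow>
        (\<exists>A\<subseteq>riesz ` \<Phi>. argmin (\<lambda>x. \<sigma> x - ereal (v \<bullet> x)) = polar A))"
    by (rule all_riesz[symmetric])
  then have 1: "L_sublinear \<Phi> \<sigma> \<longleftrightarrow> L_sub \<sigma>"
    unfolding L_sublinear_def L_sub_def cone apply_eq_riesz by (simp only:)
  have 2: "(\<exists>B\<^sub>0. finite B\<^sub>0 \<and> B\<^sub>0 \<noteq> {} \<and> B\<^sub>0 \<subseteq> root_lattice \<Phi> \<and>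
        (\<forall>x. \<sigma> x < \<infinity> \<longrightarrow> \<sigma> x = ereal (Max ((\<lambda>p. blinfun_apply p x) ` B\<^sub>0)))) \<longleftrightarrow>
     (\<exists>B\<^sub>0. finite B\<^sub>0 \<and> B\<^sub>0 \<noteq> {} \<and> B\<^sub>0 \<subseteq> lattice \<and>
        (\<forall>x. \<sigma> x < \<infinity> \<longrightarrow> \<sigma> x = ereal (Max ((\<lambda>p. p \<bullet> x) ` B\<^sub>0))))"
    by (subst ex_riesz_image)
      (simp add: lattice_eq image_image apply_eq_riesz inj_image_subset_iff[OF inj_riesz]
        finite_image_iff[OF inj_on_subset[OF inj_riesz]])
  show ?thesis unfolding integral_L_sublinear_def integral_L_sub_def 1 2 ..
qed

lemma riesz_base_polyhedron: "riesz ` base_polyhedron S \<rho> = base S \<rho>"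
proof (rule set_eqI)
 fix v :: 'a
  obtain p where "v = riesz p" using surjD[OF surj_riesz] by blast
  then show "v \<in> riesz ` base_polyhedron S \<rho> \<longleftrightarrow> v \<in> base S \<rho>"
    by (simp add: riesz_mem_image_iff base_polyhedron_def base_def apply_eq_riesz)
qed

lemma spherical_submodular_iff:
  "(\<exists>S \<rho>. integral_spherical_submodular \<Phi> S \<rho> \<and> B = base_polyhedron S \<rho> \<inter> root_lattice \<Phi>) \<longleftrightarrow>
    (\<exists>S \<sigma>. spherical S \<and> integral_L_sub \<sigma> \<and> riesz ` B = base S \<sigma> \<inter> lattice)"
proof -
  have "B = base_polyhedron S \<rho> \<inter> root_lattice \<Phi> \<longleftrightarrow> riesz ` B = base S \<rho> \<inter> lattice" for S \<rho>
    unfolding lattice_eq riesz_base_polyhedron[symmetric] image_Int[OF inj_riesz, symmetric]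
      riesz_image_eq_iff ..
  moreover have "base S \<rho> = base S \<sigma>" if "\<forall>x\<in>S. \<rho> x = \<sigma> x" for S \<rho> \<sigma>
    using that by (simp add: base_def)
  ultimately show ?thesis
    unfolding integral_spherical_submodular_def spherical_expression_iff integral_L_sublinear_iff
    by (metis (no_types, lifting))
qed

text \<open>A smallest set of roots that contains \<alpha> and is orthogonal to its complement in
  \<Phi>. An orthogonal splitting of it would produce a smaller set of this kind.\<close>

lemma ex_irreducible_component:
  assumes "\<alpha> \<in> \<Phi>"
  obtains \<Psi> where "irreducible_component \<Phi> \<Psi>" "\<alpha> \<in> \<Psi>"
proof -
  define closed_off where "closed_off \<Psi> \<longleftrightarrow> \<Psi> \<subseteq> \<Phi> \<and> \<alpha> \<in> \<Psi> \<and> (\<forall>\<beta>\<in>\<Psi>. \<forall>\<gamma>\<in>\<Phi> - \<Psi>. dual_inner \<beta> \<gamma> = 0)" for \<Psi>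
  have "closed_off \<Phi>" using assms by (simp add: closed_off_def)
  then obtain \<Psi> where \<Psi>: "closed_off \<Psi>" and least: "\<And>\<Psi>'. closed_off \<Psi>' \<Longrightarrow> card \<Psi> \<le> card \<Psi>'"
    using ex_has_least_nat[of closed_off \<Phi> card] by blast
  have sub: "\<Psi> \<subseteq> \<Phi>" and a: "\<alpha> \<in> \<Psi>" and orth: "\<And>\<beta> \<gamma>. \<beta> \<in> \<Psi> \<Longrightarrow> \<gamma> \<in> \<Phi> \<Longrightarrow> \<gamma> \<notin> \<Psi> \<Longrightarrow> dual_inner \<beta> \<gamma> = 0"
    using \<Psi> by (auto simp: closed_off_def)
  have fin: "finite \<Psi>" using sub root_system finite_subset unfolding root_system_def by blast
  have nz: "riesz \<beta> \<bullet> riesz \<beta> \<noteq> 0" if "\<beta> \<in> \<Psi>" for \<beta>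
    using that sub zero_notin by force
  have neg: "- \<beta> \<in> \<Psi>" if b: "\<beta> \<in> \<Psi>" for \<beta>
  proof (rule ccontr)
    assume "- \<beta> \<notin> \<Psi>"
    then have "dual_inner \<beta> (- \<beta>) = 0" using orth[OF b] root_uminus b sub by blast
    then show False using nz[OF b] by (simp add: dual_inner_def riesz_neg)
  qed
  \<comment> \<open>If the reflected root left \<Psi>, it would be orthogonal to \<beta>; then so is
    \<gamma>, and the reflection fixes \<gamma>.\<close>
  have refl: "reflection \<beta> \<gamma> \<in> \<Psi>" if b: "\<beta> \<in> \<Psi>" and c: "\<gamma> \<in> \<Psi>" for \<beta> \<gamma>
  proof (rule ccontr)
    assume not: "reflection \<beta> \<gamma> \<notin> \<Psi>"
    have "reflection \<beta> \<gamma> \<in> \<Phi>" using root_system b c sub unfolding root_system_def by blast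
    then have "dual_inner \<beta> (reflection \<beta> \<gamma>) = 0" using orth[OF b] not by blast
    then have "riesz \<beta> \<bullet> riesz \<gamma> = 0"
      using nz[OF b] by (simp add: dual_inner_def riesz_reflection inner_diff_right inner_commute)
    then have "riesz (reflection \<beta> \<gamma>) = riesz \<gamma>" by (simp add: riesz_reflection inner_commute)
    then show False using not c by (simp add: riesz_eq_iff)
  qed
  have "span {\<beta>} \<inter> \<Psi> = {\<beta>, - \<beta>}" if b: "\<beta> \<in> \<Psi>" for \<beta>
  proof -
    have "span {\<beta>} \<inter> \<Phi> = {\<beta>, - \<beta>}" using root_system b sub unfolding root_system_def by blast
    then show ?thesis using sub b neg[OF b] by blast
  qed
  then have rs: "root_system \<Psi>"
    using root_system sub refl fin a unfolding root_system_def by blast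
  have "\<not> (\<exists>\<Psi>\<^sub>1 \<Psi>\<^sub>2. \<Psi>\<^sub>1 \<noteq> {} \<and> \<Psi>\<^sub>2 \<noteq> {} \<and> \<Psi>\<^sub>1 \<inter> \<Psi>\<^sub>2 = {} \<and> \<Psi> = \<Psi>\<^sub>1 \<union> \<Psi>\<^sub>2 \<and>
      (\<forall>\<alpha>\<in>\<Psi>\<^sub>1. \<forall>\<beta>\<in>\<Psi>\<^sub>2. dual_inner \<alpha> \<beta> = 0))"
  proof clarify
    fix \<Psi>\<^sub>1 \<Psi>\<^sub>2 assume *: "\<Psi>\<^sub>1 \<noteq> {}" "\<Psi>\<^sub>2 \<noteq> {}" "\<Psi>\<^sub>1 \<inter> \<Psi>\<^sub>2 = {}" "\<Psi> = \<Psi>\<^sub>1 \<union> \<Psi>\<^sub>2"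
      "\<forall>\<alpha>\<in>\<Psi>\<^sub>1. \<forall>\<beta>\<in>\<Psi>\<^sub>2. dual_inner \<alpha> \<beta> = 0"
    have comm: "dual_inner \<beta> \<gamma> = dual_inner \<gamma> \<beta>" for \<beta> \<gamma> by (simp add: dual_inner_def inner_commute)
    have small: "card X < card \<Psi>" if "X \<subset> \<Psi>" for X using psubset_card_mono[OF fin that] .
    have "closed_off \<Psi>\<^sub>1 \<or> closed_off \<Psi>\<^sub>2"
    proof (cases "\<alpha> \<in> \<Psi>\<^sub>1")
      case True
      then have "closed_off \<Psi>\<^sub>1" unfolding closed_off_def using * sub orth by blast
      then show ?thesis ..
    next
      case False
      then have "closed_off \<Psi>\<^sub>2" unfolding closed_off_def using * sub orth a comm by (metis Diff_iff Un_iff le_sup_iff)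
      then show ?thesis ..
    qed
    moreover have "\<Psi>\<^sub>1 \<subset> \<Psi>" "\<Psi>\<^sub>2 \<subset> \<Psi>" using * by blast+
    ultimately show False using least small by (meson not_le)
  qed
  then have "irreducible_component \<Phi> \<Psi>"
    unfolding irreducible_component_def irreducible_root_system_def using sub rs orth by blast
  then show thesis using that a by blast
qed

lemma classical_component:
  assumes "irreducible_component \<Phi> \<Psi>" "classical_type \<Psi>"
  shows "classical (riesz ` \<Psi>)"
proof -
  obtain n N R where iso: "iso_to_model \<Psi> N R" and R: "R \<in> {model_A n, model_B n, model_C n, model_D n}"
    using assms(2) unfolding classical_type_def by blast
  obtain f :: "'a dual \<Rightarrow> nat \<Rightarrow> real" where f: "\<And>k. linear (\<lambda>p. f p k)" "inj_on f (span \<Psi>)" "f ` \<Psi> = R"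
    using iso unfolding iso_to_model_def by blast
  define g where "g = f \<circ> inv riesz"
  have g: "g (riesz p) = f p" for p by (simp add: g_def inv_f_f[OF inj_riesz])
  have "linear (\<lambda>q. g q k)" for k
  proof (rule linearI)
    fix x y :: 'a and c :: real
    obtain p q where "x = riesz p" "y = riesz q" using surj_riesz by (metis surjD)
    then show "g (x + y) k = g x k + g y k" "g (c *\<^sub>R x) k = c *\<^sub>R g x k"
      using linear_add[OF f(1)] linear_scale[OF f(1)] by (simp_all add: g flip: riesz_add riesz_scaleR)
  qed
  moreover have "inj_on g (span (riesz ` \<Psi>))"
    unfolding riesz_span using f(2) by (auto simp: inj_on_def g)
  moreover have "g ` riesz ` \<Psi> = R" using f(3) by (simp add: image_image g)
  moreover have "riesz ` \<Psi> \<subseteq> riesz ` \<Phi>" using assms(1) unfolding irreducible_component_def by blast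
  moreover have "\<forall>\<alpha>\<in>riesz ` \<Psi>. \<forall>\<beta>\<in>riesz ` \<Phi> - riesz ` \<Psi>. \<alpha> \<bullet> \<beta> = 0"
    using assms(1) unfolding irreducible_component_def dual_inner_def by blast
  ultimately show ?thesis using R unfolding classical_def by blast
qed

end

theorem theorem7p5:
  fixes \<Phi> B :: "'a::euclidean_space dual set"
  assumes "root_system \<Phi>"
    and "essential \<Phi>"
    and "\<And>\<Psi>. irreducible_component \<Phi> \<Psi> \<Longrightarrow> classical_type \<Psi>"
    and "B \<noteq> {}"
    and "B \<subseteq> root_lattice \<Phi>"
  shows
    "(M_convex_set \<Phi> B \<longleftrightarrow>
        (\<exists>S \<rho>. integral_spherical_submodular \<Phi> S \<rho> \<and>
               B = base_polyhedron S \<rho> \<inter> root_lattice \<Phi>)) \<and>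
     (M_convex_set \<Phi> B \<longleftrightarrow> hole_free \<Phi> B \<and> maximality_property \<Phi> B) \<and>
     (M_convex_set \<Phi> B \<longleftrightarrow> hole_free \<Phi> B \<and> root_cone_property \<Phi> B)"
proof -
  interpret dual_root_system \<Phi> by unfold_locales (fact assms)+
  have M: "M_convex_set \<Phi> B \<longleftrightarrow> M_set (riesz ` B)" by (rule M_convex_set_iff) (fact assms)+
  have ne: "riesz ` B \<noteq> {}" using assms(4) by simp
  have "M_set (riesz ` B) \<longleftrightarrow> (\<exists>S \<sigma>. spherical S \<and> integral_L_sub \<sigma> \<and> riesz ` B = base S \<sigma> \<inter> lattice)"
  proof
    assume B: "M_set (riesz ` B)"
    obtain S where S: "spherical S" using ex_spherical ..
    obtain \<sigma> where \<sigma>: "integral_L_sub \<sigma>" "\<And>S. spherical S \<Longrightarrow> base S \<sigma> = convex hull (riesz ` B)"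
      by (rule M_set_imp_integral_L_sub[OF B]) (rule that)
    have "riesz ` B = base S \<sigma> \<inter> lattice"
      using B unfolding \<sigma>(2)[OF S] M_set_def by blast
    then show "\<exists>S \<sigma>. spherical S \<and> integral_L_sub \<sigma> \<and> riesz ` B = base S \<sigma> \<inter> lattice"
      using S \<sigma>(1) by blast
  next
    assume "\<exists>S \<sigma>. spherical S \<and> integral_L_sub \<sigma> \<and> riesz ` B = base S \<sigma> \<inter> lattice"
    then show "M_set (riesz ` B)" using integral_L_sub_imp_M_set by blast
  qed
  moreover have "M_set (riesz ` B) \<longleftrightarrow> hole_free \<Phi> B \<and> maximality (riesz ` B)"
    using M_set_imp_maximality maximality_imp_M_set[OF ne] unfolding hole_free_iff M_set_def by blast
  moreover have "\<exists>\<Psi>. classical \<Psi> \<and> \<alpha> \<in> \<Psi>" if \<alpha>: "\<alpha> \<in> riesz ` \<Phi>" for \<alpha>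
  proof -
    obtain a where a: "a \<in> \<Phi>" "\<alpha> = riesz a" using \<alpha> by blast
    obtain \<Psi> where \<Psi>: "irreducible_component \<Phi> \<Psi>" "a \<in> \<Psi>"
      by (rule ex_irreducible_component[OF a(1)])
    have "classical (riesz ` \<Psi>)" by (rule classical_component[OF \<Psi>(1) assms(3)[OF \<Psi>(1)]])
    then show ?thesis using \<Psi>(2) a(2) by blast
  qed
  then have "M_set (riesz ` B) \<longleftrightarrow> hole_free \<Phi> B \<and> root_cone (riesz ` B)"
    using M_set_imp_root_cone root_cone_imp_M_set[OF ne] unfolding hole_free_iff M_set_def by blast
  ultimately show ?thesis
    unfolding M spherical_submodular_iff maximality_property_iff root_cone_property_iff by blast
qed

end
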